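(* Let $n\ge 3$. There is no complete $C^{n+1}$ hypersurface of one end with zero scalar curvature in $\mathbb{R}^{n+1}$ which is identical to a Schwarzschild solution with $m>0$ outside a compact set. In other words, hyperplanes are the only complete one-ended scalar-flat $C^{n+1}$ hypersurfaces in Euclidean space $\mathbb{R}^{n+1}$ which are rotationally symmetric outside a compact set.
   Context: A hypersurface of $\mathbb{R}^{n+1}$ is said to be identical to a Schwarzschild solution (of mass $m>0$) outside a compact set if, outside a compact set of a hyperplane $\mathbb{R}^n$, it is the graph of the rotationally symmetric function \[ h(x)=C_0+\int_{r_0}^{|x|}\sqrt{\frac{2m}{s^{n-2}-2m}}\,ds,\qquad |x|\ge r_0=(2m)^{1/(n-2)}, \] for some constant $C_0$ (the graph of $h$ is the exterior region of the Schwarzschild solution of mass $m$). Scalar-flat means that the scalar curvature of the induced metric vanishes identically. *)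

theory Defs
  imports "HOL-Analysis.Analysis"
begin

section \<open>Maps of class $C^k$\<close>

definition partial_deriv ::
  "'n::finite \<Rightarrow> (real^'n \<Rightarrow> 'b::real_normed_vector) \<Rightarrow> real^'n \<Rightarrow> 'b" where
  "partial_deriv i F u = frechet_derivative F (at u) (axis i 1)"

text \<open>Intended for open \<open>S\<close> only.\<close>

primrec C_k_on ::
  "nat \<Rightarrow> (real^'n \<Rightarrow> 'b::real_normed_vector) \<Rightarrow> (real^'n) set \<Rightarrow> bool" where
  "C_k_on 0 F S \<longleftrightarrow> continuous_on S F"
| "C_k_on (Suc k) F S \<longleftrightarrow> F differentiable_on S \<and> (\<forall>i. C_k_on k (partial_deriv i F) S)"


section \<open>Hypersurfaces\<close>

text \<open>
  A hypersurface of \<open>\<real>\<^sup>d\<close> is a connected manifold \<open>M\<close> (an abstract topological space) together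
  with an immersion \<open>f\<close> of \<open>M\<close> into \<open>real^'d\<close>; embedded hypersurfaces are the case where \<open>f\<close> is
  moreover a homeomorphism onto its image, e.g. the inclusion of a subset.

  No atlas has to be specified: a local parametrization is a homeomorphism \<open>\<phi>\<close> of an open set \<open>V\<close>
  of \<open>real^'n\<close> onto an open subset of \<open>M\<close> for which \<open>f \<circ> \<phi>\<close> is a \<open>C\<^sup>k\<close> immersion
  (\<open>k \<ge> 1\<close>). Since \<open>f\<close> is locally injective and a \<open>C\<^sup>k\<close> immersion in every such parametrization,
  the changes of parameters are automatically of class \<open>C\<^sup>k\<close>.
\<close>

definition local_param ::
  "nat \<Rightarrow> 'a topology \<Rightarrow> ('a \<Rightarrow> real^'d) \<Rightarrow> (real^'n) set \<Rightarrow> (real^'n \<Rightarrow> 'a) \<Rightarrow> bool" where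
  "local_param k M f V \<phi> \<longleftrightarrow>
     open V \<and> openin M (\<phi> ` V) \<and> embedding_map (top_of_set V) M \<phi> \<and>
     C_k_on k (f \<circ> \<phi>) V \<and> (\<forall>u\<in>V. inj (frechet_derivative (f \<circ> \<phi>) (at u)))"

definition hypersurface ::
  "'n::finite itself \<Rightarrow> nat \<Rightarrow> 'a topology \<Rightarrow> ('a \<Rightarrow> real^'d) \<Rightarrow> bool" where
  "hypersurface _ k M f \<longleftrightarrow>
     CARD('d) = CARD('n) + 1 \<and>
     connected_space M \<and> Hausdorff_space M \<and> second_countable M \<and>
     (\<forall>x\<in>topspace M. \<exists>V (\<phi> :: real^'n \<Rightarrow> 'a). local_param k M f V \<phi> \<and> x \<in> \<phi> ` V)"


section \<open>Completeness\<close>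

text \<open>
  Lengths of piecewise \<open>C\<^sup>1\<close> curves in \<open>M\<close>, measured in the induced metric. The predicate
  \<^const>\<open>valid_path\<close> admits an unbounded derivative near the finitely many exceptional points, so
  the length integral has to be required to exist.
\<close>

definition curve_lengths ::
  "'a topology \<Rightarrow> ('a \<Rightarrow> real^'d) \<Rightarrow> 'a \<Rightarrow> 'a \<Rightarrow> real set" where
  "curve_lengths M f x y =
     {L. \<exists>\<gamma>. continuous_map (top_of_set {0..1::real}) M \<gamma> \<and> \<gamma> 0 = x \<and> \<gamma> 1 = y \<and>
            valid_path (f \<circ> \<gamma>) \<and>
            ((\<lambda>t. norm (vector_derivative (f \<circ> \<gamma>) (at t))) has_integral L) {0..1}}"

text \<open>
  The value off \<open>topspace M\<close> is irrelevant; it is \<open>0\<close> because the locale \<^locale>\<open>Metric_space\<close>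
  asks for nonnegativity on the whole type.
\<close>

definition riemannian_dist ::
  "'a topology \<Rightarrow> ('a \<Rightarrow> real^'d) \<Rightarrow> 'a \<Rightarrow> 'a \<Rightarrow> real" where
  "riemannian_dist M f x y =
     (if x \<in> topspace M \<and> y \<in> topspace M then Inf (curve_lengths M f x y) else 0)"

definition complete_hypersurface :: "'a topology \<Rightarrow> ('a \<Rightarrow> real^'d) \<Rightarrow> bool" where
  "complete_hypersurface M f \<longleftrightarrow> Metric_space.mcomplete (topspace M) (riemannian_dist M f)"


section \<open>Ends\<close>

text \<open>
  Off every compact set there is exactly one component that is not relatively compact. For
  \<open>K = {}\<close> this forces a connected \<open>M\<close> to be nonempty and noncompact.
\<close>

definition one_ended :: "'a topology \<Rightarrow> bool" where
  "one_ended M \<longleftrightarrow>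
     (\<forall>K. compactin M K \<longrightarrow>
        (\<exists>!C. C \<in> connected_components_of (subtopology M (topspace M - K)) \<and>
              \<not> compactin M (M closure_of C)))"


section \<open>Scalar curvature of the induced metric\<close>

definition induced_metric :: "(real^'n \<Rightarrow> real^'d) \<Rightarrow> real^'n \<Rightarrow> real^'n^'n" where
  "induced_metric F u = (\<chi> i j. partial_deriv i F u \<bullet> partial_deriv j F u)"

definition christoffel :: "(real^'n \<Rightarrow> real^'n^'n) \<Rightarrow> 'n \<Rightarrow> 'n \<Rightarrow> 'n \<Rightarrow> real^'n \<Rightarrow> real" where
  "christoffel g k i j u =
     (\<Sum>l\<in>UNIV. matrix_inv (g u) $ k $ l *
        (partial_deriv i (\<lambda>v. g v $ j $ l) u + partial_deriv j (\<lambda>v. g v $ i $ l) u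
          - partial_deriv l (\<lambda>v. g v $ i $ j) u)) / 2"

definition ricci :: "(real^'n \<Rightarrow> real^'n^'n) \<Rightarrow> 'n \<Rightarrow> 'n \<Rightarrow> real^'n \<Rightarrow> real" where
  "ricci g i j u =
     (\<Sum>k\<in>UNIV. partial_deriv k (christoffel g k i j) u - partial_deriv j (christoffel g k i k) u
        + (\<Sum>l\<in>UNIV. christoffel g k k l u * christoffel g l i j u
                    - christoffel g k j l u * christoffel g l i k u))"

definition scalar_curvature :: "(real^'n \<Rightarrow> real^'n^'n) \<Rightarrow> real^'n \<Rightarrow> real" where
  "scalar_curvature g u = (\<Sum>i\<in>UNIV. \<Sum>j\<in>UNIV. matrix_inv (g u) $ i $ j * ricci g i j u)"

definition scalar_flat ::
  "'n::finite itself \<Rightarrow> nat \<Rightarrow> 'a topology \<Rightarrow> ('a \<Rightarrow> real^'d) \<Rightarrow> bool" where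
  "scalar_flat _ k M f \<longleftrightarrow>
     (\<forall>V (\<phi> :: real^'n \<Rightarrow> 'a). local_param k M f V \<phi> \<longrightarrow>
        (\<forall>u\<in>V. scalar_curvature (induced_metric (f \<circ> \<phi>)) u = 0))"


section \<open>Hyperplanes and Schwarzschild ends\<close>

definition hyperplane :: "real^'d \<Rightarrow> real^'d \<Rightarrow> (real^'d) set" where
  "hyperplane p \<nu> = {z. (z - p) \<bullet> \<nu> = 0}"

definition schwarzschild_radius :: "nat \<Rightarrow> real \<Rightarrow> real" where
  "schwarzschild_radius n m = (2 * m) powr (1 / real (n - 2))"

definition schwarzschild_height :: "nat \<Rightarrow> real \<Rightarrow> real \<Rightarrow> real \<Rightarrow> real" where
  "schwarzschild_height n m C\<^sub>0 r =
     C\<^sub>0 + integral {schwarzschild_radius n m..r} (\<lambda>s. sqrt (2 * m / (s ^ (n - 2) - 2 * m)))"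

text \<open>
  The hyperplane is \<open>hyperplane p \<nu>\<close> with origin \<open>p\<close> and unit normal \<open>\<nu>\<close>, and \<open>K\<close> is the compact
  set of it that is removed; \<open>K\<close> must contain the ball on which the height function is undefined.
  The part of the hypersurface whose orthogonal projection to the hyperplane avoids \<open>K\<close> has to be
  the graph; injectivity says that the graph is covered only once.
\<close>

definition schwarzschild_outside_compact ::
  "nat \<Rightarrow> real \<Rightarrow> 'a topology \<Rightarrow> ('a \<Rightarrow> real^'d) \<Rightarrow> bool" where
  "schwarzschild_outside_compact n m M f \<longleftrightarrow>
     (\<exists>p \<nu> K C\<^sub>0. norm \<nu> = 1 \<and> compact K \<and> K \<subseteq> hyperplane p \<nu> \<and>
        hyperplane p \<nu> \<inter> ball p (schwarzschild_radius n m) \<subseteq> K \<and>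
        (let E = {x \<in> topspace M. f x - ((f x - p) \<bullet> \<nu>) *\<^sub>R \<nu> \<notin> K} in
           inj_on f E \<and>
           f ` E = {y + schwarzschild_height n m C\<^sub>0 (norm (y - p)) *\<^sub>R \<nu> |y.
                      y \<in> hyperplane p \<nu> - K}))"


section \<open>Rotational symmetry\<close>

definition rotations_fixing :: "real^'d \<Rightarrow> (real^'d^'d) set" where
  "rotations_fixing \<nu> = {A. rotation_matrix A \<and> A *v \<nu> = \<nu>}"

text \<open>
  The group of rotations about the line through \<open>p\<close> with direction \<open>\<nu>\<close> acts continuously on
  \<open>M - K\<close>, and \<open>f\<close> is equivariant. If \<open>f\<close> is an embedding, this just says that the set
  \<open>f ` (topspace M - K)\<close> is invariant under these rotations.
\<close>

definition rotationally_symmetric_outside_compact ::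
  "'a topology \<Rightarrow> ('a \<Rightarrow> real^'d) \<Rightarrow> bool" where
  "rotationally_symmetric_outside_compact M f \<longleftrightarrow>
     (\<exists>p \<nu> K \<Phi>. norm \<nu> = 1 \<and> compactin M K \<and>
        (let E = subtopology M (topspace M - K); G = rotations_fixing \<nu> in
           continuous_map (prod_topology (top_of_set G) E) E (\<lambda>(A, x). \<Phi> A x) \<and>
           (\<forall>x\<in>topspace E. \<Phi> (mat 1) x = x) \<and>
           (\<forall>A\<in>G. \<forall>B\<in>G. \<forall>x\<in>topspace E. \<Phi> (A ** B) x = \<Phi> A (\<Phi> B x)) \<and>
           (\<forall>A\<in>G. \<forall>x\<in>topspace E. f (\<Phi> A x) = p + A *v (f x - p))))"

end

theory Submission
  imports Defs
begin

text \<open>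
  By the Gauss equation the scalar curvature of a hypersurface is twice the second elementary
  symmetric function of its principal curvatures, so it is positive wherever the second fundamental
  form is definite. At a maximum of \<open>l \<bullet> f + \<epsilon> \<bar>f\<bar>\<^sup>2\<close> the hypersurface lies on the inner side of a
  sphere that it touches, and the form is definite there. Hence a linear function on a scalar-flat
  hypersurface obeys a maximum principle (\<open>linear_maximum_principle\<close>): no superlevel set
  \<open>{l \<bullet> f \<ge> c}\<close> on which the value \<open>c\<close> is exceeded is compact. This is the only way in which
  scalar-flatness is used away from the end. One-endedness makes it effective, because the
  complement of the end is compact (\<open>one_ended_complement_compact\<close>): it is enough to find a level
  such that the end lies on one side of it and some point of the hypersurface on the other.

  On a Schwarzschild end the height is a strictly increasing function of the distance from the
  axis, so the points below a level of the end form a compact set (\<open>no_schwarzschild_end\<close>).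

  On a rotationally symmetric end with axis direction \<open>\<nu>\<close>, let \<open>w\<close> be the square length of the
  tangential part of \<open>\<nu>\<close> and \<open>r\<close> the distance from the axis. The rotation directions have one common
  principal curvature, scalar-flatness gives the remaining one, and together they make \<open>w r\<^sup>n\<^sup>-\<^sup>2\<close>
  constant (\<open>mass_constant\<close>); on the Schwarzschild end of mass \<open>m\<close> the constant is \<open>2m\<close>. Therefore
  the height is either constant on the whole end, and then on the whole hypersurface by the maximum
  principle, or it has no critical point on the end. In the second case the orbit space of the end is
  a connected one-dimensional manifold on which the height is a local homeomorphism to the line,
  hence injective: every level in the end is a single orbit (\<open>level_is_orbit\<close>). An orbit is compact,
  so removing it from the end leaves an end that lies on one side of its level, which the maximum
  principle excludes. So \<open>f\<close> maps into a hyperplane (\<open>height_constant_on_M\<close>).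

  A complete hypersurface that is mapped into a hyperplane is developed isometrically by \<open>f\<close>: local
  inverses of \<open>f\<close> extend to ever larger balls, because they carry Cauchy sequences to Cauchy
  sequences, and a global inverse makes \<open>f\<close> a homeomorphism onto the hyperplane
  (\<open>in_hyperplane_complete_imp_homeomorphic\<close>). Conversely a hyperplane has all the required
  properties (locale \<open>planar_hypersurface\<close>).
\<close>

section \<open>Partial derivatives\<close>

lemma partial_deriv_eq:
  "(F has_derivative D) (at u) \<Longrightarrow> partial_deriv i F u = D (axis i 1)"
  unfolding partial_deriv_def by (metis frechet_derivative_at)

lemma frechet_eq_sum_partial:
  fixes F :: "real^'n \<Rightarrow> 'b::real_normed_vector"
  assumes "F differentiable (at u)"
  shows "frechet_derivative F (at u) b = (\<Sum>i\<in>UNIV. b $ i *\<^sub>R partial_deriv i F u)"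
proof -
  have lin: "linear (frechet_derivative F (at u))"
    using assms by (rule linear_frechet_derivative)
  have "b = (\<Sum>i\<in>UNIV. b $ i *\<^sub>R axis i 1)"
    by (simp add: vec_eq_iff axis_def if_distrib cong: if_cong)
  then have "frechet_derivative F (at u) b
      = frechet_derivative F (at u) (\<Sum>i\<in>UNIV. b $ i *\<^sub>R axis i 1)" by (rule arg_cong)
  also have "\<dots> = (\<Sum>i\<in>UNIV. b $ i *\<^sub>R partial_deriv i F u)"
    by (simp add: linear_sum[OF lin] linear_cmul[OF lin] partial_deriv_def)
  finally show ?thesis .
qed

lemma has_derivative_sum_partial:
  fixes F :: "real^'n \<Rightarrow> 'b::real_normed_vector"
  assumes "F differentiable (at u)"
  shows "(F has_derivative (\<lambda>b. \<Sum>i\<in>UNIV. b $ i *\<^sub>R partial_deriv i F u)) (at u)"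
proof -
  have "(F has_derivative frechet_derivative F (at u)) (at u)"
    using assms frechet_derivative_works by blast
  moreover have "frechet_derivative F (at u) = (\<lambda>b. \<Sum>i\<in>UNIV. b $ i *\<^sub>R partial_deriv i F u)"
    using frechet_eq_sum_partial[OF assms] by auto
  ultimately show ?thesis by simp
qed

lemma partial_deriv_cong:
  assumes "open V" "u \<in> V" "\<And>v. v \<in> V \<Longrightarrow> F v = G v" "F differentiable (at u)"
  shows "partial_deriv i F u = partial_deriv i G u"
proof -
  have F: "(F has_derivative frechet_derivative F (at u)) (at u)"
    using assms(4) frechet_derivative_works by blast
  then have "(G has_derivative frechet_derivative F (at u)) (at u)"
    using assms by (metis has_derivative_transform_within_open)
  then show ?thesis using F partial_deriv_eq by metis
qed

lemma partial_deriv_sum: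
  assumes "\<And>k. k \<in> A \<Longrightarrow> F k differentiable (at u)"
  shows "partial_deriv i (\<lambda>v. \<Sum>k\<in>A. F k v) u = (\<Sum>k\<in>A. partial_deriv i (F k) u)"
  using partial_deriv_eq[OF has_derivative_sum[of A F, OF assms[unfolded frechet_derivative_works]]]
  by (simp add: partial_deriv_def)

lemma partial_deriv_inner:
  fixes F :: "real^'n \<Rightarrow> 'b::real_inner"
  assumes "F differentiable (at u)" "G differentiable (at u)"
  shows "partial_deriv i (\<lambda>v. F v \<bullet> G v) u = F u \<bullet> partial_deriv i G u + partial_deriv i F u \<bullet> G u"
  using partial_deriv_eq[OF has_derivative_inner[OF assms[unfolded frechet_derivative_works]]]
  by (simp add: partial_deriv_def)

lemma partial_deriv_mult:
  fixes F :: "real^'n \<Rightarrow> real"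
  assumes "F differentiable (at u)" "G differentiable (at u)"
  shows "partial_deriv i (\<lambda>v. F v * G v) u = F u * partial_deriv i G u + partial_deriv i F u * G u"
  using partial_deriv_eq[OF has_derivative_mult[OF assms[unfolded frechet_derivative_works]]]
  by (simp add: partial_deriv_def)

lemma differentiable_inner:
  fixes F G :: "real^'n \<Rightarrow> 'b::real_inner"
  assumes "F differentiable (at u)" "G differentiable (at u)"
  shows "(\<lambda>v. F v \<bullet> G v) differentiable (at u)"
  using has_derivative_inner[OF assms[unfolded frechet_derivative_works]] differentiable_def by blast

text \<open>The second difference quotient of \<open>g\<close> is symmetric in the two directions, and by the mean
  value theorem it converges to either of the mixed derivatives.\<close>

lemma second_difference_tendsto:
  fixes g :: "'a::real_normed_vector \<Rightarrow> real"
  assumes op: "open V" and u: "u \<in> V"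
    and dg: "\<And>v. v \<in> V \<Longrightarrow> (g has_derivative g' v) (at v)"
    and dd: "((\<lambda>v. g' v b) has_derivative D) (at u)"
  shows "((\<lambda>t. (g (u + t *\<^sub>R a + t *\<^sub>R b) - g (u + t *\<^sub>R a) - g (u + t *\<^sub>R b) + g u) / t\<^sup>2) \<longlongrightarrow> D a)
           (at_right 0)"
proof (rule tendstoI)
  fix e :: real assume e: "e > 0"
  define c where "c = norm a + norm b + norm b + 1"
  have c: "c > 0" "norm a + norm b \<le> c" unfolding c_def by (auto intro: add_nonneg_pos)
  define e' where "e' = e / (2 * c)"
  have e': "e' > 0" using e c by (simp add: e'_def)
  have lD: "linear D" using dd has_derivative_linear by blast
  obtain d1 where d1: "d1 > 0" "\<And>y. norm (y - u) < d1 \<Longrightarrow>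
      norm (g' y b - g' u b - D (y - u)) \<le> e' * norm (y - u)"
    using dd[unfolded has_derivative_at_alt] e' by blast
  obtain d2 where d2: "d2 > 0" "ball u d2 \<subseteq> V" using op u open_contains_ball by blast
  define d where "d = min d1 d2 / c"
  have d: "d > 0" using d1 d2 c by (simp add: d_def)
  have "dist ((g (u + t *\<^sub>R a + t *\<^sub>R b) - g (u + t *\<^sub>R a) - g (u + t *\<^sub>R b) + g u) / t\<^sup>2) (D a) < e"
    if t: "0 < t" "t < d" for t
  proof -
    have tc: "t * c < min d1 d2" using t d c by (simp add: d_def pos_less_divide_eq)
    have small: "norm (s *\<^sub>R a + r *\<^sub>R b) < min d1 d2" if "\<bar>s\<bar> \<le> t" "\<bar>r\<bar> \<le> t" for s r
    proof -
      have "norm (s *\<^sub>R a + r *\<^sub>R b) \<le> \<bar>s\<bar> * norm a + \<bar>r\<bar> * norm b"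
        by (metis norm_scaleR norm_triangle_ineq)
      also have "\<dots> \<le> t * norm a + t * norm b"
        using that by (intro add_mono mult_right_mono) auto
      also have "\<dots> = t * (norm a + norm b)" by (simp add: algebra_simps)
      also have "\<dots> \<le> t * c" using c t by (intro mult_left_mono) auto
      finally show ?thesis using tc by simp
    qed
    have inV: "u + s *\<^sub>R a + r *\<^sub>R b \<in> V" if "\<bar>s\<bar> \<le> t" "\<bar>r\<bar> \<le> t" for s r
      using small[OF that] d2 by (auto simp: dist_norm subset_iff norm_minus_commute add.assoc)
    have der: "((\<lambda>s. g (u + q *\<^sub>R a + s *\<^sub>R b)) has_real_derivative g' (u + q *\<^sub>R a + r *\<^sub>R b) b) (at r)"
      if "\<bar>q\<bar> \<le> t" "\<bar>r\<bar> \<le> t" for q r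
    proof -
      have 1: "((\<lambda>s. u + q *\<^sub>R a + s *\<^sub>R b) has_derivative (\<lambda>s. s *\<^sub>R b)) (at r)"
        by (auto intro!: derivative_eq_intros)
      have "((\<lambda>s. g (u + q *\<^sub>R a + s *\<^sub>R b)) has_derivative (\<lambda>s. g' (u + q *\<^sub>R a + r *\<^sub>R b) (s *\<^sub>R b))) (at r)"
        using has_derivative_compose[OF 1 dg[OF inV[OF that]]] by simp
      moreover have "g' (u + q *\<^sub>R a + r *\<^sub>R b) (s *\<^sub>R b) = s * g' (u + q *\<^sub>R a + r *\<^sub>R b) b" for s
        using linear_cmul[OF has_derivative_linear[OF dg[OF inV[OF that]]]] by simp
      ultimately show ?thesis
        by (simp add: has_field_derivative_def mult.commute[of _ "g' _ b"])
    qed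
    define h where "h s = g (u + t *\<^sub>R a + s *\<^sub>R b) - g (u + 0 *\<^sub>R a + s *\<^sub>R b)" for s
    have dh: "(h has_real_derivative (g' (u + t *\<^sub>R a + r *\<^sub>R b) b - g' (u + 0 *\<^sub>R a + r *\<^sub>R b) b)) (at r)"
      if "0 \<le> r" "r \<le> t" for r
      unfolding h_def using that t by (intro DERIV_diff der) auto
    obtain z where z: "0 < z" "z < t"
      "h t - h 0 = (t - 0) * (g' (u + t *\<^sub>R a + z *\<^sub>R b) b - g' (u + 0 *\<^sub>R a + z *\<^sub>R b) b)"
      using MVT2[OF \<open>0 < t\<close> dh] by blast
    let ?p = "t *\<^sub>R a + z *\<^sub>R b" and ?q = "z *\<^sub>R b"
    have p: "norm (g' (u + ?p) b - g' u b - D ?p) \<le> e' * norm ?p"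
      using d1(2)[of "u + ?p"] small[of t z] z t by simp
    have q: "norm (g' (u + ?q) b - g' u b - D ?q) \<le> e' * norm ?q"
      using d1(2)[of "u + ?q"] small[of 0 z] z t by simp
    have Dpq: "D ?p - D ?q = t * D a"
      using linear_add[OF lD] linear_cmul[OF lD] by simp
    have np: "norm ?p \<le> t * norm a + t * norm b"
      using norm_triangle_ineq[of "t *\<^sub>R a" "z *\<^sub>R b"] z t
      by (smt (verit) mult_right_mono norm_ge_zero norm_scaleR)
    have nq: "norm ?q \<le> t * norm b" using z t by (simp add: mult_right_mono)
    have "\<bar>(g' (u + ?p) b - g' (u + ?q) b) - t * D a\<bar> \<le> e' * norm ?p + e' * norm ?q"
      using p q Dpq by (simp add: abs_le_iff)
    also have "\<dots> \<le> e' * (t * norm a + t * norm b) + e' * (t * norm b)"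
      using np nq e' by (intro add_mono mult_left_mono) auto
    also have "\<dots> = t * (e' * (norm a + norm b + norm b))" by (simp add: algebra_simps)
    also have "\<dots> < t * e"
    proof -
      have "e' * (norm a + norm b + norm b) \<le> e' * c"
        using e' by (intro mult_left_mono) (auto simp: c_def)
      also have "\<dots> = e / 2" using c by (simp add: e'_def)
      finally show ?thesis using t e by (intro mult_strict_left_mono) auto
    qed
    finally have est: "\<bar>(g' (u + ?p) b - g' (u + ?q) b) - t * D a\<bar> < t * e" .
    let ?\<Delta> = "g (u + t *\<^sub>R a + t *\<^sub>R b) - g (u + t *\<^sub>R a) - g (u + t *\<^sub>R b) + g u"
    have "?\<Delta> = h t - h 0" by (simp add: h_def)
    also have "\<dots> = t * (g' (u + ?p) b - g' (u + ?q) b)"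
      using z(3) by (simp add: add.assoc)
    finally have \<Delta>: "?\<Delta> = t * (g' (u + ?p) b - g' (u + ?q) b)" .
    have "?\<Delta> / t\<^sup>2 - D a = ((g' (u + ?p) b - g' (u + ?q) b) - t * D a) / t"
      unfolding \<Delta> using t by (simp add: field_simps power2_eq_square)
    then show ?thesis using est t by (simp add: dist_real_def pos_divide_less_eq mult.commute)
  qed
  then show "\<forall>\<^sub>F t in at_right 0. dist ((g (u + t *\<^sub>R a + t *\<^sub>R b) - g (u + t *\<^sub>R a) - g (u + t *\<^sub>R b) + g u) / t\<^sup>2) (D a) < e"
    using d by (auto simp: eventually_at_right_field)
qed

lemma partial_deriv_commute_real:
  fixes g :: "real^'n \<Rightarrow> real"
  assumes op: "open V" and u: "u \<in> V" and dg: "g differentiable_on V"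
    and dd: "\<And>i. partial_deriv i g differentiable (at u)"
  shows "partial_deriv i (partial_deriv j g) u = partial_deriv j (partial_deriv i g) u"
proof -
  let ?g' = "\<lambda>v. frechet_derivative g (at v)"
  have dg': "\<And>v. v \<in> V \<Longrightarrow> (g has_derivative ?g' v) (at v)"
    using dg op by (metis differentiable_on_eq_differentiable_at frechet_derivative_works)
  have lim: "((\<lambda>t. (g (u + t *\<^sub>R axis i 1 + t *\<^sub>R axis j 1) - g (u + t *\<^sub>R axis i 1) - g (u + t *\<^sub>R axis j 1) + g u) / t\<^sup>2)
      \<longlongrightarrow> partial_deriv i (partial_deriv j g) u) (at_right 0)" for i j
  proof -
    have "((\<lambda>v. ?g' v (axis j 1)) has_derivative frechet_derivative (partial_deriv j g) (at u)) (at u)"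
      using dd[of j] unfolding frechet_derivative_works partial_deriv_def[abs_def] by simp
    from second_difference_tendsto[OF op u dg' this, of "axis i 1"]
    show ?thesis by (simp add: partial_deriv_def)
  qed
  have "((\<lambda>t. (g (u + t *\<^sub>R axis i 1 + t *\<^sub>R axis j 1) - g (u + t *\<^sub>R axis i 1) - g (u + t *\<^sub>R axis j 1) + g u) / t\<^sup>2)
      \<longlongrightarrow> partial_deriv j (partial_deriv i g) u) (at_right 0)"
    using lim[of j i] by (simp add: algebra_simps)
  with lim[of i j] show ?thesis
    using tendsto_unique trivial_limit_at_right_real by blast
qed

text \<open>The real case, applied to the components.\<close>

lemma partial_deriv_commute:
  fixes F :: "real^'n \<Rightarrow> 'b::euclidean_space"
  assumes op: "open V" and u: "u \<in> V" and dF: "F differentiable_on V"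
    and dd: "\<And>i. partial_deriv i F differentiable (at u)"
  shows "partial_deriv i (partial_deriv j F) u = partial_deriv j (partial_deriv i F) u"
proof (rule euclidean_eqI)
  fix c :: 'b assume "c \<in> Basis"
  have dFv: "F differentiable (at v)" if "v \<in> V" for v
    using dF op that by (metis differentiable_on_eq_differentiable_at)
  let ?g = "\<lambda>v. F v \<bullet> c"
  have dg: "partial_deriv i ?g v = partial_deriv i F v \<bullet> c" if "v \<in> V" for v i
    using partial_deriv_inner[OF dFv[OF that], of "\<lambda>_. c" i]
    by (simp add: partial_deriv_def)
  have diffi: "(\<lambda>v. partial_deriv i F v \<bullet> c) differentiable (at u)" for i
    by (intro differentiable_inner dd) simp
  have ddg: "partial_deriv j (partial_deriv i ?g) u = partial_deriv j (partial_deriv i F) u \<bullet> c" for i j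
  proof -
    have "partial_deriv j (\<lambda>v. partial_deriv i F v \<bullet> c) u = partial_deriv j (partial_deriv i ?g) u"
      using dg by (intro partial_deriv_cong[OF op u _ diffi]) auto
    moreover have "partial_deriv j (\<lambda>v. partial_deriv i F v \<bullet> c) u = partial_deriv j (partial_deriv i F) u \<bullet> c"
      using partial_deriv_inner[OF dd[of i], of "\<lambda>_. c" j] by (simp add: partial_deriv_def)
    ultimately show ?thesis by simp
  qed
  have "partial_deriv i (partial_deriv j ?g) u = partial_deriv j (partial_deriv i ?g) u"
  proof (rule partial_deriv_commute_real[OF op u])
    show "?g differentiable_on V"
      using dFv by (intro differentiable_at_imp_differentiable_on differentiable_inner) auto
    show "partial_deriv i ?g differentiable (at u)" for i
    proof -
      obtain D where "((\<lambda>v. partial_deriv i F v \<bullet> c) has_derivative D) (at u)"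
        using diffi differentiable_def by blast
      then have "(partial_deriv i ?g has_derivative D) (at u)"
        by (rule has_derivative_transform_within_open[OF _ op u]) (simp add: dg)
      then show ?thesis using differentiable_def by blast
    qed
  qed
  then show "partial_deriv i (partial_deriv j F) u \<bullet> c = partial_deriv j (partial_deriv i F) u \<bullet> c"
    by (simp add: ddg)
qed

lemma C_k_on_Suc_imp:
  assumes "C_k_on (Suc k) F S" shows "C_k_on k F S"
  using assms
proof (induction k arbitrary: F)
  case 0 then show ?case by (auto intro: differentiable_imp_continuous_on)
next
  case (Suc k)
  have "F differentiable_on S" "\<And>i. C_k_on (Suc k) (partial_deriv i F) S"
    using Suc.prems by auto
  then show ?case using Suc.IH by auto
qed

lemma C_k_on_mono: "C_k_on k F S \<Longrightarrow> j \<le> k \<Longrightarrow> C_k_on j F S"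
  by (induction k) (auto simp: le_Suc_eq dest: C_k_on_Suc_imp simp del: C_k_on.simps)

section \<open>Differentiating the inverse of a matrix\<close>

lemma differentiable_prod:
  fixes f :: "'i \<Rightarrow> 'a::real_normed_vector \<Rightarrow> real"
  assumes "finite I" "\<And>i. i \<in> I \<Longrightarrow> f i differentiable (at u)"
  shows "(\<lambda>v. \<Prod>i\<in>I. f i v) differentiable (at u)"
  using assms by (induction I rule: finite_induct) auto

lemma differentiable_det:
  fixes A :: "'a::real_normed_vector \<Rightarrow> real^'n^'n"
  assumes "\<And>i j. (\<lambda>v. A v $ i $ j) differentiable (at u)"
  shows "(\<lambda>v. det (A v)) differentiable (at u)"
  unfolding det_def
  using assms by (intro differentiable_sum differentiable_mult differentiable_const ballI differentiable_prod) (auto intro: finite_permutations)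

lemma invertible_matrix_inv:
  fixes A :: "real^'n^'n"
  assumes "invertible A"
  shows "A ** matrix_inv A = mat 1" "matrix_inv A ** A = mat 1"
proof -
  have "A ** matrix_inv A = mat 1 \<and> matrix_inv A ** A = mat 1"
    using assms unfolding invertible_def matrix_inv_def by (rule someI_ex)
  then show "A ** matrix_inv A = mat 1" "matrix_inv A ** A = mat 1" by auto
qed

text \<open>Cramer's rule turns the entries of the inverse into quotients of determinants, whose
  differentiability is visible.\<close>

lemma matrix_inv_nth_eq_cramer:
  fixes A :: "real^'n^'n"
  assumes "det A \<noteq> 0"
  shows "matrix_inv A $ k $ l = det (\<chi> i j. if j = k then axis l 1 $ i else A $ i $ j) / det A"
proof -
  have "A ** matrix_inv A = mat 1"
    using assms by (simp add: invertible_det_nz invertible_matrix_inv)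
  then have "A *v (matrix_inv A *v axis l 1) = axis l 1"
    by (simp add: matrix_vector_mul_assoc)
  then have "matrix_inv A *v axis l 1 = (\<chi> k. det(\<chi> i j. if j=k then axis l 1 $ i else A$i$j) / det A)"
    using cramer[OF assms] by blast
  then show ?thesis by (simp add: vec_eq_iff matrix_vector_mult_basis column_def)
qed

lemma differentiable_matrix_inv:
  fixes A :: "'a::real_normed_vector \<Rightarrow> real^'n^'n"
  assumes op: "open V" and u: "u \<in> V" and inv: "\<And>v. v \<in> V \<Longrightarrow> invertible (A v)"
    and d: "\<And>i j. (\<lambda>v. A v $ i $ j) differentiable (at u)"
  shows "(\<lambda>v. matrix_inv (A v) $ k $ l) differentiable (at u)"
proof -
  have nz: "det (A v) \<noteq> 0" if "v \<in> V" for v using inv[OF that] by (simp add: invertible_det_nz)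
  have "(\<lambda>v. det (\<chi> i j. if j = k then axis l 1 $ i else A v $ i $ j) / det (A v)) differentiable (at u)"
  proof (intro differentiable_divide differentiable_det d nz[OF u])
    show "(\<lambda>v. (\<chi> i j. if j = k then axis l 1 $ i else A v $ i $ j) $ i $ j) differentiable (at u)" for i j
      using d by (cases "j = k") auto
  qed
  then obtain D where "((\<lambda>v. det (\<chi> i j. if j = k then axis l 1 $ i else A v $ i $ j) / det (A v)) has_derivative D) (at u)"
    using differentiable_def by blast
  then have "((\<lambda>v. matrix_inv (A v) $ k $ l) has_derivative D) (at u)"
    by (rule has_derivative_transform_within_open[OF _ op u]) (simp add: matrix_inv_nth_eq_cramer[OF nz])
  then show ?thesis using differentiable_def by blast
qed

section \<open>The Gauss equation\<close>

lemma sum_swap2: "(\<Sum>i\<in>A. \<Sum>m\<in>B. \<Sum>r\<in>C. f i m r) = (\<Sum>m\<in>B. \<Sum>r\<in>C. \<Sum>i\<in>A. f i m r)"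
  by (subst sum.swap, intro sum.cong refl, rule sum.swap)

text \<open>Three derivatives are what the Gauss equation consumes: the scalar curvature differentiates the
  Christoffel symbols, which contain second derivatives of \<open>F\<close>.\<close>

locale immersion =
  fixes F :: "real^'n \<Rightarrow> real^'d" and V :: "(real^'n) set"
  assumes open_V: "open V" and C3: "C_k_on 3 F V"
    and inj_deriv: "\<And>u. u \<in> V \<Longrightarrow> inj (frechet_derivative F (at u))"
begin

abbreviation "F1 i \<equiv> partial_deriv i F"
abbreviation "F2 i j \<equiv> partial_deriv j (partial_deriv i F)"
abbreviation "DF u \<equiv> frechet_derivative F (at u)"
abbreviation "g \<equiv> induced_metric F"

text \<open>The inverse metric, and the Christoffel symbols in the form that they take for an induced metric,
  where no derivative of the metric occurs.\<close>

definition "P u = matrix_inv (g u)"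

definition "\<Gamma> k i j u = (\<Sum>l\<in>UNIV. P u $ k $ l * (F2 i j u \<bullet> F1 l u))"

text \<open>The vector-valued second fundamental form: the part of the second derivative that is normal
  to the tangent space.\<close>

definition "B i j u = F2 i j u - (\<Sum>k\<in>UNIV. \<Gamma> k i j u *\<^sub>R F1 k u)"

text \<open>For a normal vector \<open>N\<close> at \<open>u\<close> this is the second fundamental form: the tangential part of the
  second derivative has no product with \<open>N\<close>, so the Christoffel term can be left out.\<close>

definition "II u N a b = (\<Sum>i\<in>UNIV. \<Sum>j\<in>UNIV. a $ i * b $ j * (N \<bullet> F2 i j u))"

lemma differentiable:
  assumes "u \<in> V"
  shows "F differentiable (at u)" "F1 i differentiable (at u)" "F2 i j differentiable (at u)"
proof -
  have "F differentiable_on V" "F1 i differentiable_on V" "F2 i j differentiable_on V"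
    using C3 by (auto simp: numeral_eq_Suc)
  then show "F differentiable (at u)" "F1 i differentiable (at u)" "F2 i j differentiable (at u)"
    using assms open_V by (auto simp: differentiable_on_eq_differentiable_at)
qed

lemma DF_eq: "u \<in> V \<Longrightarrow> DF u b = (\<Sum>i\<in>UNIV. b $ i *\<^sub>R F1 i u)"
  by (rule frechet_eq_sum_partial) (rule differentiable)

lemma linear_DF: "u \<in> V \<Longrightarrow> linear (DF u)"
  by (simp add: differentiable linear_frechet_derivative)

lemma DF_axis: "DF u (axis i 1) = F1 i u"
  by (simp add: partial_deriv_def)

lemma F2_commute: "u \<in> V \<Longrightarrow> F2 i j u = F2 j i u"
  by (rule partial_deriv_commute[OF open_V])
    (auto intro: differentiable_at_imp_differentiable_on differentiable)

lemma F3_commute: "u \<in> V \<Longrightarrow> partial_deriv m (F2 i j) u = partial_deriv j (F2 i m) u"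
  by (rule partial_deriv_commute[OF open_V])
    (auto intro: differentiable_at_imp_differentiable_on differentiable)

lemma g_nth: "g u $ i $ j = F1 i u \<bullet> F1 j u"
  by (simp add: induced_metric_def)

lemma inner_DF:
  assumes "u \<in> V"
  shows "DF u a \<bullet> DF u b = (\<Sum>i\<in>UNIV. \<Sum>j\<in>UNIV. a $ i * b $ j * g u $ i $ j)"
  unfolding DF_eq[OF assms] inner_sum_left
  by (simp add: inner_sum_right g_nth sum_distrib_left ac_simps)

lemma DF_eq_0_iff: "u \<in> V \<Longrightarrow> DF u b = 0 \<longleftrightarrow> b = 0"
  using inj_deriv linear_DF linear_injective_0 linear_0 by blast

lemma invertible_g:
  assumes u: "u \<in> V" shows "invertible (g u)"
proof -
  have "b = 0" if "g u *v b = 0" for b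
  proof -
    have "(\<Sum>j\<in>UNIV. b $ j * g u $ i $ j) = 0" for i
      using that by (simp add: vec_eq_iff matrix_vector_mult_def mult.commute)
    then have "(\<Sum>i\<in>UNIV. b $ i * (\<Sum>j\<in>UNIV. b $ j * g u $ i $ j)) = 0" by simp
    then have "DF u b \<bullet> DF u b = 0"
      by (simp add: inner_DF[OF u] sum_distrib_left mult.assoc)
    then show ?thesis using DF_eq_0_iff[OF u] by simp
  qed
  then show ?thesis
    by (simp add: invertible_left_inverse matrix_left_invertible_ker)
qed

lemma P_mult_g: assumes "u \<in> V" shows "(\<Sum>l\<in>UNIV. P u $ k $ l * g u $ l $ j) = (if k = j then 1 else 0)"
  using invertible_matrix_inv(2)[OF invertible_g[OF assms]]
  by (simp add: P_def[symmetric] vec_eq_iff matrix_matrix_mult_def mat_def)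

lemma g_mult_P: assumes "u \<in> V" shows "(\<Sum>l\<in>UNIV. g u $ k $ l * P u $ l $ j) = (if k = j then 1 else 0)"
  using invertible_matrix_inv(1)[OF invertible_g[OF assms]]
  by (simp add: P_def[symmetric] vec_eq_iff matrix_matrix_mult_def mat_def)

lemma g_sym: "g u $ i $ j = g u $ j $ i"
  by (simp add: g_nth inner_commute)

lemma P_sym: assumes u: "u \<in> V" shows "P u $ i $ j = P u $ j $ i"
proof -
  have gT: "transpose (g u) = g u" by (simp add: vec_eq_iff transpose_def g_sym[of u])
  have gP: "g u ** P u = mat 1" using invertible_matrix_inv(1)[OF invertible_g[OF u]] by (simp add: P_def)
  have "transpose (P u) ** g u = mat 1"
    using arg_cong[OF gP, of transpose] by (simp add: matrix_transpose_mul gT transpose_mat)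
  then have "transpose (P u) = P u"
    using matrix_mul_assoc[of "transpose (P u)" "g u" "P u"] gP by simp
  then have "transpose (P u) $ i $ j = P u $ i $ j" by simp
  then show ?thesis by (simp add: transpose_def)
qed

lemma differentiable_g: "u \<in> V \<Longrightarrow> (\<lambda>v. g v $ i $ j) differentiable (at u)"
  unfolding g_nth by (intro differentiable_inner differentiable)

lemma differentiable_P: "u \<in> V \<Longrightarrow> (\<lambda>v. P v $ i $ j) differentiable (at u)"
  unfolding P_def by (rule differentiable_matrix_inv[OF open_V _ invertible_g differentiable_g])

lemma differentiable_\<Gamma>: "u \<in> V \<Longrightarrow> \<Gamma> k i j differentiable (at u)"
  unfolding \<Gamma>_def[abs_def]
  by (intro differentiable_sum differentiable_mult differentiable_P differentiable_inner differentiable ballI finite)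

lemma partial_g: "u \<in> V \<Longrightarrow> partial_deriv m (\<lambda>v. g v $ i $ j) u = F1 i u \<bullet> F2 j m u + F2 i m u \<bullet> F1 j u"
  unfolding g_nth by (intro partial_deriv_inner differentiable)

lemma christoffel_eq:
  assumes u: "u \<in> V" shows "christoffel g k i j u = \<Gamma> k i j u"
proof -
  have "partial_deriv i (\<lambda>v. g v $ j $ l) u + partial_deriv j (\<lambda>v. g v $ i $ l) u
          - partial_deriv l (\<lambda>v. g v $ i $ j) u = 2 * (F2 i j u \<bullet> F1 l u)" for l
    unfolding partial_g[OF u] F2_commute[OF u, of l i] F2_commute[OF u, of l j] F2_commute[OF u, of j i]
    by (simp add: inner_commute)
  then show ?thesis
    by (simp add: christoffel_def \<Gamma>_def P_def sum_divide_distrib)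
qed

lemma \<Gamma>_commute: "u \<in> V \<Longrightarrow> \<Gamma> k i j u = \<Gamma> k j i u"
  by (simp add: \<Gamma>_def F2_commute)

lemma \<Gamma>_lower:
  assumes u: "u \<in> V" shows "(\<Sum>k\<in>UNIV. \<Gamma> k i j u * g u $ k $ c) = F2 i j u \<bullet> F1 c u"
proof -
  have "(\<Sum>k\<in>UNIV. \<Gamma> k i j u * g u $ k $ c)
      = (\<Sum>k\<in>UNIV. \<Sum>l\<in>UNIV. (F2 i j u \<bullet> F1 l u) * (P u $ l $ k * g u $ k $ c))"
    by (simp add: \<Gamma>_def sum_distrib_left P_sym[OF u, of _ "_::'n"] ac_simps)
  also have "\<dots> = (\<Sum>l\<in>UNIV. (F2 i j u \<bullet> F1 l u) * (\<Sum>k\<in>UNIV. P u $ l $ k * g u $ k $ c))"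
    by (subst sum.swap) (simp add: sum_distrib_left)
  also have "\<dots> = F2 i j u \<bullet> F1 c u"
    by (simp add: P_mult_g[OF u] if_distrib cong: if_cong)
  finally show ?thesis .
qed

lemma B_orthogonal: assumes u: "u \<in> V" shows "B i j u \<bullet> F1 c u = 0"
  by (simp add: B_def inner_diff_left inner_sum_left g_nth[symmetric] \<Gamma>_lower[OF u])

lemma B_inner_F2: assumes u: "u \<in> V" shows "B i j u \<bullet> F2 k l u = B i j u \<bullet> B k l u"
  by (subst (3) B_def) (simp add: inner_diff_right inner_sum_right B_orthogonal[OF u])

text \<open>Differentiating the identity \<open>\<Gamma>_lower\<close> instead of the definition of \<open>\<Gamma>\<close> avoids the derivative of
  the inverse metric.\<close>

lemma partial_\<Gamma>_lower:
  assumes u: "u \<in> V"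
  shows "(\<Sum>k\<in>UNIV. (partial_deriv m (\<Gamma> k i j) u + (\<Sum>l\<in>UNIV. \<Gamma> l i j u * \<Gamma> k l m u)) * g u $ k $ c)
      = partial_deriv m (F2 i j) u \<bullet> F1 c u + B i j u \<bullet> B c m u"
proof -
  have "partial_deriv m (\<lambda>v. F2 i j v \<bullet> F1 c v) u = partial_deriv m (\<lambda>v. \<Sum>k\<in>UNIV. \<Gamma> k i j v * g v $ k $ c) u"
    using u \<Gamma>_lower by (intro partial_deriv_cong[OF open_V u] differentiable_inner differentiable) auto
  also have "\<dots> = (\<Sum>k\<in>UNIV. \<Gamma> k i j u * (F1 k u \<bullet> F2 c m u + F2 k m u \<bullet> F1 c u)
      + partial_deriv m (\<Gamma> k i j) u * g u $ k $ c)"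
    by (simp add: partial_deriv_sum partial_deriv_mult differentiable_mult u differentiable_\<Gamma>
        differentiable_g partial_g)
  also have "partial_deriv m (\<lambda>v. F2 i j v \<bullet> F1 c v) u = F2 i j u \<bullet> F2 c m u + partial_deriv m (F2 i j) u \<bullet> F1 c u"
    using u by (intro partial_deriv_inner differentiable)
  finally have 1: "F2 i j u \<bullet> F2 c m u + partial_deriv m (F2 i j) u \<bullet> F1 c u =
     (\<Sum>k\<in>UNIV. partial_deriv m (\<Gamma> k i j) u * g u $ k $ c) + (\<Sum>k\<in>UNIV. \<Gamma> k i j u * (F1 k u \<bullet> F2 c m u))
     + (\<Sum>k\<in>UNIV. \<Gamma> k i j u * (F2 k m u \<bullet> F1 c u))"
    by (simp add: sum.distrib algebra_simps)
  have 2: "F2 i j u \<bullet> F2 c m u - (\<Sum>k\<in>UNIV. \<Gamma> k i j u * (F1 k u \<bullet> F2 c m u)) = B i j u \<bullet> B c m u"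
    by (simp add: B_inner_F2[OF u, symmetric]) (simp add: B_def inner_diff_left inner_sum_left)
  have 3: "(\<Sum>k\<in>UNIV. \<Gamma> k i j u * (F2 k m u \<bullet> F1 c u)) = (\<Sum>k\<in>UNIV. (\<Sum>l\<in>UNIV. \<Gamma> l i j u * \<Gamma> k l m u) * g u $ k $ c)"
  proof -
    have "(\<Sum>k\<in>UNIV. \<Gamma> k i j u * (F2 k m u \<bullet> F1 c u)) = (\<Sum>l\<in>UNIV. \<Gamma> l i j u * (\<Sum>k\<in>UNIV. \<Gamma> k l m u * g u $ k $ c))"
      by (simp add: \<Gamma>_lower[OF u])
    also have "\<dots> = (\<Sum>k\<in>UNIV. (\<Sum>l\<in>UNIV. \<Gamma> l i j u * \<Gamma> k l m u) * g u $ k $ c)"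
      unfolding sum_distrib_left sum_distrib_right by (subst sum.swap) (simp add: mult.assoc)
    finally show ?thesis .
  qed
  show ?thesis using 1 2 unfolding 3 by (simp add: distrib_right sum.distrib)
qed

text \<open>The Gauss equation. The third derivatives of \<open>F\<close> in \<open>partial_\<Gamma>_lower\<close> cancel by symmetry, and
  only products of the second fundamental form are left.\<close>

lemma riemann_eq:
  assumes u: "u \<in> V"
  shows "(partial_deriv m (\<Gamma> k i j) u + (\<Sum>l\<in>UNIV. \<Gamma> l i j u * \<Gamma> k l m u))
       - (partial_deriv j (\<Gamma> k i m) u + (\<Sum>l\<in>UNIV. \<Gamma> l i m u * \<Gamma> k l j u))
     = (\<Sum>c\<in>UNIV. P u $ k $ c * (B i j u \<bullet> B c m u - B i m u \<bullet> B c j u))"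
proof -
  define R where "R k = (partial_deriv m (\<Gamma> k i j) u + (\<Sum>l\<in>UNIV. \<Gamma> l i j u * \<Gamma> k l m u))
       - (partial_deriv j (\<Gamma> k i m) u + (\<Sum>l\<in>UNIV. \<Gamma> l i m u * \<Gamma> k l j u))" for k
  have low: "(\<Sum>k\<in>UNIV. R k * g u $ k $ c) = B i j u \<bullet> B c m u - B i m u \<bullet> B c j u" for c
    unfolding R_def left_diff_distrib sum_subtractf partial_\<Gamma>_lower[OF u] F3_commute[OF u, of m]
    by simp
  have "(\<Sum>c\<in>UNIV. P u $ k $ c * (B i j u \<bullet> B c m u - B i m u \<bullet> B c j u))
      = (\<Sum>c\<in>UNIV. \<Sum>q\<in>UNIV. R q * (g u $ q $ c * P u $ c $ k))"
    by (simp add: low[symmetric] sum_distrib_left P_sym[OF u, of k] ac_simps)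
  also have "\<dots> = (\<Sum>q\<in>UNIV. R q * (\<Sum>c\<in>UNIV. g u $ q $ c * P u $ c $ k))"
    by (subst sum.swap) (simp add: sum_distrib_left)
  also have "\<dots> = R k"
    by (simp add: g_mult_P[OF u] if_distrib cong: if_cong)
  finally show ?thesis unfolding R_def by simp
qed

text \<open>The contraction of \<open>riemann_eq\<close> over its indices.\<close>

lemma scalar_curvature_eq:
  assumes u: "u \<in> V"
  shows "scalar_curvature g u = (\<Sum>i\<in>UNIV. \<Sum>j\<in>UNIV. P u $ i $ j *
     (\<Sum>k\<in>UNIV. \<Sum>c\<in>UNIV. P u $ k $ c * (B i j u \<bullet> B c k u - B i k u \<bullet> B c j u)))"
proof -
  have pd: "partial_deriv m (christoffel g k i j) u = partial_deriv m (\<Gamma> k i j) u" for m k i j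
    using u christoffel_eq
    by (intro partial_deriv_cong[OF open_V u _ differentiable_\<Gamma>, symmetric]) auto
  have "ricci g i j u = (\<Sum>k\<in>UNIV. \<Sum>c\<in>UNIV. P u $ k $ c * (B i j u \<bullet> B c k u - B i k u \<bullet> B c j u))" for i j
  proof -
    have "ricci g i j u = (\<Sum>k\<in>UNIV. (partial_deriv k (\<Gamma> k i j) u + (\<Sum>l\<in>UNIV. \<Gamma> l i j u * \<Gamma> k l k u))
       - (partial_deriv j (\<Gamma> k i k) u + (\<Sum>l\<in>UNIV. \<Gamma> l i k u * \<Gamma> k l j u)))"
      unfolding ricci_def pd christoffel_eq[OF u]
      by (intro sum.cong refl) (simp add: sum_subtractf \<Gamma>_commute[OF u, of _ _ "_::'n"] mult.commute)
    then show ?thesis using riemann_eq[OF u] by simp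
  qed
  then show ?thesis by (simp add: scalar_curvature_def P_def)
qed

lemma orthonormal_frame:
  assumes u: "u \<in> V"
  obtains e :: "'n \<Rightarrow> real^'n" where "\<And>m k. DF u (e m) \<bullet> DF u (e k) = (if m = k then 1 else 0)"
proof -
  have sub: "subspace (range (DF u))"
    using linear_DF[OF u] by (simp add: linear_subspace_image)
  obtain S where S: "S \<subseteq> range (DF u)" "pairwise orthogonal S" "\<And>x. x \<in> S \<Longrightarrow> norm x = 1"
    "independent S" "card S = dim (range (DF u))" "span S = range (DF u)"
    using orthonormal_basis_subspace[OF sub] by metis
  have "dim (range (DF u)) = CARD('n)"
    using dim_image_eq[OF linear_DF[OF u], of UNIV] inj_deriv[OF u] by simp
  then have "card S = CARD('n)" "finite S"
    using S independent_imp_finite by auto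
  then obtain h where h: "bij_betw h (UNIV :: 'n set) S"
    by (metis finite_same_card_bij finite)
  have "\<exists>e. DF u e = h m" for m
    using h S(1) by (metis bij_betwE UNIV_I rangeE subsetD)
  then obtain e where e: "\<And>m. DF u (e m) = h m" by metis
  have "h m \<bullet> h k = (if m = k then 1 else 0)" for m k
  proof (cases "m = k")
    case True
    then show ?thesis using S(3) bij_betwE[OF h] by (auto simp: norm_eq_1)
  next
    case False
    then have "h m \<noteq> h k" using h by (metis bij_betw_def inj_on_def UNIV_I)
    then show ?thesis using False S(2) bij_betwE[OF h] by (auto simp: pairwise_def orthogonal_def)
  qed
  then show ?thesis using that[of e] e by auto
qed

text \<open>If the columns of \<open>E\<close> are orthonormal for \<open>g\<close>, then \<open>E\<^sup>T g E = 1\<close>, so \<open>E E\<^sup>T\<close> is the inverse of \<open>g\<close>.\<close>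

lemma P_eq_frame:
  fixes e :: "'n \<Rightarrow> real^'n"
  assumes u: "u \<in> V" and e: "\<And>m k. DF u (e m) \<bullet> DF u (e k) = (if m = k then 1 else 0)"
  shows "P u $ i $ j = (\<Sum>m\<in>UNIV. e m $ i * e m $ j)"
proof -
  define E :: "real^'n^'n" where "E = (\<chi> i m. e m $ i)"
  have "(transpose E ** g u) ** E = mat 1"
  proof -
    have "((transpose E ** g u) ** E) $ m $ k = DF u (e m) \<bullet> DF u (e k)" for m k
      unfolding inner_DF[OF u]
      by (simp add: matrix_matrix_mult_def transpose_def E_def sum_distrib_left ac_simps)
        (rule sum.swap)
    then show ?thesis by (simp add: vec_eq_iff e mat_def)
  qed
  then have "E ** (transpose E ** g u) = mat 1"
    using matrix_left_right_inverse by blast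
  then have "(E ** transpose E) ** g u = mat 1" by (simp add: matrix_mul_assoc)
  moreover have "g u ** P u = mat 1"
    using invertible_matrix_inv(1)[OF invertible_g[OF u]] by (simp add: P_def)
  ultimately have "P u = E ** transpose E"
    using matrix_mul_assoc[of "E ** transpose E" "g u" "P u"] by simp
  then show ?thesis by (simp add: matrix_matrix_mult_def transpose_def E_def)
qed

lemma DF_frame_expansion:
  fixes e :: "'n \<Rightarrow> real^'n"
  assumes u: "u \<in> V" and e: "\<And>m k. DF u (e m) \<bullet> DF u (e k) = (if m = k then 1 else 0)"
  shows "DF u b \<bullet> DF u c = (\<Sum>m\<in>UNIV. (DF u b \<bullet> DF u (e m)) * (DF u c \<bullet> DF u (e m)))"
proof -
  define a where "a m = DF u c \<bullet> DF u (e m)" for m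
  have "c $ i = (\<Sum>m\<in>UNIV. a m * e m $ i)" for i
  proof -
    have "(\<Sum>m\<in>UNIV. a m * e m $ i) = (\<Sum>m\<in>UNIV. \<Sum>j\<in>UNIV. \<Sum>k\<in>UNIV. c $ j * e m $ k * g u $ j $ k * e m $ i)"
      by (simp add: a_def inner_DF[OF u] sum_distrib_right)
    also have "\<dots> = (\<Sum>j\<in>UNIV. \<Sum>k\<in>UNIV. \<Sum>m\<in>UNIV. c $ j * e m $ k * g u $ j $ k * e m $ i)"
      by (rule sum_swap2)
    also have "\<dots> = (\<Sum>j\<in>UNIV. \<Sum>k\<in>UNIV. c $ j * (g u $ j $ k * P u $ k $ i))"
      by (intro sum.cong refl) (simp add: P_eq_frame[OF u e] sum_distrib_left ac_simps)
    also have "\<dots> = c $ i"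
      by (simp add: sum_distrib_left[symmetric] g_mult_P[OF u] if_distrib cong: if_cong)
    finally show ?thesis by simp
  qed
  then have "c = (\<Sum>m\<in>UNIV. a m *\<^sub>R e m)"
    by (simp add: vec_eq_iff)
  then have "DF u c = (\<Sum>m\<in>UNIV. a m *\<^sub>R DF u (e m))"
    by (simp add: linear_sum[OF linear_DF[OF u]] linear_cmul[OF linear_DF[OF u]])
  then have "DF u b \<bullet> DF u c = DF u b \<bullet> (\<Sum>m\<in>UNIV. a m *\<^sub>R DF u (e m))" by (rule arg_cong)
  then show ?thesis by (simp only: inner_sum_right inner_scaleR_right) (simp add: a_def mult.commute)
qed

text \<open>In codimension one the tangent space and a unit normal span everything.\<close>

lemma normal_line:
  assumes u: "u \<in> V" and d: "CARD('d) = CARD('n) + 1"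
    and N: "norm N = 1" "\<And>i. N \<bullet> F1 i u = 0" and X: "\<And>i. X \<bullet> F1 i u = 0"
  shows "X = (X \<bullet> N) *\<^sub>R N"
proof -
  let ?T = "range (DF u)"
  have orth: "Z \<bullet> y = 0" if "\<And>i. Z \<bullet> F1 i u = 0" "y \<in> ?T" for Z y
    using that by (auto simp: DF_eq[OF u] inner_sum_right)
  have sub: "subspace ?T" using linear_DF[OF u] by (simp add: linear_subspace_image)
  have dT: "dim ?T = CARD('n)"
    using dim_image_eq[OF linear_DF[OF u], of UNIV] inj_deriv[OF u] by simp
  have "N \<notin> span ?T"
    using orth[of N N] N sub by (auto simp: span_eq_iff[THEN iffD2, OF sub])
  then have "dim (insert N ?T) = DIM(real^'d)"
    using dT d by (simp add: dim_insert)
  then have full: "span (insert N ?T) = UNIV" using dim_eq_full by blast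
  define Y where "Y = X - (X \<bullet> N) *\<^sub>R N"
  have "orthogonal Y y" if "y \<in> insert N ?T" for y
    using that orth[OF N(2)] orth[OF X] N(1)
    by (auto simp: Y_def orthogonal_def inner_diff_left dot_square_norm)
  then have "orthogonal Y Y"
    using orthogonal_to_span[of Y "insert N ?T" Y] full by auto
  then show ?thesis by (simp add: Y_def orthogonal_self)
qed

lemma inner_normal_B: assumes "\<And>i. N \<bullet> F1 i u = 0" shows "N \<bullet> B i j u = N \<bullet> F2 i j u"
  by (simp add: B_def inner_diff_right inner_sum_right assms)

lemma II_commute: "u \<in> V \<Longrightarrow> II u N a b = II u N b a"
  unfolding II_def by (subst sum.swap) (simp add: F2_commute mult.commute mult.left_commute)

text \<open>In codimension one all values of the vector-valued form are multiples of a unit normal. In an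
  orthonormal frame the Gauss equation then becomes the sum of all the 2-by-2 principal minors, twice
  the second elementary symmetric function of the principal curvatures.\<close>

lemma scalar_curvature_frame:
  fixes e :: "'n \<Rightarrow> real^'n"
  assumes u: "u \<in> V" and d: "CARD('d) = CARD('n) + 1"
    and N: "norm N = 1" "\<And>i. N \<bullet> F1 i u = 0"
    and e: "\<And>m k. DF u (e m) \<bullet> DF u (e k) = (if m = k then 1 else 0)"
  shows "scalar_curvature g u = (\<Sum>m\<in>UNIV. \<Sum>k\<in>UNIV. II u N (e m) (e m) * II u N (e k) (e k) - (II u N (e m) (e k))\<^sup>2)"
proof -
  define h where "h i j = N \<bullet> F2 i j u" for i j
  have B: "B i j u = h i j *\<^sub>R N" for i j
    using normal_line[OF u d N, of "B i j u"] B_orthogonal[OF u] inner_normal_B[OF N(2)]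
    by (simp add: h_def inner_commute)
  have hs: "h i j = h j i" for i j by (simp add: h_def F2_commute[OF u])
  have NN: "N \<bullet> N = 1" using N by (simp add: dot_square_norm)
  (* the two frame sums are moved outside the four coordinate sums, one index at a time *)
  let ?t = "\<lambda>m r i j k c. e r $ i * e r $ j * (e m $ k * e m $ c) * (h i j * h k c - h i k * h j c)"
  have "scalar_curvature g u = (\<Sum>i\<in>UNIV. \<Sum>j\<in>UNIV. \<Sum>k\<in>UNIV. \<Sum>c\<in>UNIV. \<Sum>m\<in>UNIV. \<Sum>r\<in>UNIV. ?t m r i j k c)"
    unfolding scalar_curvature_eq[OF u] P_eq_frame[OF u e]
    by (simp add: B NN sum_distrib_left sum_distrib_right hs[of _ "_::'n"] ac_simps)
  also have "\<dots> = (\<Sum>i\<in>UNIV. \<Sum>j\<in>UNIV. \<Sum>k\<in>UNIV. \<Sum>m\<in>UNIV. \<Sum>r\<in>UNIV. \<Sum>c\<in>UNIV. ?t m r i j k c)"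
    by (rule sum.cong[OF refl], rule sum.cong[OF refl], rule sum.cong[OF refl], rule sum_swap2)
  also have "\<dots> = (\<Sum>i\<in>UNIV. \<Sum>j\<in>UNIV. \<Sum>m\<in>UNIV. \<Sum>r\<in>UNIV. \<Sum>k\<in>UNIV. \<Sum>c\<in>UNIV. ?t m r i j k c)"
    by (rule sum.cong[OF refl], rule sum.cong[OF refl], rule sum_swap2)
  also have "\<dots> = (\<Sum>i\<in>UNIV. \<Sum>m\<in>UNIV. \<Sum>r\<in>UNIV. \<Sum>j\<in>UNIV. \<Sum>k\<in>UNIV. \<Sum>c\<in>UNIV. ?t m r i j k c)"
    by (rule sum.cong[OF refl], rule sum_swap2)
  also have "\<dots> = (\<Sum>m\<in>UNIV. \<Sum>r\<in>UNIV. \<Sum>i\<in>UNIV. \<Sum>j\<in>UNIV. \<Sum>k\<in>UNIV. \<Sum>c\<in>UNIV. ?t m r i j k c)"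
    by (rule sum_swap2)
  also have "\<dots> = (\<Sum>m\<in>UNIV. \<Sum>r\<in>UNIV. II u N (e m) (e m) * II u N (e r) (e r) - (II u N (e m) (e r))\<^sup>2)"
  proof (intro sum.cong refl)
    fix m r
    have 1: "II u N (e r) (e r) * II u N (e m) (e m)
        = (\<Sum>i\<in>UNIV. \<Sum>j\<in>UNIV. \<Sum>k\<in>UNIV. \<Sum>c\<in>UNIV. e r $ i * e r $ j * h i j * (e m $ k * e m $ c * h k c))"
      unfolding II_def h_def by (simp only: sum_distrib_right, simp only: sum_distrib_left)
    have "II u N (e r) (e m) * II u N (e r) (e m)
        = (\<Sum>i\<in>UNIV. \<Sum>k\<in>UNIV. \<Sum>j\<in>UNIV. \<Sum>c\<in>UNIV. e r $ i * e m $ k * h i k * (e r $ j * e m $ c * h j c))"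
      unfolding II_def h_def by (simp only: sum_distrib_right, simp only: sum_distrib_left)
    also have "\<dots> = (\<Sum>i\<in>UNIV. \<Sum>j\<in>UNIV. \<Sum>k\<in>UNIV. \<Sum>c\<in>UNIV. e r $ i * e m $ k * h i k * (e r $ j * e m $ c * h j c))"
      by (rule sum.cong[OF refl], rule sum.swap)
    finally have 2: "(II u N (e m) (e r))\<^sup>2 = \<dots>"
      by (simp add: power2_eq_square II_commute[OF u, of N "e m"])
    show "(\<Sum>i\<in>UNIV. \<Sum>j\<in>UNIV. \<Sum>k\<in>UNIV. \<Sum>c\<in>UNIV. ?t m r i j k c) = II u N (e m) (e m) * II u N (e r) (e r) - (II u N (e m) (e r))\<^sup>2"
      unfolding 2 mult.commute[of "II u N (e m) (e m)"] 1
      by (simp add: sum_subtractf[symmetric] algebra_simps)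
  qed
  finally show ?thesis .
qed

lemma scalar_curvature_eq_0_if_B:
  assumes "u \<in> V" "\<And>i j. B i j u = 0" shows "scalar_curvature g u = 0"
  using assms by (simp add: scalar_curvature_eq)

end

section \<open>The maximum principle\<close>

lemma has_vector_derivative_line:
  fixes G :: "real^'n \<Rightarrow> 'b::real_normed_vector"
  assumes "G differentiable (at (w + s *\<^sub>R b))"
  shows "((\<lambda>t. G (w + t *\<^sub>R b)) has_vector_derivative (\<Sum>i\<in>UNIV. b $ i *\<^sub>R partial_deriv i G (w + s *\<^sub>R b))) (at s)"
proof -
  have 1: "((\<lambda>s. w + s *\<^sub>R b) has_derivative (\<lambda>s. s *\<^sub>R b)) (at s)"
    by (auto intro!: derivative_eq_intros)
  show ?thesis
    using has_derivative_compose[OF 1 has_derivative_sum_partial[OF assms]]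
    by (simp add: has_vector_derivative_def scaleR_sum_right)
qed

text \<open>The second derivative is only assumed at \<open>0\<close>: if it were positive, the first derivative would be
  positive just to the right of \<open>0\<close>.\<close>

lemma second_derivative_le_0_if_local_max:
  fixes \<phi> :: "real \<Rightarrow> real"
  assumes d: "d > 0" and D: "\<And>t. \<bar>t\<bar> < d \<Longrightarrow> (\<phi> has_real_derivative \<phi>' t) (at t)"
    and D2: "(\<phi>' has_real_derivative c) (at 0)" and max: "\<And>t. \<bar>t\<bar> < d \<Longrightarrow> \<phi> t \<le> \<phi> 0"
  shows "\<phi>' 0 = 0" "c \<le> 0"
proof -
  show 0: "\<phi>' 0 = 0"
    using DERIV_local_max[OF D[of 0] d] max d by (simp add: abs_minus_commute)
  show "c \<le> 0"
  proof (rule ccontr)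
    assume "\<not> c \<le> 0"
    then obtain e where e: "e > 0" "\<And>h. 0 < h \<Longrightarrow> h < e \<Longrightarrow> \<phi>' 0 < \<phi>' h"
      using DERIV_pos_inc_right[OF D2] by auto
    define h where "h = min d e / 2"
    have h: "0 < h" "h < d" "h < e" using d e by (auto simp: h_def)
    obtain z where "0 < z" "z < h" "\<phi> h - \<phi> 0 = (h - 0) * \<phi>' z"
      using MVT2[OF h(1), of \<phi> \<phi>'] D h by auto
    then have "\<phi> h > \<phi> 0" using e(2)[of z] h 0 by (smt (verit) mult_pos_pos)
    then show False using max[of h] h by simp
  qed
qed

context immersion begin

lemma II_eq: "II u N a b = N \<bullet> (\<Sum>i\<in>UNIV. \<Sum>j\<in>UNIV. (a $ i * b $ j) *\<^sub>R F2 i j u)"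
  by (simp add: II_def inner_sum_right)

lemma II_add_left: "II u N (a + a') b = II u N a b + II u N a' b"
  by (simp add: II_def distrib_right sum.distrib)

lemma II_scale_left: "II u N (s *\<^sub>R a) b = s * II u N a b"
  by (simp add: II_def sum_distrib_left mult.assoc)

lemma II_add_right: "u \<in> V \<Longrightarrow> II u N b (a + a') = II u N b a + II u N b a'"
  using II_add_left II_commute by metis

lemma II_scale_right: "u \<in> V \<Longrightarrow> II u N b (s *\<^sub>R a) = s * II u N b a"
  using II_scale_left II_commute by metis

text \<open>The 2-by-2 principal minors of a definite form are positive, and the scalar curvature is their sum.\<close>

lemma scalar_curvature_pos_if_definite:
  assumes u: "u \<in> V" and d: "CARD('d) = CARD('n) + 1" and n: "CARD('n) \<ge> 2"
    and N: "norm N = 1" "\<And>i. N \<bullet> F1 i u = 0" and neg: "\<And>b. b \<noteq> 0 \<Longrightarrow> II u N b b < 0"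
  shows "scalar_curvature g u > 0"
proof -
  obtain e :: "'n \<Rightarrow> real^'n" where e: "\<And>m k. DF u (e m) \<bullet> DF u (e k) = (if m = k then 1 else 0)"
    using orthonormal_frame[OF u] by metis
  let ?h = "\<lambda>m k. II u N (e m) (e k)"
  have e0: "e m \<noteq> 0" for m using e[of m m] linear_0[OF linear_DF[OF u]] by auto
  have minor: "?h m m * ?h k k - (?h m k)\<^sup>2 > 0" if "m \<noteq> k" for m k
  proof -
    (* on this combination the form takes the value of the minor times a diagonal entry *)
    define b where "b = ?h m k *\<^sub>R e m + (- ?h m m) *\<^sub>R e k"
    have "DF u b \<bullet> DF u (e k) = - ?h m m"
      by (simp add: b_def linear_add[OF linear_DF[OF u]] linear_cmul[OF linear_DF[OF u]]
          linear_diff[OF linear_DF[OF u]] inner_add_left inner_diff_left e that)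
    then have "b \<noteq> 0" using neg[OF e0[of m]] linear_0[OF linear_DF[OF u]] by auto
    then have "II u N b b < 0" by (rule neg)
    also have "II u N b b = ?h m m * (?h m m * ?h k k - (?h m k)\<^sup>2)"
      unfolding b_def II_add_left II_add_right[OF u] II_scale_left II_scale_right[OF u]
        II_commute[OF u, of N "e k" "e m"]
      by (simp add: algebra_simps power2_eq_square)
    finally show ?thesis using neg[OF e0[of m]] by (simp add: mult_less_0_iff)
  qed
  have nonneg: "0 \<le> ?h m m * ?h k k - (?h m k)\<^sup>2" for m k
    using minor[of m k] by (cases "m = k") (auto simp: power2_eq_square)
  obtain m k :: 'n where "m \<noteq> k"
    using n card_le_Suc0_iff_eq[of "UNIV :: 'n set"] by auto
  have row: "0 < (\<Sum>k\<in>UNIV. ?h m m * ?h k k - (?h m k)\<^sup>2)"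
    by (rule sum_pos2[where i = k]) (use minor[OF \<open>m \<noteq> k\<close>] nonneg in auto)
  have "0 < (\<Sum>m\<in>UNIV. \<Sum>k\<in>UNIV. ?h m m * ?h k k - (?h m k)\<^sup>2)"
    by (rule sum_pos2[where i = m], simp_all only: finite UNIV_I row)
      (rule sum_nonneg, rule nonneg)
  then show ?thesis using scalar_curvature_frame[OF u d N e] by simp
qed

text \<open>The level sets of \<open>l \<bullet> X + \<epsilon> \<bar>X\<bar>\<^sup>2\<close> are spheres. At a local maximum on the hypersurface, the
  hypersurface lies inside such a sphere and touches it, so it is at least as curved as the sphere.
  In formulas: the gradient \<open>W\<close> is normal, and the second derivative of the function along lines
  of the chart bounds the second fundamental form by a negative multiple of the metric.\<close>

lemma scalar_curvature_pos_at_max: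
  assumes u: "u \<in> V" and d: "CARD('d) = CARD('n) + 1" and n: "CARD('n) \<ge> 2"
    and \<epsilon>: "\<epsilon> > 0" and r: "r > 0" "ball u r \<subseteq> V"
    and max: "\<And>v. v \<in> ball u r \<Longrightarrow> l \<bullet> F v + \<epsilon> * (F v \<bullet> F v) \<le> l \<bullet> F u + \<epsilon> * (F u \<bullet> F u)"
  shows "scalar_curvature g u > 0"
proof -
  define W where "W = l + (2 * \<epsilon>) *\<^sub>R F u"
  define Q where "Q b = (\<Sum>i\<in>UNIV. \<Sum>j\<in>UNIV. (b $ i * b $ j) *\<^sub>R F2 i j u)" for b :: "real^'n"
  have key: "W \<bullet> DF u b = 0" "W \<bullet> Q b + 2 * \<epsilon> * (DF u b \<bullet> DF u b) \<le> 0" for b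
  proof -
    define dl where "dl = r / (norm b + 1)"
    have dl: "dl > 0" using r by (simp add: dl_def add_nonneg_pos)
    have inb: "u + t *\<^sub>R b \<in> ball u r" if "\<bar>t\<bar> < dl" for t
    proof -
      have "\<bar>t\<bar> * norm b \<le> \<bar>t\<bar> * (norm b + 1)" by (simp add: mult_left_mono)
      also have "\<dots> < r" using that by (simp add: dl_def pos_less_divide_eq add_nonneg_pos)
      finally show ?thesis by (simp add: dist_norm)
    qed
    then have inV: "u + t *\<^sub>R b \<in> V" if "\<bar>t\<bar> < dl" for t using that r by blast
    define D where "D t = (\<Sum>i\<in>UNIV. b $ i *\<^sub>R F1 i (u + t *\<^sub>R b))" for t
    have dF: "((\<lambda>t. F (u + t *\<^sub>R b)) has_vector_derivative D t) (at t)" if "\<bar>t\<bar> < dl" for t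
      unfolding D_def using that inV by (intro has_vector_derivative_line differentiable)
    have "(D has_vector_derivative (\<Sum>i\<in>UNIV. b $ i *\<^sub>R (\<Sum>j\<in>UNIV. b $ j *\<^sub>R F2 i j (u + 0 *\<^sub>R b)))) (at 0)"
      unfolding D_def using u
      by (intro has_vector_derivative_sum bounded_linear.has_vector_derivative[OF bounded_linear_scaleR_right]
           has_vector_derivative_line differentiable) simp
    then have dD: "(D has_vector_derivative Q b) (at 0)"
      by (simp add: Q_def scaleR_sum_right)
    define \<phi> where "\<phi> t = l \<bullet> F (u + t *\<^sub>R b) + \<epsilon> * (F (u + t *\<^sub>R b) \<bullet> F (u + t *\<^sub>R b))" for t
    define \<phi>' where "\<phi>' t = l \<bullet> D t + 2 * \<epsilon> * (F (u + t *\<^sub>R b) \<bullet> D t)" for t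
    have dphi: "(\<phi> has_real_derivative \<phi>' t) (at t)" if "\<bar>t\<bar> < dl" for t
      using dF[OF that] unfolding \<phi>_def \<phi>'_def has_real_derivative_iff_has_vector_derivative has_vector_derivative_def
      by (auto intro!: derivative_eq_intros simp: fun_eq_iff inner_commute algebra_simps)
    have dphi': "(\<phi>' has_real_derivative (l \<bullet> Q b + 2 * \<epsilon> * (F u \<bullet> Q b + D 0 \<bullet> D 0))) (at 0)"
      using dF[of 0] dD dl unfolding \<phi>'_def has_real_derivative_iff_has_vector_derivative has_vector_derivative_def
      by (auto intro!: derivative_eq_intros simp: fun_eq_iff inner_commute algebra_simps)
    have mx: "\<phi> t \<le> \<phi> 0" if "\<bar>t\<bar> < dl" for t
      using max[OF inb[OF that]] by (simp add: \<phi>_def)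
    note res = second_derivative_le_0_if_local_max[OF dl dphi dphi' mx]
    have D0: "D 0 = DF u b" by (simp add: D_def DF_eq[OF u])
    show "W \<bullet> DF u b = 0"
      using res(1) by (simp add: \<phi>'_def D0 W_def inner_add_left)
    show "W \<bullet> Q b + 2 * \<epsilon> * (DF u b \<bullet> DF u b) \<le> 0"
      using res(2) by (simp add: D0 W_def inner_add_left algebra_simps)
  qed
  have pos: "DF u b \<bullet> DF u b > 0" if "b \<noteq> 0" for b
    using that DF_eq_0_iff[OF u] by simp
  have W0: "W \<noteq> 0"
  proof
    assume "W = 0"
    then have "2 * \<epsilon> * (DF u (axis i 1) \<bullet> DF u (axis i 1)) \<le> 0" for i using key(2)[of "axis i 1"] by simp
    then show False using pos[of "axis undefined 1"] \<epsilon> by (smt (verit) axis_eq_0_iff mult_pos_pos)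
  qed
  define N where "N = W /\<^sub>R norm W"
  show ?thesis
  proof (rule scalar_curvature_pos_if_definite[OF u d n, of N])
    show "norm N = 1" using W0 by (simp add: N_def)
    show "N \<bullet> F1 i u = 0" for i using key(1)[of "axis i 1"] by (simp add: N_def DF_axis)
    fix b :: "real^'n" assume b: "b \<noteq> 0"
    have "W \<bullet> Q b < 0" using key(2)[of b] pos[OF b] \<epsilon> by (smt (verit) mult_pos_pos)
    then show "II u N b b < 0"
      using W0 by (simp add: II_eq N_def Q_def[symmetric] mult_less_0_iff)
  qed
qed

section \<open>Immersions are locally close to their derivative\<close>

text \<open>Since the first partial derivatives are continuous, the linear approximation is uniform in both
  points. Together with the lower bound for the injective derivative it controls the distance of two
  nearby points of the chart by the distance of their images.\<close>

lemma strong_differentiability: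
  assumes u: "u \<in> V" and \<epsilon>: "\<epsilon> > 0"
  obtains \<delta> where "\<delta> > 0" "ball u \<delta> \<subseteq> V"
    "\<And>v w. v \<in> ball u \<delta> \<Longrightarrow> w \<in> ball u \<delta> \<Longrightarrow> norm (F v - F w - DF u (v - w)) \<le> \<epsilon> * norm (v - w)"
proof -
  define c where "c = \<epsilon> / CARD('n)"
  have c: "c > 0" using \<epsilon> by (simp add: c_def)
  have "\<exists>\<delta>>0. \<forall>v. dist v u < \<delta> \<longrightarrow> dist (F1 i v) (F1 i u) < c" for i
    using differentiable_imp_continuous_within[OF differentiable(2)[OF u, of i]] c
    unfolding continuous_at_eps_delta by blast
  then obtain dl where dl: "\<And>i. dl i > 0" "\<And>i v. dist v u < dl i \<Longrightarrow> dist (F1 i v) (F1 i u) < c"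
    by metis
  obtain r where r: "r > 0" "ball u r \<subseteq> V" using open_V u open_contains_ball by blast
  define \<delta> where "\<delta> = Min (insert r (range dl))"
  have \<delta>: "\<delta> > 0" "\<delta> \<le> r" "\<delta> \<le> dl i" for i
    using r dl unfolding \<delta>_def by (auto intro!: Min_le simp del: Min_insert)
  have sub: "ball u \<delta> \<subseteq> V" using \<delta> r by (meson order_trans subset_ball)
  have der: "((\<lambda>x. F x - DF u x) has_derivative (\<lambda>b. DF v b - DF u b)) (at v within ball u \<delta>)"
    if "v \<in> ball u \<delta>" for v
  proof -
    have "v \<in> V" using that sub by blast
    then have "(F has_derivative DF v) (at v)"
      using differentiable(1) frechet_derivative_works by blast
    moreover have "(DF u has_derivative DF u) (at v)"
      using linear_DF[OF u] by (simp add: linear_imp_has_derivative)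
    ultimately show ?thesis by (rule has_derivative_at_withinI[OF has_derivative_diff])
  qed
  have bound: "onorm (\<lambda>b. DF v b - DF u b) \<le> \<epsilon>" if v: "v \<in> ball u \<delta>" for v
  proof (rule onorm_bound)
    show "0 \<le> \<epsilon>" using \<epsilon> by simp
    fix b :: "real^'n"
    have vV: "v \<in> V" using v sub by blast
    have close: "norm (F1 i v - F1 i u) \<le> c" for i
    proof -
      have "dist v u < dl i" using v \<delta>(3)[of i] by (simp add: dist_commute)
      then show ?thesis using dl(2)[of v i] by (simp add: dist_norm)
    qed
    have "norm (DF v b - DF u b) = norm (\<Sum>i\<in>UNIV. b $ i *\<^sub>R (F1 i v - F1 i u))"
      by (simp add: DF_eq[OF vV] DF_eq[OF u] sum_subtractf scaleR_diff_right)
    also have "\<dots> \<le> (\<Sum>i\<in>UNIV. norm (b $ i *\<^sub>R (F1 i v - F1 i u)))" by (rule norm_sum)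
    also have "\<dots> \<le> (\<Sum>i\<in>(UNIV::'n set). norm b * c)"
      using close by (intro sum_mono) (auto intro: mult_mono component_le_norm_cart)
    also have "\<dots> = \<epsilon> * norm b" by (simp add: c_def)
    finally show "norm (DF v b - DF u b) \<le> \<epsilon> * norm b" .
  qed
  have "norm (F v - F w - DF u (v - w)) \<le> \<epsilon> * norm (v - w)" if "v \<in> ball u \<delta>" "w \<in> ball u \<delta>" for v w
    using differentiable_bound[OF convex_ball der bound that]
    by (simp add: linear_diff[OF linear_DF[OF u]] algebra_simps)
  then show ?thesis using that \<delta> sub by blast
qed

lemma DF_bounded_below:
  assumes "u \<in> V" obtains \<kappa> where "\<kappa> > 0" "\<And>b. \<kappa> * norm b \<le> norm (DF u b)"
proof -
  obtain B where "B > 0" "\<And>x. B * norm x \<le> norm (DF u x)"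
    using linear_inj_bounded_below_pos[OF linear_DF[OF assms] inj_deriv[OF assms]] by metis
  then show ?thesis using that by blast
qed

lemma locally_injective:
  assumes "u \<in> V" obtains \<delta> where "\<delta> > 0" "ball u \<delta> \<subseteq> V" "inj_on F (ball u \<delta>)"
proof -
  obtain \<kappa> where \<kappa>: "\<kappa> > 0" "\<And>b. \<kappa> * norm b \<le> norm (DF u b)" using DF_bounded_below[OF assms] by blast
  obtain \<delta> where \<delta>: "\<delta> > 0" "ball u \<delta> \<subseteq> V"
    "\<And>v w. v \<in> ball u \<delta> \<Longrightarrow> w \<in> ball u \<delta> \<Longrightarrow> norm (F v - F w - DF u (v - w)) \<le> \<kappa> / 2 * norm (v - w)"
    using strong_differentiability[OF assms, of "\<kappa> / 2"] \<kappa> by auto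
  have "inj_on F (ball u \<delta>)"
  proof (rule inj_onI)
    fix v w assume vw: "v \<in> ball u \<delta>" "w \<in> ball u \<delta>" "F v = F w"
    then have "\<kappa> * norm (v - w) \<le> \<kappa> / 2 * norm (v - w)"
      using \<kappa>(2)[of "v - w"] \<delta>(3)[OF vw(1,2)] by simp
    then show "v = w" using \<kappa>(1) by (simp add: mult_le_cancel_right1)
  qed
  then show ?thesis using that \<delta> by blast
qed

end

section \<open>Rotationally symmetric scalar-flat immersions\<close>

text \<open>Infinitesimal rotational symmetry about the axis through \<open>p\<close> with direction \<open>\<nu>\<close>: the vector fields
  of the rotations about this axis are tangent to the hypersurface.\<close>

locale rotational_immersion = immersion F V
  for F :: "real^'n \<Rightarrow> real^'d" and V +
  fixes p \<nu> :: "real^'d"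
  assumes norm_\<nu>: "norm \<nu> = 1" and card_d: "CARD('d) = CARD('n) + 1" and card_n: "CARD('n) \<ge> 3"
    and rotation_tangent: "\<And>u a b. u \<in> V \<Longrightarrow> a \<bullet> \<nu> = 0 \<Longrightarrow> b \<bullet> \<nu> = 0 \<Longrightarrow>
      \<exists>k. DF u k = ((F u - p) \<bullet> a) *\<^sub>R b - ((F u - p) \<bullet> b) *\<^sub>R a"
    and flat: "\<And>u. u \<in> V \<Longrightarrow> scalar_curvature g u = 0"
begin

text \<open>\<open>X\<close> is the position relative to the axis. The tangential part \<open>\<tau>\<close> of the axis direction is the
  gradient of the height \<open>\<nu> \<bullet> F\<close>, with covariant components \<open>z\<close>, contravariant components \<open>v\<close> and
  square length \<open>w\<close>. Defined in this way, \<open>w\<close> is differentiable without a choice of normal vector.\<close>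

definition "X u = (F u - p) - ((F u - p) \<bullet> \<nu>) *\<^sub>R \<nu>"

definition "z i u = \<nu> \<bullet> F1 i u"

definition "v i u = (\<Sum>j\<in>UNIV. P u $ i $ j * z j u)"

definition "w u = (\<Sum>i\<in>UNIV. v i u * z i u)"

definition "\<tau> u = (\<Sum>i\<in>UNIV. v i u *\<^sub>R F1 i u)"

lemma II_axis: "II u N a (axis m 1) = (\<Sum>i\<in>UNIV. a $ i * (N \<bullet> F2 i m u))"
proof -
  have "a $ i * axis m 1 $ j * (N \<bullet> F2 i j u) = (if j = m then a $ i * (N \<bullet> F2 i m u) else 0)" for i j
    by (simp add: axis_def)
  then show ?thesis by (simp add: II_def)
qed

lemma \<nu>\<nu>: "\<nu> \<bullet> \<nu> = 1" using norm_\<nu> by (simp add: dot_square_norm)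

lemma X_orth: "X u \<bullet> \<nu> = 0" "\<nu> \<bullet> X u = 0"
  by (simp_all add: X_def inner_diff_left inner_diff_right \<nu>\<nu> inner_commute)

lemma inner_X: "a \<bullet> \<nu> = 0 \<Longrightarrow> X u \<bullet> a = (F u - p) \<bullet> a"
  by (simp add: X_def inner_diff_left inner_commute[of \<nu> a])

lemma v_lower: "u \<in> V \<Longrightarrow> (\<Sum>i\<in>UNIV. v i u * g u $ i $ k) = z k u"
proof -
  assume u: "u \<in> V"
  have "(\<Sum>i\<in>UNIV. v i u * g u $ i $ k) = (\<Sum>i\<in>UNIV. \<Sum>j\<in>UNIV. z j u * (P u $ j $ i * g u $ i $ k))"
    by (simp add: v_def sum_distrib_left P_sym[OF u, of _ "_::'n"] ac_simps)
  also have "\<dots> = (\<Sum>j\<in>UNIV. z j u * (\<Sum>i\<in>UNIV. P u $ j $ i * g u $ i $ k))"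
    by (subst sum.swap) (simp add: sum_distrib_left)
  also have "\<dots> = z k u" by (simp add: P_mult_g[OF u] if_distrib cong: if_cong)
  finally show ?thesis .
qed

lemma \<tau>_DF: "u \<in> V \<Longrightarrow> \<tau> u = DF u (\<chi> i. v i u)"
  by (simp add: \<tau>_def DF_eq)

lemma \<tau>_inner: "u \<in> V \<Longrightarrow> \<tau> u \<bullet> F1 k u = z k u"
  by (simp add: \<tau>_def inner_sum_left g_nth[symmetric] v_lower)

lemma w_eq: assumes u: "u \<in> V" shows "w u = \<tau> u \<bullet> \<tau> u" "w u = \<nu> \<bullet> \<tau> u"
proof -
  have "\<tau> u \<bullet> \<tau> u = (\<Sum>i\<in>UNIV. v i u * (\<tau> u \<bullet> F1 i u))"
    by (subst (2) \<tau>_def) (simp add: inner_sum_right)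
  then show "w u = \<tau> u \<bullet> \<tau> u" by (simp add: w_def \<tau>_inner[OF u])
  show "w u = \<nu> \<bullet> \<tau> u" by (simp add: w_def \<tau>_def inner_sum_right z_def)
qed

lemma exists_unit_normal:
  assumes u: "u \<in> V" obtains N where "norm N = 1" "\<And>i. N \<bullet> F1 i u = 0"
proof -
  have "dim (range (DF u)) = CARD('n)"
    using dim_image_eq[OF linear_DF[OF u], of UNIV] inj_deriv[OF u] by simp
  then have "dim (range (DF u)) < DIM(real^'d)" using card_d by simp
  then obtain x where x: "x \<noteq> 0" "\<And>y. y \<in> span (range (DF u)) \<Longrightarrow> orthogonal x y"
    using orthogonal_to_subspace_exists by blast
  have "x \<bullet> F1 i u = 0" for i
    using x(2)[OF span_base[OF rangeI[of "DF u" "axis i 1"]]] by (simp add: DF_axis orthogonal_def)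
  then show ?thesis using that[of "x /\<^sub>R norm x"] x(1) by simp
qed

lemma \<nu>_decomp:
  assumes u: "u \<in> V" and N: "norm N = 1" "\<And>i. N \<bullet> F1 i u = 0"
  shows "\<nu> = \<tau> u + (\<nu> \<bullet> N) *\<^sub>R N" "w u = 1 - (\<nu> \<bullet> N)\<^sup>2"
proof -
  have "F1 i u \<bullet> N = 0" for i using N(2)[of i] by (simp add: inner_commute)
  then have N\<tau>: "\<tau> u \<bullet> N = 0" by (simp add: \<tau>_def inner_sum_left)
  have "\<nu> - \<tau> u = ((\<nu> - \<tau> u) \<bullet> N) *\<^sub>R N"
    using u by (intro normal_line[OF u card_d N]) (simp add: inner_diff_left \<tau>_inner z_def)
  then show 1: "\<nu> = \<tau> u + (\<nu> \<bullet> N) *\<^sub>R N" by (simp add: inner_diff_left N\<tau> algebra_simps)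
  have "w u = \<nu> \<bullet> (\<nu> - (\<nu> \<bullet> N) *\<^sub>R N)" using w_eq(2)[OF u] 1 by (metis add_diff_cancel_right')
  then show "w u = 1 - (\<nu> \<bullet> N)\<^sup>2" by (simp add: inner_diff_right \<nu>\<nu> power2_eq_square)
qed

lemma differentiable_z: "u \<in> V \<Longrightarrow> z i differentiable (at u)"
  unfolding z_def[abs_def] by (intro differentiable_inner differentiable) auto

lemma partial_z: "u \<in> V \<Longrightarrow> partial_deriv k (z i) u = \<nu> \<bullet> F2 i k u"
  unfolding z_def[abs_def]
  using partial_deriv_inner[OF differentiable_const differentiable(2), of u k \<nu> i]
  by (simp add: partial_deriv_def)

lemma differentiable_v: "u \<in> V \<Longrightarrow> v i differentiable (at u)"
  unfolding v_def[abs_def]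
  by (intro differentiable_sum differentiable_mult differentiable_P differentiable_z ballI finite)

lemma differentiable_w: "u \<in> V \<Longrightarrow> w differentiable (at u)"
  unfolding w_def[abs_def]
  by (intro differentiable_sum differentiable_mult differentiable_v differentiable_z ballI finite)

text \<open>The normal part of \<open>\<nu>\<close> changes along the hypersurface by the second fundamental form applied to the
  tangential part, and \<open>w = 1 - (\<nu> \<bullet> N)\<^sup>2\<close>. Instead of a derivative of \<open>N\<close> the computation uses that of
  the identity \<open>v_lower\<close>.\<close>

lemma partial_w:
  assumes u: "u \<in> V" and N: "norm N = 1" "\<And>i. N \<bullet> F1 i u = 0"
  shows "partial_deriv k w u = 2 * (\<nu> \<bullet> N) * II u N (\<chi> i. v i u) (axis k 1)"
proof -
  define Y where "Y = (\<Sum>j\<in>UNIV. v j u *\<^sub>R F2 j k u)"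
  have "(\<Sum>i\<in>UNIV. v i u * (F1 i u \<bullet> F2 j k u + F2 i k u \<bullet> F1 j u) + partial_deriv k (v i) u * g u $ i $ j)
      = \<nu> \<bullet> F2 j k u" for j
  proof -
    have "partial_deriv k (z j) u = partial_deriv k (\<lambda>x. \<Sum>i\<in>UNIV. v i x * g x $ i $ j) u"
      using v_lower by (intro partial_deriv_cong[OF open_V u _ differentiable_z[OF u]]) auto
    also have "\<dots> = (\<Sum>i\<in>UNIV. v i u * (F1 i u \<bullet> F2 j k u + F2 i k u \<bullet> F1 j u) + partial_deriv k (v i) u * g u $ i $ j)"
      by (simp add: partial_deriv_sum partial_deriv_mult differentiable_mult u differentiable_v
        differentiable_g partial_g)
    finally show ?thesis by (simp add: partial_z[OF u])
  qed
  then have "\<tau> u \<bullet> F2 j k u + Y \<bullet> F1 j u + (\<Sum>i\<in>UNIV. partial_deriv k (v i) u * g u $ i $ j) = \<nu> \<bullet> F2 j k u" for j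
    by (simp add: sum.distrib distrib_left \<tau>_def Y_def inner_sum_left)
  then have "(\<Sum>j\<in>UNIV. v j u * (\<tau> u \<bullet> F2 j k u + Y \<bullet> F1 j u + (\<Sum>i\<in>UNIV. partial_deriv k (v i) u * g u $ i $ j)))
      = (\<Sum>j\<in>UNIV. v j u * (\<nu> \<bullet> F2 j k u))" by simp
  moreover have "(\<Sum>j\<in>UNIV. v j u * (\<Sum>i\<in>UNIV. partial_deriv k (v i) u * g u $ i $ j))
      = (\<Sum>i\<in>UNIV. partial_deriv k (v i) u * z i u)"
  proof -
    have "(\<Sum>j\<in>UNIV. v j u * (\<Sum>i\<in>UNIV. partial_deriv k (v i) u * g u $ i $ j))
      = (\<Sum>i\<in>UNIV. partial_deriv k (v i) u * (\<Sum>j\<in>UNIV. v j u * g u $ j $ i))"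
      unfolding sum_distrib_left by (subst sum.swap) (simp add: g_sym[of u] ac_simps)
    then show ?thesis by (simp add: v_lower[OF u])
  qed
  moreover have "(\<Sum>j\<in>UNIV. v j u * (\<tau> u \<bullet> F2 j k u)) = \<tau> u \<bullet> Y" "(\<Sum>j\<in>UNIV. v j u * (\<nu> \<bullet> F2 j k u)) = \<nu> \<bullet> Y"
    unfolding Y_def by (simp_all add: inner_sum_right)
  moreover have "(\<Sum>j\<in>UNIV. v j u * (Y \<bullet> F1 j u)) = \<tau> u \<bullet> Y"
    unfolding \<tau>_def inner_sum_left by (simp add: inner_commute)
  ultimately have 1: "2 * (\<tau> u \<bullet> Y) + (\<Sum>i\<in>UNIV. partial_deriv k (v i) u * z i u) = \<nu> \<bullet> Y"
    by (simp add: distrib_left sum.distrib)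
  have "partial_deriv k w u = (\<Sum>i\<in>UNIV. v i u * (\<nu> \<bullet> F2 i k u) + partial_deriv k (v i) u * z i u)"
    unfolding w_def[abs_def]
    by (simp add: partial_deriv_sum partial_deriv_mult differentiable_mult u differentiable_v
        differentiable_z partial_z)
  also have "\<dots> = \<nu> \<bullet> Y + (\<Sum>i\<in>UNIV. partial_deriv k (v i) u * z i u)"
    by (simp add: sum.distrib Y_def inner_sum_right)
  also have "\<dots> = 2 * ((\<nu> - \<tau> u) \<bullet> Y)" using 1 by (simp add: inner_diff_left)
  also have "\<nu> - \<tau> u = (\<nu> \<bullet> N) *\<^sub>R N" using \<nu>_decomp(1)[OF u N] by (metis add_diff_cancel_left')
  finally show ?thesis by (simp add: II_axis Y_def inner_sum_right sum_distrib_left ac_simps)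
qed

text \<open>The rotation field \<open>J\<close>, \<open>J y = (y \<bullet> a) b - (y \<bullet> b) a\<close>, is a tangent field along \<open>F\<close>. The normal
  part of the derivative of a tangent field is given by the second fundamental form, and the derivative
  of \<open>J\<close> is \<open>J\<close> itself because it is linear.\<close>

lemma II_rotation_field:
  assumes u: "u \<in> V" and N: "\<And>i. N \<bullet> F1 i u = 0" and ab: "a \<bullet> \<nu> = 0" "b \<bullet> \<nu> = 0"
    and k: "DF u k = ((F u - p) \<bullet> a) *\<^sub>R b - ((F u - p) \<bullet> b) *\<^sub>R a"
  shows "II u N k c = (DF u c \<bullet> a) * (N \<bullet> b) - (DF u c \<bullet> b) * (N \<bullet> a)"
proof -
  define J where "J y = (y \<bullet> a) *\<^sub>R b - (y \<bullet> b) *\<^sub>R a" for y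
  define K where "K i x = (\<Sum>j\<in>UNIV. P x $ i $ j * (J (F x - p) \<bullet> F1 j x))" for i x
  have linJ: "bounded_linear J"
    unfolding J_def by (intro bounded_linear_sub bounded_linear_compose[OF bounded_linear_scaleR_left] bounded_linear_inner_left)
  have dJ: "(\<lambda>x. J (F x - p)) differentiable (at x)" if "x \<in> V" for x
  proof -
    have "((\<lambda>x. F x - p) has_derivative DF x) (at x)"
      using differentiable(1)[OF that] by (auto intro!: derivative_eq_intros simp: frechet_derivative_works)
    from bounded_linear.has_derivative[OF linJ this] show ?thesis
      unfolding differentiable_def by blast
  qed
  have pJ: "partial_deriv m (\<lambda>x. J (F x - p)) u = J (F1 m u)" for m
  proof -
    have "((\<lambda>x. F x - p) has_derivative DF u) (at u)"
      using differentiable(1)[OF u] by (auto intro!: derivative_eq_intros simp: frechet_derivative_works)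
    from partial_deriv_eq[OF bounded_linear.has_derivative[OF linJ this]] show ?thesis
      by (simp add: DF_axis)
  qed
  have dK: "K i differentiable (at u)" for i
    unfolding K_def[abs_def] using u
    by (intro differentiable_sum differentiable_mult differentiable_P differentiable_inner dJ differentiable ballI finite)
  have comps: "K i x = q $ i" if x: "x \<in> V" and q: "DF x q = J (F x - p)" for x q i
  proof -
    have "K i x = (\<Sum>j\<in>UNIV. P x $ i $ j * (\<Sum>m\<in>UNIV. q $ m * g x $ j $ m))"
      unfolding K_def q[symmetric] DF_eq[OF x] inner_sum_left by (simp add: g_nth inner_commute)
    also have "\<dots> = (\<Sum>m\<in>UNIV. q $ m * (\<Sum>j\<in>UNIV. P x $ i $ j * g x $ j $ m))"
      unfolding sum_distrib_left by (subst sum.swap) (simp add: ac_simps)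
    also have "\<dots> = q $ i" by (simp add: P_mult_g[OF x] if_distrib cong: if_cong)
    finally show ?thesis .
  qed
  have KF: "(\<Sum>i\<in>UNIV. K i x *\<^sub>R F1 i x) = J (F x - p)" if x: "x \<in> V" for x
  proof -
    obtain q where "DF x q = J (F x - p)" using rotation_tangent[OF x ab] unfolding J_def by blast
    then show ?thesis using comps[OF x] DF_eq[OF x, of q] by simp
  qed
  have dKF: "(\<lambda>x. K i x *\<^sub>R F1 i x) differentiable (at u)" for i
    using dK u by (intro differentiable_scaleR differentiable) auto
  have pKF: "partial_deriv m (\<lambda>x. K i x *\<^sub>R F1 i x) u = K i u *\<^sub>R F2 i m u + partial_deriv m (K i) u *\<^sub>R F1 i u" for i m
    using partial_deriv_eq[OF has_derivative_scaleR[OF dK[unfolded frechet_derivative_works] differentiable(2)[OF u, unfolded frechet_derivative_works]]]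
    by (simp add: partial_deriv_def)
  have axis: "II u N k (axis m 1) = (F1 m u \<bullet> a) * (N \<bullet> b) - (F1 m u \<bullet> b) * (N \<bullet> a)" for m
  proof -
    have "J (F1 m u) = partial_deriv m (\<lambda>x. \<Sum>i\<in>UNIV. K i x *\<^sub>R F1 i x) u"
      using pJ[of m] KF by (simp add: partial_deriv_cong[OF open_V u _ dJ[OF u], of "\<lambda>x. \<Sum>i\<in>UNIV. K i x *\<^sub>R F1 i x"])
    also have "\<dots> = (\<Sum>i\<in>UNIV. K i u *\<^sub>R F2 i m u + partial_deriv m (K i) u *\<^sub>R F1 i u)"
      by (subst partial_deriv_sum) (simp_all add: dKF pKF)
    finally have "N \<bullet> J (F1 m u) = (\<Sum>i\<in>UNIV. k $ i * (N \<bullet> F2 i m u))"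
      using comps[OF u, of k] k by (simp add: inner_sum_right inner_add_right N J_def)
    then show ?thesis
      by (simp add: II_axis J_def inner_diff_right)
  qed
  have "II u N k c = (\<Sum>m\<in>UNIV. c $ m * II u N k (axis m 1))"
    unfolding II_axis unfolding II_def sum_distrib_left by (subst sum.swap) (simp add: ac_simps)
  also have "\<dots> = (DF u c \<bullet> a) * (N \<bullet> b) - (DF u c \<bullet> b) * (N \<bullet> a)"
    unfolding axis DF_eq[OF u, of c]
    by (simp add: inner_sum_left sum_distrib_right right_diff_distrib sum_subtractf mult.assoc)
  finally show ?thesis .
qed

text \<open>Off the axis the normal lies in the plane of the axis and of the radial direction. The orbit
  directions are principal with one and the same curvature \<open>k1\<close>. Where the tangent plane is not
  horizontal there is one more direction \<open>t\<close>; scalar-flatness determines its curvature as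
  \<open>- (n - 2) k1 / 2\<close>, and this is the curvature that governs the derivative of \<open>w\<close>.\<close>

lemma partial_w_radial:
  assumes u: "u \<in> V" and X0: "X u \<noteq> 0"
  shows "(X u \<bullet> X u) * partial_deriv m w u = - (real CARD('n) - 2) * w u * (X u \<bullet> F1 m u)"
proof -
  obtain N where N: "norm N = 1" "\<And>i. N \<bullet> F1 i u = 0" using exists_unit_normal[OF u] by blast
  define r where "r = norm (X u)"
  have r: "r > 0" using X0 by (simp add: r_def)
  define e where "e = X u /\<^sub>R r"
  have ee: "e \<bullet> e = 1" using r by (simp add: e_def dot_square_norm r_def power2_eq_square)
  have e\<nu>: "e \<bullet> \<nu> = 0" "\<nu> \<bullet> e = 0" by (simp_all add: e_def X_orth)
  have Xe: "X u = r *\<^sub>R e" using r by (simp add: e_def)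
  define \<alpha> where "\<alpha> = N \<bullet> e"
  define \<beta> where "\<beta> = \<nu> \<bullet> N"
  have NN: "N \<bullet> N = 1" using N by (simp add: dot_square_norm)
  have orbit: "\<exists>k. DF u k = a \<and> (\<forall>c. II u N k c = - (\<alpha> / r) * (DF u c \<bullet> a))" if a: "a \<bullet> \<nu> = 0" "a \<bullet> e = 0" for a
  proof -
    have Fe: "(F u - p) \<bullet> e = r" using inner_X[OF e\<nu>(1), of u] ee by (simp add: Xe)
    have Fa: "(F u - p) \<bullet> a = 0" using inner_X[OF a(1), of u] a by (simp add: Xe inner_commute)
    obtain k where k: "DF u k = ((F u - p) \<bullet> e) *\<^sub>R a - ((F u - p) \<bullet> a) *\<^sub>R e"
      using rotation_tangent[OF u e\<nu>(1) a(1)] by blast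
    then have DFk: "DF u k = r *\<^sub>R a" by (simp add: Fe Fa)
    have Na: "N \<bullet> a = 0"
    proof -
      have "N \<bullet> DF u k = 0" using N(2) by (simp add: DF_eq[OF u] inner_sum_right)
      then show ?thesis using DFk r by simp
    qed
    have "II u N k c = - \<alpha> * (DF u c \<bullet> a)" for c
      using II_rotation_field[OF u N(2) e\<nu>(1) a(1) k, of c] by (simp add: Na \<alpha>_def)
    then have "II u N (k /\<^sub>R r) c = - (\<alpha> / r) * (DF u c \<bullet> a)" for c
      by (simp only: II_scale_left) (simp add: divide_inverse)
    moreover have "DF u (k /\<^sub>R r) = a" using DFk r by (simp add: linear_cmul[OF linear_DF[OF u]])
    ultimately show ?thesis by blast
  qed
  have Neq: "N = \<alpha> *\<^sub>R e + \<beta> *\<^sub>R \<nu>"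
  proof -
    define a where "a = N - \<alpha> *\<^sub>R e - \<beta> *\<^sub>R \<nu>"
    have a: "a \<bullet> \<nu> = 0" "a \<bullet> e = 0"
      by (simp_all add: a_def inner_diff_left e\<nu> \<nu>\<nu> ee \<alpha>_def \<beta>_def inner_commute[of \<nu> N])
    then obtain k where "DF u k = a" using orbit by blast
    then have "N \<bullet> a = 0" using N(2) by (auto simp: DF_eq[OF u] inner_sum_right)
    moreover have "a \<bullet> a = a \<bullet> N - \<alpha> * (a \<bullet> e) - \<beta> * (a \<bullet> \<nu>)"
      by (subst (2) a_def) (simp add: inner_diff_right)
    ultimately have "a \<bullet> a = 0" using a by (simp add: inner_commute[of a N])
    then show ?thesis by (simp add: a_def diff_eq_eq add.commute)
  qed
  have \<alpha>\<beta>: "\<alpha>\<^sup>2 + \<beta>\<^sup>2 = 1"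
    using NN by (simp add: Neq inner_add_left inner_add_right e\<nu> ee \<nu>\<nu> power2_eq_square)
  have w\<alpha>: "w u = \<alpha>\<^sup>2" using \<nu>_decomp(2)[OF u N] \<alpha>\<beta> by (simp add: \<beta>_def)
  have \<tau>eq: "\<tau> u = \<nu> - \<beta> *\<^sub>R N" using \<nu>_decomp(1)[OF u N] by (simp add: \<beta>_def algebra_simps)
  have vDF: "DF u (\<chi> i. v i u) = \<tau> u" using \<tau>_DF[OF u] by simp
  show ?thesis
  proof (cases "\<alpha> = 0")
    case True
    then have "w u = 0" by (simp add: w\<alpha>)
    then have "\<tau> u = 0" using w_eq(1)[OF u] by simp
    then have "(\<chi> i. v i u) = 0" using vDF DF_eq_0_iff[OF u] by metis
    then have "II u N (\<chi> i. v i u) (axis m 1) = 0" by (simp add: II_def)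
    then show ?thesis using partial_w[OF u N, of m] \<open>w u = 0\<close> by simp
  next
    case \<alpha>0: False
    (* the unit tangent vector of the profile curve; q is its preimage in the chart *)
    define t where "t = \<alpha> *\<^sub>R \<nu> - \<beta> *\<^sub>R e"
    define q where "q = (1 / \<alpha>) *\<^sub>R (\<chi> i. v i u)"
    define \<kappa> where "\<kappa> = II u N q q"
    define k1 where "k1 = - (\<alpha> / r)"
    have tt: "t \<bullet> t = 1"
      using \<alpha>\<beta> by (simp add: t_def inner_diff_left inner_diff_right e\<nu> ee \<nu>\<nu> power2_eq_square)
    have "\<tau> u = \<alpha> *\<^sub>R t"
    proof -
      have "\<tau> u = (1 - \<beta>\<^sup>2) *\<^sub>R \<nu> - (\<beta> * \<alpha>) *\<^sub>R e"
        unfolding \<tau>eq by (subst Neq) (simp add: algebra_simps power2_eq_square)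
      also have "1 - \<beta>\<^sup>2 = \<alpha>\<^sup>2" using \<alpha>\<beta> by simp
      finally show ?thesis by (simp add: t_def algebra_simps power2_eq_square)
    qed
    then have DFq: "DF u q = t"
      using \<alpha>0 vDF by (simp add: q_def linear_cmul[OF linear_DF[OF u]])
    have t\<nu>: "t \<bullet> \<nu> = \<alpha>" "t \<bullet> e = - \<beta>" "t \<bullet> N = 0"
      by (simp_all add: t_def inner_diff_left e\<nu> ee \<nu>\<nu> Neq inner_add_right)
    have DFN: "DF u b \<bullet> N = 0" for b
      unfolding inner_commute[of _ N] using N(2) by (simp add: DF_eq[OF u] inner_sum_right)
    have split: "\<exists>k. DF u k = DF u b - (DF u b \<bullet> t) *\<^sub>R t \<and>
       (\<forall>c. II u N k c = k1 * (DF u c \<bullet> (DF u b - (DF u b \<bullet> t) *\<^sub>R t)))" for b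
    proof -
      let ?a = "DF u b - (DF u b \<bullet> t) *\<^sub>R t"
      have aN: "?a \<bullet> N = 0" "?a \<bullet> t = 0" using DFN t\<nu> tt by (simp_all add: inner_diff_left)
      have 1: "\<alpha> * (?a \<bullet> e) + \<beta> * (?a \<bullet> \<nu>) = 0" using aN(1) by (subst (asm) Neq) (simp add: inner_add_right)
      have 2: "\<alpha> * (?a \<bullet> \<nu>) - \<beta> * (?a \<bullet> e) = 0" using aN(2) by (subst (asm) (3) t_def) (simp add: inner_diff_right)
      have "(\<alpha>\<^sup>2 + \<beta>\<^sup>2) * (?a \<bullet> e) = \<alpha> * (\<alpha> * (?a \<bullet> e) + \<beta> * (?a \<bullet> \<nu>)) - \<beta> * (\<alpha> * (?a \<bullet> \<nu>) - \<beta> * (?a \<bullet> e))"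
        "(\<alpha>\<^sup>2 + \<beta>\<^sup>2) * (?a \<bullet> \<nu>) = \<beta> * (\<alpha> * (?a \<bullet> e) + \<beta> * (?a \<bullet> \<nu>)) + \<alpha> * (\<alpha> * (?a \<bullet> \<nu>) - \<beta> * (?a \<bullet> e))"
        by (simp_all only: algebra_simps power2_eq_square)
      then have "?a \<bullet> e = 0" "?a \<bullet> \<nu> = 0" unfolding 1 2 \<alpha>\<beta> by simp_all
      then show ?thesis using orbit[of ?a] unfolding k1_def by blast
    qed
    have II: "II u N b c = k1 * (DF u b \<bullet> DF u c) + (\<kappa> - k1) * ((DF u b \<bullet> t) * (DF u c \<bullet> t))" for b c
    proof -
      have full: "II u N b c = k1 * (DF u c \<bullet> (DF u b - (DF u b \<bullet> t) *\<^sub>R t)) + (DF u b \<bullet> t) * II u N q c" for b c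
      proof -
        obtain k where k: "DF u k = DF u b - (DF u b \<bullet> t) *\<^sub>R t"
            "\<And>c. II u N k c = k1 * (DF u c \<bullet> (DF u b - (DF u b \<bullet> t) *\<^sub>R t))"
          using split by blast
        have "DF u b = DF u (k + (DF u b \<bullet> t) *\<^sub>R q)"
          by (simp add: linear_add[OF linear_DF[OF u]] linear_cmul[OF linear_DF[OF u]] k DFq)
        then have "b = k + (DF u b \<bullet> t) *\<^sub>R q" using inj_deriv[OF u] by (simp add: inj_eq)
        then have "II u N b c = II u N (k + (DF u b \<bullet> t) *\<^sub>R q) c" by simp
        then show ?thesis by (simp add: II_add_left II_scale_left k)
      qed
      have "II u N q c = (DF u c \<bullet> t) * \<kappa>"
        using full[of c q] by (simp add: II_commute[OF u, of N q c] DFq \<kappa>_def inner_diff_right tt inner_commute)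
      then show ?thesis by (simp add: full[of b c] inner_diff_right inner_commute algebra_simps)
    qed
    (* the frame need not be adapted to t: the form is k1 times the metric plus a rank-one term *)
    obtain f :: "'n \<Rightarrow> real^'n" where f: "\<And>m k. DF u (f m) \<bullet> DF u (f k) = (if m = k then 1 else 0)"
      using orthonormal_frame[OF u] by metis
    define s where "s m = DF u (f m) \<bullet> t" for m
    define \<mu> where "\<mu> = \<kappa> - k1"
    define n where "n = real CARD('n)"
    have s1: "(\<Sum>m\<in>UNIV. (s m)\<^sup>2) = 1"
      using DF_frame_expansion[OF u f, of q q] by (simp add: DFq tt s_def power2_eq_square inner_commute)
    have hf: "II u N (f m) (f k) = k1 * (if m = k then 1 else 0) + \<mu> * (s m * s k)" for m k
      by (simp add: II f s_def \<mu>_def)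
    have "0 = (\<Sum>m\<in>UNIV. \<Sum>k\<in>UNIV. (k1 + \<mu> * (s m)\<^sup>2) * (k1 + \<mu> * (s k)\<^sup>2) - (k1 * (if m = k then 1 else 0) + \<mu> * (s m * s k))\<^sup>2)"
      using scalar_curvature_frame[OF u card_d N f] flat[OF u] by (simp add: hf power2_eq_square)
    also have "\<dots> = (\<Sum>m\<in>UNIV. \<Sum>k\<in>UNIV. k1\<^sup>2 + k1 * \<mu> * (s m)\<^sup>2 + k1 * \<mu> * (s k)\<^sup>2 - (if m = k then k1\<^sup>2 + 2 * k1 * \<mu> * (s m)\<^sup>2 else 0))"
      by (intro sum.cong refl) (simp add: power2_eq_square algebra_simps)
    also have "\<dots> = (\<Sum>m\<in>UNIV. n * k1\<^sup>2 + n * (k1 * \<mu> * (s m)\<^sup>2) + k1 * \<mu> - (k1\<^sup>2 + 2 * k1 * \<mu> * (s m)\<^sup>2))"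
      by (simp add: sum.distrib sum_subtractf sum_distrib_left[symmetric] s1 n_def) (simp add: algebra_simps)
    also have "\<dots> = n * (n * k1\<^sup>2) + n * (k1 * \<mu>) + n * (k1 * \<mu>) - (n * k1\<^sup>2 + 2 * k1 * \<mu>)"
      by (simp add: sum.distrib sum_subtractf sum_distrib_left[symmetric] s1 n_def)
    finally have "k1 * (n - 1) * (n * k1 + 2 * \<mu>) = 0" by (simp add: power2_eq_square algebra_simps)
    moreover have "k1 \<noteq> 0" using \<alpha>0 r by (simp add: k1_def)
    moreover have "n - 1 \<noteq> 0" using card_n by (simp add: n_def)
    ultimately have "n * k1 + 2 * \<mu> = 0" by simp
    then have \<kappa>: "2 * \<kappa> = - (n - 2) * k1" by (simp add: \<mu>_def algebra_simps)
    have vq: "(\<chi> i. v i u) = \<alpha> *\<^sub>R q" using \<alpha>0 by (simp add: q_def)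
    have "II u N q (axis m 1) = \<kappa> * (F1 m u \<bullet> t)"
      unfolding II by (simp add: DFq DF_axis tt inner_commute algebra_simps)
    then have "partial_deriv m w u = \<beta> * \<alpha> * (2 * \<kappa>) * (F1 m u \<bullet> t)"
      using partial_w[OF u N, of m] by (simp add: vq II_scale_left \<beta>_def[symmetric])
    also have "\<dots> = (n - 2) * \<alpha>\<^sup>2 * \<beta> / r * (F1 m u \<bullet> t)"
      unfolding \<kappa> using r by (simp add: k1_def power2_eq_square field_simps)
    also have "\<beta> * (F1 m u \<bullet> t) = - (F1 m u \<bullet> e)"
    proof -
      have "e = \<alpha> *\<^sub>R N - \<beta> *\<^sub>R t"
      proof -
        have "\<alpha> *\<^sub>R N - \<beta> *\<^sub>R t = (\<alpha>\<^sup>2 + \<beta>\<^sup>2) *\<^sub>R e"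
          by (subst Neq) (simp add: t_def algebra_simps power2_eq_square)
        then show ?thesis by (simp add: \<alpha>\<beta>)
      qed
      then have "F1 m u \<bullet> e = F1 m u \<bullet> (\<alpha> *\<^sub>R N - \<beta> *\<^sub>R t)" by (rule arg_cong)
      then have "F1 m u \<bullet> e = \<alpha> * (F1 m u \<bullet> N) - \<beta> * (F1 m u \<bullet> t)"
        by (simp add: inner_diff_right)
      then show ?thesis using N(2)[of m] by (simp add: inner_commute)
    qed
    then have "(n - 2) * \<alpha>\<^sup>2 / r * (\<beta> * (F1 m u \<bullet> t)) = (n - 2) * \<alpha>\<^sup>2 / r * - (F1 m u \<bullet> e)"
      by (rule arg_cong)
    then have "(n - 2) * \<alpha>\<^sup>2 * \<beta> / r * (F1 m u \<bullet> t) = - (n - 2) * \<alpha>\<^sup>2 / r * (F1 m u \<bullet> e)"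
      by (simp add: field_simps)
    finally have "r * r * partial_deriv m w u = - (n - 2) * w u * (r * (F1 m u \<bullet> e))"
      using r by (simp add: w\<alpha>)
    then show ?thesis
      using ee by (simp add: Xe inner_commute n_def power2_eq_square)
  qed
qed

text \<open>The square of \<open>w r\<^sup>n\<^sup>-\<^sup>2\<close>, where \<open>r\<close> is the distance from the axis. The square is differentiable
  also on the axis, where \<open>r\<close> itself need not be.\<close>

definition "mass u = (w u)\<^sup>2 * (X u \<bullet> X u) ^ (CARD('n) - 2)"

text \<open>By \<open>partial_w_radial\<close> the logarithmic derivatives of \<open>w\<close> and \<open>r\<^sup>n\<^sup>-\<^sup>2\<close> cancel off the axis; on the
  axis the derivative vanishes because \<open>n \<ge> 3\<close>.\<close>

lemma mass_constant:
  assumes conv: "convex V" obtains c where "\<And>u. u \<in> V \<Longrightarrow> mass u = c"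
proof -
  have "(mass has_derivative (\<lambda>h. 0)) (at u within V)" if u: "u \<in> V" for u
  proof -
    obtain k where k: "CARD('n) - 2 = Suc k" using card_n by (cases "CARD('n) - 2") auto
    have kn: "real CARD('n) - 2 = real (Suc k)" using k card_n by linarith
    have dX: "((\<lambda>x. X x \<bullet> X x) has_derivative (\<lambda>h. 2 * (X u \<bullet> DF u h))) (at u)"
    proof -
      have "(F has_derivative DF u) (at u)" using differentiable(1)[OF u] frechet_derivative_works by blast
      then have "(X has_derivative (\<lambda>h. DF u h - (DF u h \<bullet> \<nu>) *\<^sub>R \<nu>)) (at u)"
        unfolding X_def[abs_def] by (auto intro!: derivative_eq_intros)
      from has_derivative_inner[OF this this] show ?thesis
        by (simp add: inner_diff_right inner_diff_left X_orth inner_commute)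
    qed
    have dw: "(w has_derivative (\<lambda>h. \<Sum>i\<in>UNIV. h $ i * partial_deriv i w u)) (at u)"
      using has_derivative_sum_partial[OF differentiable_w[OF u]] by simp
    have "(mass has_derivative (\<lambda>h. (w u)\<^sup>2 * (real (Suc k) * (2 * (X u \<bullet> DF u h)) * (X u \<bullet> X u) ^ k)
        + (2 * (\<Sum>i\<in>UNIV. h $ i * partial_deriv i w u) * w u) * (X u \<bullet> X u) ^ Suc k)) (at u)"
      unfolding mass_def[abs_def] k
      using has_derivative_mult[OF has_derivative_power[OF dw, of 2] has_derivative_power[OF dX, of "Suc k"]]
      by (simp add: algebra_simps)
    moreover have "(w u)\<^sup>2 * (real (Suc k) * (2 * (X u \<bullet> DF u h)) * (X u \<bullet> X u) ^ k)
        + (2 * (\<Sum>i\<in>UNIV. h $ i * partial_deriv i w u) * w u) * (X u \<bullet> X u) ^ Suc k = 0" for h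
    proof (cases "X u = 0")
      case False
      have "(X u \<bullet> X u) * (\<Sum>i\<in>UNIV. h $ i * partial_deriv i w u) = (\<Sum>i\<in>UNIV. h $ i * ((X u \<bullet> X u) * partial_deriv i w u))"
        by (simp add: sum_distrib_left ac_simps)
      also have "\<dots> = - real (Suc k) * w u * (X u \<bullet> DF u h)"
        unfolding partial_w_radial[OF u False] kn DF_eq[OF u] inner_sum_right
        by (simp add: sum_distrib_left sum_negf ac_simps)
      finally have eq: "(X u \<bullet> X u) * (\<Sum>i\<in>UNIV. h $ i * partial_deriv i w u) = - real (Suc k) * w u * (X u \<bullet> DF u h)" .
      have eq': "(2 * (\<Sum>i\<in>UNIV. h $ i * partial_deriv i w u) * w u) * (X u \<bullet> X u) ^ Suc k
        = 2 * w u * (X u \<bullet> X u) ^ k * ((X u \<bullet> X u) * (\<Sum>i\<in>UNIV. h $ i * partial_deriv i w u))"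
        by simp
      show ?thesis unfolding eq' eq by (simp add: power2_eq_square algebra_simps)
    qed simp
    ultimately show ?thesis by (simp add: has_derivative_at_withinI)
  qed
  then show ?thesis using has_derivative_zero_constant[OF conv] that by metis
qed

text \<open>The axis is one-dimensional, the hypersurface is not.\<close>

lemma not_on_axis:
  assumes "open U" "U \<subseteq> V" "U \<noteq> {}" shows "\<exists>u\<in>U. X u \<noteq> 0"
proof (rule ccontr)
  assume "\<not> ?thesis"
  then have X0: "X u = 0" if "u \<in> U" for u using that by blast
  obtain u where u: "u \<in> U" using assms by blast
  have uV: "u \<in> V" using u assms by blast
  have dF: "(F has_derivative DF u) (at u)" using differentiable(1)[OF uV] frechet_derivative_works by blast
  then have "(X has_derivative (\<lambda>h. DF u h - (DF u h \<bullet> \<nu>) *\<^sub>R \<nu>)) (at u)"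
    unfolding X_def[abs_def] by (auto intro!: derivative_eq_intros)
  moreover have "(X has_derivative (\<lambda>h. 0)) (at u)"
    by (rule has_derivative_transform_within_open[OF has_derivative_const[of 0] assms(1) u]) (simp add: X0)
  ultimately have "(\<lambda>h. DF u h - (DF u h \<bullet> \<nu>) *\<^sub>R \<nu>) = (\<lambda>h. 0)"
    by (rule has_derivative_unique)
  then have "DF u h = (DF u h \<bullet> \<nu>) *\<^sub>R \<nu>" for h by (simp add: fun_eq_iff)
  then have "DF u h \<in> span {\<nu>}" for h by (metis span_base span_scale insertI1)
  then have "range (DF u) \<subseteq> span {\<nu>}" by blast
  then have "dim (range (DF u)) \<le> card {\<nu>}" by (intro dim_le_card) auto
  moreover have "dim (range (DF u)) = CARD('n)"
    using dim_image_eq[OF linear_DF[OF uV], of UNIV] inj_deriv[OF uV] by simp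
  ultimately show False using card_n by simp
qed

text \<open>If the mass vanishes, then \<open>w = 0\<close> off the axis, and the points off the axis are dense. If it does
  not, neither factor can vanish anywhere.\<close>

lemma horizontal_dichotomy:
  assumes conv: "convex V"
  shows "(\<forall>u\<in>V. w u = 0) \<or> (\<forall>u\<in>V. w u \<noteq> 0 \<and> X u \<noteq> 0)"
proof -
  obtain c where c: "\<And>u. u \<in> V \<Longrightarrow> mass u = c" using mass_constant[OF conv] by blast
  show ?thesis
  proof (cases "c = 0")
    case False
    have "w u \<noteq> 0 \<and> X u \<noteq> 0" if "u \<in> V" for u
      using c[OF that] False card_n by (auto simp: mass_def power_0_left)
    then show ?thesis by blast
  next
    case True
    have "w u = 0" if u: "u \<in> V" for u
    proof (rule ccontr)
      assume w0: "w u \<noteq> 0"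
      define U where "U = {x \<in> V. w x \<noteq> 0}"
      have "continuous_on V w"
        using differentiable_w by (intro differentiable_imp_continuous_on differentiable_at_imp_differentiable_on)
      then have "open (V \<inter> w -` (-{0}))" using open_V by (intro continuous_open_preimage) auto
      moreover have "V \<inter> w -` (-{0}) = U" by (auto simp: U_def)
      ultimately have "open U" by simp
      moreover have "U \<subseteq> V" "U \<noteq> {}" using w0 u by (auto simp: U_def)
      ultimately obtain x where "x \<in> U" "X x \<noteq> 0" using not_on_axis by blast
      then show False using c[of x] True by (auto simp: U_def mass_def)
    qed
    then show ?thesis by blast
  qed
qed

lemma height_has_derivative:
  assumes "u \<in> V" shows "((\<lambda>x. \<nu> \<bullet> F x) has_derivative (\<lambda>h. \<nu> \<bullet> DF u h)) (at u)"
  using differentiable(1)[OF assms] by (auto intro!: derivative_eq_intros simp: frechet_derivative_works)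

lemma z_0_if_w_0: "u \<in> V \<Longrightarrow> w u = 0 \<Longrightarrow> z i u = 0"
  using w_eq(1) \<tau>_inner by (metis inner_eq_zero_iff inner_zero_left)

lemma height_constant:
  assumes conv: "convex V" and w0: "\<And>u. u \<in> V \<Longrightarrow> w u = 0"
  obtains c where "\<And>u. u \<in> V \<Longrightarrow> \<nu> \<bullet> F u = c"
proof -
  have "((\<lambda>x. \<nu> \<bullet> F x) has_derivative (\<lambda>h. 0)) (at u within V)" if u: "u \<in> V" for u
  proof -
    have "\<nu> \<bullet> DF u h = 0" for h
      using z_0_if_w_0[OF u w0[OF u]] by (simp add: DF_eq[OF u] inner_sum_right z_def)
    then show ?thesis using height_has_derivative[OF u] by (simp add: has_derivative_at_withinI)
  qed
  then show ?thesis using has_derivative_zero_constant[OF conv] that by metis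
qed

lemma w_0_if_height_constant:
  assumes "open U" "U \<subseteq> V" "u \<in> U" "\<And>x. x \<in> U \<Longrightarrow> \<nu> \<bullet> F x = c"
  shows "w u = 0"
proof -
  have u: "u \<in> V" using assms by blast
  have "((\<lambda>x. \<nu> \<bullet> F x) has_derivative (\<lambda>h. 0)) (at u)"
    by (rule has_derivative_transform_within_open[OF has_derivative_const[of c] assms(1,3)]) (simp add: assms(4))
  then have "(\<lambda>h. \<nu> \<bullet> DF u h) = (\<lambda>h. 0)" by (rule has_derivative_unique[OF height_has_derivative[OF u]])
  then have "\<nu> \<bullet> DF u h = 0" for h by (simp add: fun_eq_iff)
  then have "z i u = 0" for i by (simp add: z_def flip: DF_axis)
  then show ?thesis by (simp add: w_def)
qed

end

section \<open>Charts and topology of a hypersurface\<close>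

lemma embedding_map_open_imageD:
  assumes "embedding_map (top_of_set V) M \<phi>" "openin M (\<phi> ` V)"
  shows "continuous_map (top_of_set V) M \<phi>" "inj_on \<phi> V"
    "openin (top_of_set V) U \<Longrightarrow> openin M (\<phi> ` U)"
proof -
  have h: "homeomorphic_map (top_of_set V) (subtopology M (\<phi> ` V)) \<phi>"
    using assms(1) by (simp add: embedding_map_def)
  then show "inj_on \<phi> V" using homeomorphic_imp_injective_map by fastforce
  show "continuous_map (top_of_set V) M \<phi>"
    using homeomorphic_imp_continuous_map[OF h] by (simp add: continuous_map_in_subtopology)
  assume "openin (top_of_set V) U"
  then have "openin (subtopology M (\<phi> ` V)) (\<phi> ` U)"
    using homeomorphic_imp_open_map[OF h] by (simp add: open_map_def)
  then show "openin M (\<phi> ` U)" using assms(2) openin_trans_full by blast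
qed

lemma C_k_on_subset: "C_k_on k F S \<Longrightarrow> T \<subseteq> S \<Longrightarrow> C_k_on k F T"
  by (induction k arbitrary: F) (auto intro: continuous_on_subset differentiable_on_subset)

lemma local_param_subset:
  assumes lp: "local_param k M f V \<phi>" and U: "open U" "U \<subseteq> V"
  shows "local_param k M f U \<phi>"
proof -
  note e = embedding_map_open_imageD[of V M \<phi>]
  have lp': "embedding_map (top_of_set V) M \<phi>" "openin M (\<phi> ` V)" using lp by (auto simp: local_param_def)
  have oU: "openin (top_of_set V) S" if "openin (top_of_set U) S" for S
    using that U by (metis openin_open_eq openin_trans open_subset order_refl openin_subset)
  have "continuous_map (top_of_set U) M \<phi>"
    using e(1)[OF lp'] U(2) by (metis continuous_map_from_subtopology subtopology_subtopology inf.absorb2)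
  moreover have "open_map (top_of_set U) M \<phi>"
    using e(3)[OF lp'] oU by (simp add: open_map_def)
  moreover have "inj_on \<phi> (topspace (top_of_set U))"
    using e(2)[OF lp'] U(2) by (auto intro: inj_on_subset)
  ultimately have "embedding_map (top_of_set U) M \<phi>"
    by (rule injective_open_imp_embedding_map)
  moreover have "openin M (\<phi> ` U)" using e(3)[OF lp'] oU[of U] by simp
  ultimately show ?thesis
    using lp U C_k_on_subset unfolding local_param_def by blast
qed

text \<open>Only finitely many components of the complement meet the boundary of a compact neighbourhood of
  \<open>K\<close>, and a component that does not meet it stays inside, by connectedness. So all but the one large
  component are contained in the union of that neighbourhood and of finitely many components with
  compact closure.\<close>

lemma one_ended_complement_compact:
  assumes one: "one_ended X" and conn: "connected_space X" and H: "Hausdorff_space X"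
    and lc: "locally_compact_space X" and lconn: "locally_connected_space X" and K: "compactin X K"
  obtains C where "openin X C" "connectedin X C" "C \<subseteq> topspace X - K" "C \<noteq> {}"
    "compactin X (topspace X - C)" "\<not> compactin X (X closure_of C)"
    "\<And>D. D \<in> connected_components_of (subtopology X (topspace X - K)) \<Longrightarrow>
       \<not> compactin X (X closure_of D) \<Longrightarrow> D = C"
proof -
  let ?Y = "subtopology X (topspace X - K)"
  have clK: "closedin X K" using K H compactin_imp_closedin by blast
  then have oY: "openin X (topspace X - K)" by blast
  then have lY: "locally_connected_space ?Y" using locally_connected_space_open_subset[OF lconn] by blast
  have op: "openin X D" if "D \<in> connected_components_of ?Y" for D
    using openin_connected_components_of_locally_connected_space[OF lY that] oY openin_trans_full by blast
  have sub: "D \<subseteq> topspace X - K" if "D \<in> connected_components_of ?Y" for D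
    using connected_components_of_subset[OF that] by auto
  have con: "connectedin X D" if "D \<in> connected_components_of ?Y" for D
    using connectedin_connected_components_of[OF that] by (simp add: connectedin_subtopology)
  obtain C where C: "C \<in> connected_components_of ?Y" "\<not> compactin X (X closure_of C)"
    and uniq: "\<And>D. D \<in> connected_components_of ?Y \<Longrightarrow> \<not> compactin X (X closure_of D) \<Longrightarrow> D = C"
    using one K unfolding one_ended_def by metis
  obtain U L where UL: "openin X U" "compactin X L" "K \<subseteq> U" "U \<subseteq> L"
    using locally_compact_space_compact_closed_compact[of X] H lc K by metis
  have clL: "closedin X L" using UL H compactin_imp_closedin by blast
  define Fr where "Fr = L - U"
  have Fr: "compactin X Fr"
    using UL clL by (intro closed_compactin[OF UL(2)]) (auto simp: Fr_def)
  have cover: "Fr \<subseteq> \<Union> (connected_components_of ?Y)"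
    using UL compactin_subset_topspace[OF UL(2)] by (auto simp: Union_connected_components_of Fr_def)
  obtain \<F> where \<F>: "finite \<F>" "\<F> \<subseteq> connected_components_of ?Y" "Fr \<subseteq> \<Union> \<F>"
    using compactinD[OF Fr _ cover] op by blast
  have comp: "compactin X (L \<union> \<Union> ((\<lambda>D. X closure_of D) ` (\<F> - {C})))"
    using UL \<F> uniq by (intro compactin_Un compactin_Union) (auto simp: finite_imageI)
  have "topspace X - C \<subseteq> L \<union> \<Union> ((\<lambda>D. X closure_of D) ` (\<F> - {C}))"
  proof
    fix x assume x: "x \<in> topspace X - C"
    show "x \<in> L \<union> \<Union> ((\<lambda>D. X closure_of D) ` (\<F> - {C}))"
    proof (cases "x \<in> L")
      case False
      then have "x \<in> topspace ?Y" using x UL by auto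
      then obtain D where D: "D \<in> connected_components_of ?Y" "x \<in> D"
        using Union_connected_components_of[of ?Y] by blast
      (* a component outside the neighbourhood that avoids its boundary would be clopen in X *)
      have "D \<inter> Fr \<noteq> {}"
      proof
        assume e: "D \<inter> Fr = {}"
        have "D \<inter> U = {}"
        proof (rule ccontr)
          assume ne: "D \<inter> U \<noteq> {}"
          have "openin X (topspace X - L)" using clL by blast
          moreover have "D \<subseteq> U \<union> (topspace X - L)" using e sub[OF D(1)] by (auto simp: Fr_def)
          moreover have "U \<inter> (topspace X - L) \<inter> D = {}" using UL by auto
          moreover have "(topspace X - L) \<inter> D \<noteq> {}" using D False x by auto
          ultimately show False using con[OF D(1)] UL(1) ne unfolding connectedin by (metis inf_commute)
        qed
        then have 1: "X closure_of D \<inter> U = {}"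
          using UL(1) by (simp add: openin_Int_closure_of_eq_empty inf_commute)
        have "closedin ?Y D" using closedin_connected_components_of[OF D(1)] .
        then obtain D' where D': "closedin X D'" "D = D' \<inter> (topspace X - K)"
          by (auto simp: closedin_subtopology)
        then have "X closure_of D \<subseteq> D'" by (intro closure_of_minimal) auto
        then have "X closure_of D \<inter> (topspace X - K) \<subseteq> D" using D'(2) by blast
        then have "X closure_of D \<subseteq> D" using 1 UL(3) closure_of_subset_topspace[of X D] by blast
        then have "closedin X D" using closure_of_subset[of D X] sub[OF D(1)] closure_of_eq by blast
        then have "D = topspace X"
          using conn op[OF D(1)] D(2) unfolding connected_space_clopen_in by blast
        moreover have "C \<subseteq> topspace X" using sub[OF C(1)] by blast
        moreover have "C \<noteq> {}" using nonempty_connected_components_of[OF C(1)] .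
        ultimately have "C = D" using connected_components_of_overlap[OF C(1) D(1)] by blast
        then show False using D x by blast
      qed
      then obtain y E where "y \<in> D" "y \<in> E" "E \<in> \<F>" using \<F> by blast
      then have "E = D" using \<F>(2) D connected_components_of_overlap[of E ?Y D] by blast
      moreover have "D \<noteq> C" using D x by blast
      moreover have "x \<in> X closure_of D"
        using D(2) sub[OF D(1)] closure_of_subset[of D X] by blast
      ultimately show ?thesis using \<open>E \<in> \<F>\<close> by blast
    qed auto
  qed
  moreover have "closedin X (topspace X - C)" using op[OF C(1)] by blast
  ultimately have "compactin X (topspace X - C)" using closed_compactin[OF comp] by blast
  then show ?thesis
    using that[of C] op con sub C uniq nonempty_connected_components_of[OF C(1)] by blast
qed

locale hypersurface_chart =
  fixes T :: "'n::finite itself" and M :: "'a topology" and f :: "'a \<Rightarrow> real^'d"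
  assumes hyp: "hypersurface T (CARD('n) + 1) M f" and card_n: "CARD('n) \<ge> 3"
begin

abbreviation "chart V (\<phi> :: real^'n \<Rightarrow> 'a) \<equiv> local_param (CARD('n) + 1) M f V \<phi>"

lemma card_d: "CARD('d) = CARD('n) + 1" and connected_M: "connected_space M" and Hausdorff_M: "Hausdorff_space M"
  using hyp by (auto simp: hypersurface_def)

lemma chart_immersion: assumes "chart V \<phi>" shows "immersion (f \<circ> \<phi>) V"
proof
  show "C_k_on 3 (f \<circ> \<phi>) V"
    using assms card_n C_k_on_mono[of "CARD('n) + 1" "f \<circ> \<phi>" V 3] by (simp add: local_param_def)
qed (use assms in \<open>auto simp: local_param_def\<close>)

lemma chartD:
  assumes "chart V \<phi>"
  shows "open V" "continuous_map (top_of_set V) M \<phi>" "inj_on \<phi> V" "openin M (\<phi> ` V)"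
    "\<And>U. open U \<Longrightarrow> U \<subseteq> V \<Longrightarrow> openin M (\<phi> ` U)" "continuous_on V (f \<circ> \<phi>)"
proof -
  have e: "embedding_map (top_of_set V) M \<phi>" "openin M (\<phi> ` V)" and o: "open V"
    using assms by (auto simp: local_param_def)
  note h = embedding_map_open_imageD[OF e]
  show "open V" "openin M (\<phi> ` V)" by fact+
  show "continuous_map (top_of_set V) M \<phi>" "inj_on \<phi> V" using h by auto
  show "openin M (\<phi> ` U)" if "open U" "U \<subseteq> V" for U
    using h(3)[of U] that open_subset by blast
  interpret immersion "f \<circ> \<phi>" V using chart_immersion[OF assms] .
  show "continuous_on V (f \<circ> \<phi>)"
    using differentiable(1) by (intro continuous_at_imp_continuous_on ballI differentiable_imp_continuous_within)
qed

lemma chart_preimage_open: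
  assumes "chart V \<phi>" "openin M U" shows "open (V \<inter> \<phi> -` U)"
proof -
  have "openin (top_of_set V) {v \<in> topspace (top_of_set V). \<phi> v \<in> U}"
    using openin_continuous_map_preimage[OF chartD(2)[OF assms(1)] assms(2)] .
  moreover have "{v \<in> topspace (top_of_set V). \<phi> v \<in> U} = V \<inter> \<phi> -` U" by auto
  ultimately show ?thesis using chartD(1)[OF assms(1)] openin_open_eq by auto
qed

text \<open>Balls are the convenient chart domains: they are convex, and small ones parametrize neighbourhoods
  inside any open set.\<close>

lemma chart_ball:
  assumes x: "x \<in> U" and U: "openin M U"
  obtains u r \<phi> where "r > 0" "chart (ball u r) \<phi>" "\<phi> u = x" "\<phi> ` ball u r \<subseteq> U"
proof -
  have "x \<in> topspace M" using x U openin_subset by blast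
  then obtain V \<phi> where V: "chart V \<phi>" "x \<in> \<phi> ` V"
    using hyp unfolding hypersurface_def by blast
  then obtain u where u: "u \<in> V" "\<phi> u = x" by blast
  have "open (V \<inter> \<phi> -` U)" using chart_preimage_open[OF V(1) U] .
  moreover have "u \<in> V \<inter> \<phi> -` U" using u x by simp
  ultimately obtain r where r: "r > 0" "ball u r \<subseteq> V \<inter> \<phi> -` U" using open_contains_ball by blast
  then have "chart (ball u r) \<phi>" using local_param_subset[OF V(1)] by auto
  then show ?thesis using that r u by blast
qed

lemma chart_ball_topspace:
  assumes x: "x \<in> topspace M"
  obtains u r \<phi> where "r > 0" "chart (ball u r) \<phi>" "\<phi> u = x"
  using chart_ball[OF x openin_topspace] by metis

lemma continuous_f: "continuous_map M euclidean f"
  unfolding continuous_map_def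
proof (intro conjI allI impI)
  fix S :: "(real^'d) set" assume "openin euclidean S"
  then have S: "open S" by simp
  show "openin M {x \<in> topspace M. f x \<in> S}"
  proof (subst openin_subopen, intro ballI)
    fix x assume x: "x \<in> {x \<in> topspace M. f x \<in> S}"
    then have "x \<in> topspace M" by simp
    then obtain u r \<phi> where c: "r > 0" "chart (ball u r) \<phi>" "\<phi> u = x" by (rule chart_ball_topspace)
    let ?W = "ball u r \<inter> (f \<circ> \<phi>) -` S"
    have "open ?W" using chartD(6)[OF c(2)] S by (intro continuous_open_preimage) auto
    then have "openin M (\<phi> ` ?W)" using chartD(5)[OF c(2), of ?W] by auto
    moreover have "x \<in> \<phi> ` ?W" using c x by auto
    moreover have "\<phi> ` ?W \<subseteq> {x \<in> topspace M. f x \<in> S}"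
      using openin_subset[OF \<open>openin M (\<phi> ` ?W)\<close>] by auto
    ultimately show "\<exists>T. openin M T \<and> x \<in> T \<and> T \<subseteq> {x \<in> topspace M. f x \<in> S}" by blast
  qed
qed simp

lemma locally_compact_M: "locally_compact_space M"
  unfolding locally_compact_space_def
proof
  fix x assume "x \<in> topspace M"
  then obtain u r \<phi> where c: "r > 0" "chart (ball u r) \<phi>" "\<phi> u = x" by (rule chart_ball_topspace)
  have sub: "ball u (r/2) \<subseteq> ball u r" "cball u (r/2) \<subseteq> ball u r" using c(1) by auto
  have "compactin (top_of_set (ball u r)) (cball u (r/2))" using sub by (simp add: compactin_subtopology)
  then have "compactin M (\<phi> ` cball u (r/2))" using image_compactin chartD(2)[OF c(2)] by blast
  moreover have "openin M (\<phi> ` ball u (r/2))" using chartD(5)[OF c(2), of "ball u (r/2)"] sub by auto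
  moreover have "x \<in> \<phi> ` ball u (r/2)" using c by auto
  ultimately show "\<exists>U K. openin M U \<and> compactin M K \<and> x \<in> U \<and> U \<subseteq> K"
    by (meson ball_subset_cball image_mono)
qed

lemma connected_chart: "chart V \<phi> \<Longrightarrow> connected V \<Longrightarrow> connectedin M (\<phi> ` V)"
  by (intro connectedin_continuous_map_image[OF chartD(2)]) (auto simp: connectedin_subtopology)

lemma locally_connected_M: "locally_connected_space M"
  unfolding locally_connected_space
proof (intro allI impI)
  fix U x assume U: "openin M U \<and> x \<in> U"
  obtain u r \<phi> where c: "r > 0" "chart (ball u r) \<phi>" "\<phi> u = x" "\<phi> ` ball u r \<subseteq> U"
    by (rule chart_ball[of x U]) (use U in auto)
  then show "\<exists>V. openin M V \<and> connectedin M V \<and> x \<in> V \<and> V \<subseteq> U"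
    using chartD(4)[OF c(2)] connected_chart[OF c(2)] by (intro exI[of _ "\<phi> ` ball u r"]) auto
qed

text \<open>Invariance of domain, in charts.\<close>

lemma open_image_if_injective:
  fixes q :: "'a \<Rightarrow> real^'n"
  assumes q: "continuous_map M euclidean q" "inj_on q U" and U: "openin M U"
  shows "open (q ` U)"
proof (subst open_subopen, intro ballI)
  fix w assume "w \<in> q ` U"
  then obtain x where x: "x \<in> U" "w = q x" by blast
  obtain u r \<phi> where c: "r > 0" "chart (ball u r) \<phi>" "\<phi> u = x" "\<phi> ` ball u r \<subseteq> U"
    by (rule chart_ball[OF x(1) U])
  have "continuous_map (top_of_set (ball u r)) euclidean (q \<circ> \<phi>)"
    by (rule continuous_map_compose[OF chartD(2)[OF c(2)] q(1)])
  then have "continuous_on (ball u r) (q \<circ> \<phi>)" by simp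
  moreover have "inj_on (q \<circ> \<phi>) (ball u r)"
    using chartD(3)[OF c(2)] inj_on_subset[OF q(2) c(4)] by (rule comp_inj_on)
  ultimately have "open ((q \<circ> \<phi>) ` ball u r)" by (intro invariance_of_domain) auto
  moreover have "w \<in> (q \<circ> \<phi>) ` ball u r" using x c by (auto intro!: image_eqI[of _ _ u])
  ultimately show "\<exists>T. open T \<and> w \<in> T \<and> T \<subseteq> q ` U"
    using c(4) by (intro exI[of _ "(q \<circ> \<phi>) ` ball u r"]) (auto simp: image_comp[symmetric])
qed

lemma continuous_inv_into:
  fixes q :: "'a \<Rightarrow> real^'n"
  assumes q: "continuous_map M euclidean q" "inj_on q U" and U: "openin M U"
    and S: "open S" "S \<subseteq> q ` U"
  shows "continuous_map (top_of_set S) M (inv_into U q)"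
  unfolding continuous_map_def
proof (intro conjI allI impI)
  have inv: "inv_into U q w \<in> U" "q (inv_into U q w) = w" if "w \<in> S" for w
    using that S(2) by (auto simp: inv_into_into f_inv_into_f)
  show "inv_into U q \<in> topspace (top_of_set S) \<rightarrow> topspace M"
    using inv(1) openin_subset[OF U] by auto
  fix W assume W: "openin M W"
  have "{w \<in> topspace (top_of_set S). inv_into U q w \<in> W} = S \<inter> q ` (W \<inter> U)"
  proof
    show "{w \<in> topspace (top_of_set S). inv_into U q w \<in> W} \<subseteq> S \<inter> q ` (W \<inter> U)"
    proof
      fix w assume w: "w \<in> {w \<in> topspace (top_of_set S). inv_into U q w \<in> W}"
      then have "inv_into U q w \<in> W \<inter> U" "q (inv_into U q w) = w" using inv by auto
      then have "w \<in> q ` (W \<inter> U)" by (metis imageI)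
      then show "w \<in> S \<inter> q ` (W \<inter> U)" using w by simp
    qed
    show "S \<inter> q ` (W \<inter> U) \<subseteq> {w \<in> topspace (top_of_set S). inv_into U q w \<in> W}" using q(2) by auto
  qed
  moreover have "open (q ` (W \<inter> U))"
    using q(1) inj_on_subset[OF q(2)] W U by (intro open_image_if_injective openin_Int) auto
  ultimately show "openin (top_of_set S) {w \<in> topspace (top_of_set S). inv_into U q w \<in> W}"
    by (simp add: openin_open_Int)
qed

lemmas end_complement_compact =
  one_ended_complement_compact[OF _ connected_M Hausdorff_M locally_compact_M locally_connected_M]

lemma f_locally_injective:
  assumes "x \<in> U" "openin M U"
  obtains W where "openin M W" "x \<in> W" "W \<subseteq> U" "inj_on f W"
proof -
  obtain u r \<phi> where c: "r > 0" "chart (ball u r) \<phi>" "\<phi> u = x" "\<phi> ` ball u r \<subseteq> U"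
    by (rule chart_ball[OF assms])
  interpret immersion "f \<circ> \<phi>" "ball u r" using chart_immersion[OF c(2)] .
  obtain \<delta> where \<delta>: "\<delta> > 0" "ball u \<delta> \<subseteq> ball u r" "inj_on (f \<circ> \<phi>) (ball u \<delta>)"
    using locally_injective[of u] c(1) by (metis centre_in_ball)
  have "inj_on f (\<phi> ` ball u \<delta>)" using \<delta>(3) by (auto simp: inj_on_def)
  moreover have "openin M (\<phi> ` ball u \<delta>)" using chartD(5)[OF c(2) _ \<delta>(2)] by auto
  moreover have "x \<in> \<phi> ` ball u \<delta>" using c \<delta> by auto
  ultimately show ?thesis using that c(4) \<delta>(2) by (meson image_mono order_trans)
qed

end

locale scalar_flat_hypersurface = hypersurface_chart T M f
  for T :: "'n::finite itself" and M :: "'a topology" and f :: "'a \<Rightarrow> real^'d" +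
  assumes flat: "scalar_flat T (CARD('n) + 1) M f"
begin

text \<open>Adding a small multiple of \<open>\<bar>f\<bar>\<^sup>2\<close> to a linear function keeps the maximum over a compact set among
  the points above \<open>c\<close>, where the set is open, and makes the curvature positive there.\<close>

lemma linear_maximum_principle:
  assumes Q: "compactin M Q" and a: "a \<in> Q" "l \<bullet> f a > c"
    and bd: "\<And>y. y \<in> Q \<Longrightarrow> l \<bullet> f y > c \<Longrightarrow> \<exists>U. openin M U \<and> y \<in> U \<and> U \<subseteq> Q"
  shows False
proof -
  have "compact (f ` Q)" using image_compactin[OF Q continuous_f] by simp
  then obtain b where b: "\<And>y. y \<in> Q \<Longrightarrow> norm (f y) \<le> b"
    using compact_imp_bounded bounded_iff by (metis imageI)
  (* the quadratic term then changes the function by at most half of the excess over c *)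
  define \<epsilon> where "\<epsilon> = (l \<bullet> f a - c) / (2 * (b\<^sup>2 + 1))"
  have b1: "b\<^sup>2 + 1 > 0" by (simp add: add_nonneg_pos)
  have \<epsilon>: "\<epsilon> > 0" using a b1 by (simp add: \<epsilon>_def)
  define \<psi> where "\<psi> X = l \<bullet> X + \<epsilon> * (X \<bullet> X)" for X
  have "continuous_on (f ` Q) \<psi>" unfolding \<psi>_def by (intro continuous_intros)
  then obtain y where y: "y \<in> Q" "\<And>x. x \<in> Q \<Longrightarrow> \<psi> (f x) \<le> \<psi> (f y)"
    using continuous_attains_sup[OF \<open>compact (f ` Q)\<close>, of \<psi>] a by auto
  have "l \<bullet> f y > c"
  proof (rule ccontr)
    assume "\<not> l \<bullet> f y > c"
    moreover have "f y \<bullet> f y \<le> b\<^sup>2 + 1"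
      using power_mono[OF b[OF y(1)] norm_ge_zero, of 2] by (simp add: power2_norm_eq_inner)
    then have "\<epsilon> * (f y \<bullet> f y) \<le> \<epsilon> * (b\<^sup>2 + 1)" using \<epsilon> by (intro mult_left_mono) auto
    moreover have "\<epsilon> * (b\<^sup>2 + 1) = (l \<bullet> f a - c) / 2" using b1 by (simp add: \<epsilon>_def divide_simps)
    ultimately have "\<psi> (f y) \<le> c + (l \<bullet> f a - c) / 2" unfolding \<psi>_def by linarith
    moreover have "\<psi> (f a) \<ge> l \<bullet> f a" using \<epsilon> by (simp add: \<psi>_def)
    ultimately show False using y(2)[OF a(1)] a(2) by argo
  qed
  then obtain U where U: "openin M U" "y \<in> U" "U \<subseteq> Q" using bd y by blast
  obtain u r \<phi> where c: "r > 0" "chart (ball u r) \<phi>" "\<phi> u = y" "\<phi> ` ball u r \<subseteq> U"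
    by (rule chart_ball[OF U(2,1)])
  interpret I: immersion "f \<circ> \<phi>" "ball u r" using chart_immersion[OF c(2)] .
  have "scalar_curvature (induced_metric (f \<circ> \<phi>)) u > 0"
  proof (rule I.scalar_curvature_pos_at_max[OF _ card_d _ \<epsilon> c(1) order_refl])
    show "u \<in> ball u r" using c by simp
    show "CARD('n) \<ge> 2" using card_n by simp
    fix v assume "v \<in> ball u r"
    then have "\<phi> v \<in> Q" using c U by blast
    then show "l \<bullet> (f \<circ> \<phi>) v + \<epsilon> * ((f \<circ> \<phi>) v \<bullet> (f \<circ> \<phi>) v) \<le> l \<bullet> (f \<circ> \<phi>) u + \<epsilon> * ((f \<circ> \<phi>) u \<bullet> (f \<circ> \<phi>) u)"
      using y(2) c(3) by (simp add: \<psi>_def)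
  qed
  moreover have "scalar_curvature (induced_metric (f \<circ> \<phi>)) u = 0"
    using flat c unfolding scalar_flat_def by (metis centre_in_ball)
  ultimately show False by simp
qed

text \<open>The points strictly above the level are interior to the superlevel set.\<close>

lemma superlevel_not_compact:
  assumes Q: "compactin M {x \<in> topspace M. l \<bullet> f x \<ge> c}" and a: "a \<in> topspace M" "l \<bullet> f a > c"
  shows False
proof (rule linear_maximum_principle[OF Q])
  show "a \<in> {x \<in> topspace M. l \<bullet> f x \<ge> c}" "l \<bullet> f a > c" using a by auto
  fix y assume y: "y \<in> {x \<in> topspace M. l \<bullet> f x \<ge> c}" "l \<bullet> f y > c"
  have "openin M {x \<in> topspace M. f x \<in> {X. l \<bullet> X > c}}"
    by (intro openin_continuous_map_preimage[OF continuous_f]) (simp add: open_halfspace_gt)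
  then show "\<exists>U. openin M U \<and> y \<in> U \<and> U \<subseteq> {x \<in> topspace M. l \<bullet> f x \<ge> c}"
    using y by (intro exI[of _ "{x \<in> topspace M. f x \<in> {X. l \<bullet> X > c}}"]) auto
qed

end

section \<open>Rotations about an axis\<close>

text \<open>For unit vectors \<open>a\<close> and \<open>b\<close> this is the rotation in their plane that takes \<open>a\<close> to \<open>b\<close>, the
  product of the reflections in \<open>a\<close> and in \<open>a + b\<close>. The closed formula is jointly continuous in \<open>a\<close>
  and \<open>b\<close> away from antipodal pairs, where the denominator vanishes.\<close>

definition rotate_to :: "real^'d \<Rightarrow> real^'d \<Rightarrow> real^'d^'d" where
  "rotate_to a b = (\<chi> i j. (if i = j then 1 else 0) - (a $ i + b $ i) * (a $ j + b $ j) / (1 + a \<bullet> b) + 2 * (b $ i * a $ j))"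

definition reflection :: "real^'d \<Rightarrow> real^'d^'d" where
  "reflection s = (\<chi> i j. (if i = j then 1 else 0) - 2 * (s $ i * s $ j))"

lemma sum_identity_plus_rank_two:
  fixes s t y :: "real^'d"
  shows "(\<Sum>j\<in>UNIV. ((if i = j then 1 else 0) + c * s $ j + d * t $ j) * y $ j) = y $ i + c * (s \<bullet> y) + d * (t \<bullet> y)"
proof -
  have "((if i = j then 1 else 0) + c * s $ j + d * t $ j) * y $ j
      = (if i = j then y $ i else 0) + c * (s $ j * y $ j) + d * (t $ j * y $ j)" for j
    by (simp add: algebra_simps)
  then show ?thesis by (simp add: sum.distrib inner_vec_def sum_distrib_left)
qed

lemma reflection_mult: "reflection s *v y = y - (2 * (s \<bullet> y)) *\<^sub>R s"
  using sum_identity_plus_rank_two[of _ "- 2 * s $ _" s 0 0 y]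
  by (simp add: vec_eq_iff reflection_def matrix_vector_mult_def algebra_simps)

lemma rotate_to_mult:
  "rotate_to a b *v y = y - (((a + b) \<bullet> y) / (1 + a \<bullet> b)) *\<^sub>R (a + b) + (2 * (a \<bullet> y)) *\<^sub>R b"
proof -
  have "rotate_to a b $ i $ j = (if i = j then 1 else 0) + (- ((a + b) $ i / (1 + a \<bullet> b))) * (a + b) $ j + (2 * b $ i) * a $ j" for i j
    by (simp add: rotate_to_def)
  then have "(rotate_to a b *v y) $ i = y $ i + (- ((a + b) $ i / (1 + a \<bullet> b))) * ((a + b) \<bullet> y) + (2 * b $ i) * (a \<bullet> y)" for i
    using sum_identity_plus_rank_two[of i "- ((a + b) $ i / (1 + a \<bullet> b))" "a + b" "2 * b $ i" a y]
    by (simp add: matrix_vector_mult_def)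
  then show ?thesis by (simp add: vec_eq_iff mult.commute)
qed

lemma orthogonal_reflection: "norm s = 1 \<Longrightarrow> orthogonal_matrix (reflection s)"
proof -
  assume s: "norm s = 1"
  then have ss: "s \<bullet> s = 1" by (simp add: dot_square_norm)
  have "reflection s *v (reflection s *v y) = y" for y
  proof -
    have "s \<bullet> (y - (2 * (s \<bullet> y)) *\<^sub>R s) = - (s \<bullet> y)" by (simp add: inner_diff_right ss)
    then show ?thesis unfolding reflection_mult by simp
  qed
  then have "reflection s ** reflection s = mat 1"
    by (simp add: matrix_eq matrix_vector_mul_assoc[symmetric])
  moreover have "transpose (reflection s) = reflection s"
    by (simp add: vec_eq_iff transpose_def reflection_def mult.commute)
  ultimately show ?thesis by (simp add: orthogonal_matrix_def)
qed

text \<open>Conjugating by a rotation moves \<open>s\<close> to a coordinate vector, where the reflection is diagonal.\<close>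

lemma det_reflection:
  assumes s: "norm (s :: real^'d) = 1" and d: "CARD('d) \<ge> 2"
  shows "det (reflection s) = -1"
proof -
  obtain k :: 'd where True by simp
  obtain R :: "real^'d^'d" where R: "rotation_matrix R" "R *v (axis k 1) = s"
    using rotation_matrix_exists_basis[OF d s] by metis
  then have orth: "orthogonal_matrix R" by (simp add: rotation_matrix_def)
  define D :: "real^'d^'d" where "D = (\<chi> i j. if i = j then (if i = k then -1 else 1) else 0)"
  have D: "D *v y = y - (2 * (axis k 1 \<bullet> y)) *\<^sub>R axis k 1" for y
  proof -
    have "axis k 1 \<bullet> y = y $ k" by (simp add: inner_axis')
    then show ?thesis
      by (simp add: vec_eq_iff D_def matrix_vector_mult_def axis_def if_distrib[of "\<lambda>x. x * _"] cong: if_cong)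
  qed
  have "R ** transpose R = mat 1" using orth by (simp add: orthogonal_matrix_def)
  then have RR: "R *v (transpose R *v y) = y" for y
    using matrix_vector_mul_assoc[of R "transpose R" y] by (simp only: matrix_vector_mul_lid)
  have sR: "axis k 1 \<bullet> (transpose R *v y) = s \<bullet> y" for y
    by (metis R(2) dot_lmul_matrix inner_commute transpose_matrix_vector transpose_transpose)
  have "R ** D ** transpose R = reflection s"
    unfolding matrix_eq matrix_vector_mul_assoc[symmetric] D reflection_mult
    by (simp add: matrix_vector_mult_diff_distrib RR sR R(2) matrix_vector_mult_scaleR del: transpose_matrix_vector)
  then have "det (reflection s) = det R * det D * det (transpose R)"
    by (metis det_mul)
  also have "\<dots> = det D" using R(1) by (simp add: rotation_matrix_def det_transpose)
  also have "det D = (\<Prod>i\<in>UNIV. D $ i $ i)"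
    by (rule det_diagonal) (simp add: D_def)
  also have "\<dots> = (\<Prod>i\<in>UNIV. if i = k then -1 else 1)" by (simp add: D_def)
  also have "\<dots> = -1" by simp
  finally show ?thesis .
qed

lemma rotate_to_in_rotations:
  assumes a: "norm a = 1" "a \<bullet> \<nu> = 0" and b: "norm b = 1" "b \<bullet> \<nu> = 0" and ab: "a \<bullet> b \<noteq> -1"
    and d: "CARD('d) \<ge> 2"
  shows "rotate_to a b \<in> rotations_fixing (\<nu> :: real^'d)"
proof -
  have aa: "a \<bullet> a = 1" "b \<bullet> b = 1" using a b by (simp_all add: dot_square_norm)
  define q where "q = norm (a + b)"
  have q2: "q * q = 2 * (1 + a \<bullet> b)"
    by (simp add: q_def power2_eq_square[symmetric] power2_norm_eq_inner inner_add_left inner_add_right aa inner_commute)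
  have c0: "1 + a \<bullet> b \<noteq> 0" using ab by (simp add: add_eq_0_iff)
  then have q0: "q \<noteq> 0" using q2 by auto
  define s where "s = (a + b) /\<^sub>R q"
  have s: "norm s = 1" using q0 by (simp add: s_def q_def)
  have "reflection s *v (reflection a *v y) = rotate_to a b *v y" for y
  proof -
    have ss: "(2 * (s \<bullet> x)) *\<^sub>R s = (((a + b) \<bullet> x) / (1 + a \<bullet> b)) *\<^sub>R (a + b)" for x
    proof -
      have "(2 * (s \<bullet> x)) *\<^sub>R s = (2 * ((a + b) \<bullet> x) / (q * q)) *\<^sub>R (a + b)"
        by (simp add: s_def divide_inverse)
      moreover have "2 * v / (2 * w) = v / w" for v w :: real by simp
      ultimately show ?thesis unfolding q2 by (simp only:)
    qed
    have eq: "(a + b) \<bullet> (y - (2 * (a \<bullet> y)) *\<^sub>R a) / (1 + a \<bullet> b) = ((a + b) \<bullet> y) / (1 + a \<bullet> b) - 2 * (a \<bullet> y)"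
    proof -
      have "(a + b) \<bullet> (y - (2 * (a \<bullet> y)) *\<^sub>R a) = (a + b) \<bullet> y - 2 * (a \<bullet> y) * (1 + a \<bullet> b)"
        by (simp add: inner_diff_right inner_add_left aa inner_commute algebra_simps)
      then show ?thesis using c0 by (simp add: diff_divide_distrib)
    qed
    define v where "v = ((a + b) \<bullet> y) / (1 + a \<bullet> b)"
    show ?thesis unfolding reflection_mult rotate_to_mult ss eq unfolding v_def[symmetric]
      by (simp add: algebra_simps)
  qed
  then have eq: "rotate_to a b = reflection s ** reflection a"
    by (simp add: matrix_eq matrix_vector_mul_assoc[symmetric])
  have "orthogonal_matrix (rotate_to a b)"
    unfolding eq by (intro orthogonal_matrix_mul orthogonal_reflection s a(1))
  moreover have "det (rotate_to a b) = 1"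
    unfolding eq using s a d by (simp add: det_mul det_reflection)
  moreover have "rotate_to a b *v \<nu> = \<nu>" using a b by (simp add: rotate_to_mult inner_add_left)
  ultimately show ?thesis by (simp add: rotations_fixing_def rotation_matrix_def)
qed

lemma rotate_to_maps:
  assumes "norm a = 1" "norm b = 1" "a \<bullet> b \<noteq> -1" shows "rotate_to a b *v a = b"
proof -
  have "a \<bullet> a = 1" "1 + a \<bullet> b \<noteq> 0" using assms by (simp_all add: dot_square_norm add_eq_0_iff)
  then show ?thesis by (simp add: rotate_to_mult inner_add_left inner_add_right inner_commute scaleR_2)
qed

lemma rotate_to_same: "norm a = 1 \<Longrightarrow> rotate_to a a = mat 1"
proof -
  assume "norm a = 1"
  then have "a \<bullet> a = 1" by (simp add: dot_square_norm)
  then show ?thesis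
    by (simp add: matrix_eq rotate_to_mult inner_add_left scaleR_2[symmetric])
qed

lemma tendsto_rotate_to:
  assumes "(a \<longlongrightarrow> a0) F" "(b \<longlongrightarrow> b0) F" "a0 \<bullet> b0 \<noteq> -1"
  shows "((\<lambda>x. rotate_to (a x) (b x)) \<longlongrightarrow> rotate_to a0 b0) F"
proof -
  have "1 + a0 \<bullet> b0 \<noteq> 0" using assms(3) by (simp add: add_eq_0_iff)
  then show ?thesis
    unfolding rotate_to_def using assms(1,2)
    by (intro tendsto_vec_lambda tendsto_intros)
qed

text \<open>The rotation by the angle \<open>t\<close> in the plane of \<open>a\<close> and \<open>b\<close>; the coefficient of \<open>sin t\<close> is the
  infinitesimal rotation.\<close>

lemma rotate_to_cos_sin:
  assumes "norm a = 1" "norm b = 1" "a \<bullet> b = 0" "cos t \<noteq> -1"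
  shows "rotate_to a (cos t *\<^sub>R a + sin t *\<^sub>R b) *v y
     = y + (cos t - 1) *\<^sub>R ((a \<bullet> y) *\<^sub>R a + (b \<bullet> y) *\<^sub>R b) + sin t *\<^sub>R ((a \<bullet> y) *\<^sub>R b - (b \<bullet> y) *\<^sub>R a)"
proof -
  have aa: "a \<bullet> a = 1" using assms by (simp add: dot_square_norm)
  have c0: "1 + cos t \<noteq> 0" using assms(4) by (simp add: add_eq_0_iff)
  define A where "A = a \<bullet> y"
  define B where "B = b \<bullet> y"
  have s2: "sin t * sin t = (1 + cos t) * (1 - cos t)"
    using sin_cos_squared_add[of t] by (simp add: power2_eq_square algebra_simps)
  have "((a + (cos t *\<^sub>R a + sin t *\<^sub>R b)) \<bullet> y) / (1 + cos t) = A + sin t * B / (1 + cos t)"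
  proof -
    have "(a + (cos t *\<^sub>R a + sin t *\<^sub>R b)) \<bullet> y = A * (1 + cos t) + sin t * B"
      by (simp add: inner_add_left A_def B_def algebra_simps)
    then show ?thesis using c0 by (simp add: add_divide_distrib)
  qed
  then have "rotate_to a (cos t *\<^sub>R a + sin t *\<^sub>R b) *v y
    = y - (A + sin t * B / (1 + cos t)) *\<^sub>R ((1 + cos t) *\<^sub>R a + sin t *\<^sub>R b) + (2 * A) *\<^sub>R (cos t *\<^sub>R a + sin t *\<^sub>R b)"
    by (simp add: rotate_to_mult inner_add_right aa assms(3) A_def algebra_simps)
  also have "(A + sin t * B / (1 + cos t)) *\<^sub>R ((1 + cos t) *\<^sub>R a + sin t *\<^sub>R b)
     = (A * (1 + cos t) + sin t * B) *\<^sub>R a + (A * sin t + B * (1 - cos t)) *\<^sub>R b"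
  proof -
    have "(A + sin t * B / (1 + cos t)) * (1 + cos t) = A * (1 + cos t) + sin t * B"
      using c0 by (simp add: field_simps)
    moreover have "(A + sin t * B / (1 + cos t)) * sin t = A * sin t + B * (sin t * sin t) / (1 + cos t)"
      by (simp add: algebra_simps)
    moreover have "B * (sin t * sin t) / (1 + cos t) = B * (1 - cos t)"
      unfolding s2 using c0 by simp
    ultimately show ?thesis by (simp only: scaleR_add_right scaleR_scaleR)
  qed
  finally show ?thesis by (simp add: A_def B_def vec_eq_iff algebra_simps)
qed

lemma compact_rotations_fixing: "compact (rotations_fixing (\<nu> :: real^'d))"
proof -
  have "\<bar>A $ i $ j\<bar> \<le> 1" if "A \<in> rotations_fixing \<nu>" for A :: "real^'d^'d" and i j
  proof -
    have "transpose A ** A = mat 1" using that by (simp add: rotations_fixing_def rotation_matrix_def orthogonal_matrix_def)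
    then have "(transpose A ** A) $ j $ j = mat 1 $ j $ j" by simp
    then have "(\<Sum>i\<in>UNIV. (A $ i $ j)\<^sup>2) = 1"
      by (simp add: matrix_matrix_mult_def transpose_def mat_def power2_eq_square)
    then have "(A $ i $ j)\<^sup>2 \<le> 1"
      using member_le_sum[of i UNIV "\<lambda>i. (A $ i $ j)\<^sup>2"] by simp
    then show ?thesis by (simp add: abs_square_le_1)
  qed
  then have "norm A \<le> (\<Sum>i\<in>(UNIV::'d set). \<Sum>j\<in>(UNIV::'d set). 1)" if "A \<in> rotations_fixing \<nu>" for A :: "real^'d^'d"
  proof -
    have "norm A \<le> (\<Sum>i\<in>UNIV. norm (A $ i))" by (simp add: norm_vec_def L2_set_le_sum)
    also have "\<dots> \<le> (\<Sum>i\<in>(UNIV::'d set). \<Sum>j\<in>(UNIV::'d set). \<bar>A $ i $ j\<bar>)"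
      by (intro sum_mono norm_le_l1_cart)
    also have "\<dots> \<le> (\<Sum>i\<in>(UNIV::'d set). \<Sum>j\<in>(UNIV::'d set). 1)"
      using that \<open>\<And>A i j. A \<in> rotations_fixing \<nu> \<Longrightarrow> \<bar>A $ i $ j\<bar> \<le> 1\<close> by (intro sum_mono)
    finally show ?thesis .
  qed
  then have "bounded (rotations_fixing \<nu>)" unfolding bounded_iff by blast
  moreover have "closed (rotations_fixing \<nu>)"
  proof -
    have "rotations_fixing \<nu> = {A. transpose A ** A = mat 1} \<inter> {A. A ** transpose A = mat 1} \<inter> {A. det A = 1} \<inter> {A. A *v \<nu> = \<nu>}"
      by (auto simp: rotations_fixing_def rotation_matrix_def orthogonal_matrix_def)
    moreover have "continuous_on UNIV (\<lambda>A :: real^'d^'d. det A)"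
      unfolding det_def by (intro continuous_intros)
    moreover have "continuous_on UNIV (\<lambda>A :: real^'d^'d. transpose A ** A)" "continuous_on UNIV (\<lambda>A :: real^'d^'d. A ** transpose A)"
      "continuous_on UNIV (\<lambda>A :: real^'d^'d. A *v \<nu>)"
      unfolding matrix_matrix_mult_def transpose_def matrix_vector_mult_def
      by (intro continuous_on_vec_lambda continuous_intros)+
    ultimately show ?thesis
      by (auto intro!: closed_Int closed_Collect_eq continuous_on_const)
  qed
  ultimately show ?thesis by (simp add: compact_eq_bounded_closed)
qed

lemma rotations_fixing_group:
  "mat 1 \<in> rotations_fixing \<nu>"
  "A \<in> rotations_fixing \<nu> \<Longrightarrow> B \<in> rotations_fixing \<nu> \<Longrightarrow> A ** B \<in> rotations_fixing \<nu>"
  "A \<in> rotations_fixing \<nu> \<Longrightarrow> transpose A \<in> rotations_fixing \<nu>"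
  "A \<in> rotations_fixing \<nu> \<Longrightarrow> transpose A ** A = mat 1"
  "A \<in> rotations_fixing \<nu> \<Longrightarrow> A ** transpose A = mat 1"
proof -
  show "mat 1 \<in> rotations_fixing \<nu>"
    by (simp add: rotations_fixing_def rotation_matrix_def orthogonal_matrix_id)
  show "A ** B \<in> rotations_fixing \<nu>" if "A \<in> rotations_fixing \<nu>" "B \<in> rotations_fixing \<nu>"
    using that by (auto simp: rotations_fixing_def rotation_matrix_def orthogonal_matrix_mul det_mul matrix_vector_mul_assoc[symmetric])
  assume A: "A \<in> rotations_fixing \<nu>"
  then show 1: "transpose A ** A = mat 1" and "A ** transpose A = mat 1"
    by (auto simp: rotations_fixing_def rotation_matrix_def orthogonal_matrix_def)
  have "transpose A *v \<nu> = transpose A *v (A *v \<nu>)" using A by (simp add: rotations_fixing_def)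
  also have "\<dots> = \<nu>" by (simp add: matrix_vector_mul_assoc 1)
  finally show "transpose A \<in> rotations_fixing \<nu>"
    using A by (auto simp: rotations_fixing_def rotation_matrix_def orthogonal_matrix_def det_transpose)
qed

section \<open>Rotationally symmetric ends\<close>

text \<open>Let \<open>R\<close> be an equivalence relation with open saturations and separated classes, and \<open>z\<close> an
  open invariant function that locally distinguishes the classes. Then \<open>z\<close> distinguishes them
  globally: a local homeomorphism of the connected quotient to the line is injective. The proof
  grows a saturated open set on which \<open>z\<close> is injective modulo \<open>R\<close>.\<close>

lemma classes_distinguished_globally:
  fixes z :: "'a \<Rightarrow> real"
  assumes conn: "connected_space X"
    and refl: "\<And>x. x \<in> topspace X \<Longrightarrow> R x x"
    and sym: "\<And>x y. x \<in> topspace X \<Longrightarrow> y \<in> topspace X \<Longrightarrow> R x y \<Longrightarrow> R y x"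
    and trans: "\<And>x y w. x \<in> topspace X \<Longrightarrow> y \<in> topspace X \<Longrightarrow> w \<in> topspace X \<Longrightarrow> R x y \<Longrightarrow> R y w \<Longrightarrow> R x w"
    and inv: "\<And>x y. x \<in> topspace X \<Longrightarrow> y \<in> topspace X \<Longrightarrow> R x y \<Longrightarrow> z x = z y"
    and satur: "\<And>U. openin X U \<Longrightarrow> openin X {y \<in> topspace X. \<exists>x\<in>U. R x y}"
    and sep: "\<And>x y. x \<in> topspace X \<Longrightarrow> y \<in> topspace X \<Longrightarrow> \<not> R x y \<Longrightarrow>
        \<exists>N1 N2. openin X N1 \<and> openin X N2 \<and> x \<in> N1 \<and> y \<in> N2 \<and> (\<forall>a\<in>N1. \<forall>b\<in>N2. \<not> R a b)"
    and loc: "\<And>x. x \<in> topspace X \<Longrightarrow>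
        \<exists>U. openin X U \<and> x \<in> U \<and> connected (z ` U) \<and> (\<forall>a\<in>U. \<forall>b\<in>U. z a = z b \<longrightarrow> R a b)"
    and zopen: "\<And>U. openin X U \<Longrightarrow> open (z ` U)"
    and ab: "a \<in> topspace X" "b \<in> topspace X" "z a = z b"
  shows "R a b"
proof -
  (* sets that look like a piece of the quotient on which z is injective *)
  define good where "good V \<longleftrightarrow> openin X V \<and> (\<forall>x\<in>V. \<forall>y\<in>topspace X. R x y \<longrightarrow> y \<in> V) \<and> connected (z ` V)
      \<and> (\<forall>x\<in>V. \<forall>y\<in>V. z x = z y \<longrightarrow> R x y)" for V
  have sub: "V \<subseteq> topspace X" if "good V" for V using that openin_subset by (auto simp: good_def)
  have good_inj: "R x y" if "good V" "x \<in> V" "y \<in> V" "z x = z y" for V x y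
    using that by (simp add: good_def)
  (* Two good sets that meet agree wherever their images do: the images meet in an interval, which is
     covered by two disjoint open sets, the values at common points and the values O' at points that
     are separated from each other modulo R. *)
  have agree: "R b1 b2"
    if V: "good V1" "good V2" and a: "a1 \<in> V1 \<inter> V2" and b: "b1 \<in> V1" "b2 \<in> V2" "z b1 = z b2" for V1 V2 a1 b1 b2
  proof -
    let ?I = "z ` V1 \<inter> z ` V2" and ?S = "z ` (V1 \<inter> V2)"
    have I: "connected ?I"
      using V by (auto simp: good_def is_interval_connected_1[symmetric] intro: is_interval_Int)
    have "openin X (V1 \<inter> V2)" using V by (auto simp: good_def)
    then have S: "open ?S" by (rule zopen)
    define O' where "O' = {t. \<exists>N1 N2. openin X N1 \<and> openin X N2 \<and> N1 \<subseteq> V1 \<and> N2 \<subseteq> V2 \<and>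
        (\<forall>a\<in>N1. \<forall>b\<in>N2. \<not> R a b) \<and> t \<in> z ` N1 \<inter> z ` N2}"
    have O': "open O'"
    proof (subst open_subopen, intro ballI)
      fix t assume "t \<in> O'"
      then obtain N1 N2 where N: "openin X N1" "openin X N2" "N1 \<subseteq> V1" "N2 \<subseteq> V2"
        "\<forall>a\<in>N1. \<forall>b\<in>N2. \<not> R a b" "t \<in> z ` N1 \<inter> z ` N2" unfolding O'_def by blast
      then show "\<exists>T. open T \<and> t \<in> T \<and> T \<subseteq> O'"
        using zopen by (intro exI[of _ "z ` N1 \<inter> z ` N2"]) (auto simp: O'_def)
    qed
    have cover: "?I \<subseteq> ?S \<union> O'"
    proof
      fix t assume "t \<in> ?I"
      then obtain x1 x2 where x: "x1 \<in> V1" "x2 \<in> V2" "z x1 = t" "z x2 = t" by auto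
      have xt: "x1 \<in> topspace X" "x2 \<in> topspace X" using x sub V by auto
      show "t \<in> ?S \<union> O'"
      proof (cases "R x1 x2")
        case True
        then have "x2 \<in> V1" using V(1) x xt by (auto simp: good_def)
        then have "z x2 \<in> ?S" using x(2) by (intro imageI IntI)
        then show ?thesis using x(4) by simp
      next
        case False
        then obtain N1 N2 where N: "openin X N1" "openin X N2" "x1 \<in> N1" "x2 \<in> N2" "\<forall>a\<in>N1. \<forall>b\<in>N2. \<not> R a b"
          using sep xt by metis
        have "openin X V1" "openin X V2" using V by (simp_all add: good_def)
        then have "openin X (N1 \<inter> V1)" "openin X (N2 \<inter> V2)" using N by (simp_all add: openin_Int)
        moreover have "\<forall>a\<in>N1 \<inter> V1. \<forall>b\<in>N2 \<inter> V2. \<not> R a b" using N(5) by simp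
        moreover have "t \<in> z ` (N1 \<inter> V1)"
          using imageI[of x1 "N1 \<inter> V1" z] x N(3) by simp
        moreover have "t \<in> z ` (N2 \<inter> V2)"
          using imageI[of x2 "N2 \<inter> V2" z] x N(4) by simp
        ultimately have "t \<in> O'"
          unfolding O'_def by (intro CollectI exI[of _ "N1 \<inter> V1"] exI[of _ "N2 \<inter> V2"]) (simp only:, simp)
        then show ?thesis by simp
      qed
    qed
    have "?S \<inter> O' \<inter> ?I = {}"
    proof (rule ccontr)
      assume "\<not> ?thesis"
      then obtain t where t: "t \<in> ?S" "t \<in> O'" by blast
      from t(1) obtain x where x: "x \<in> V1" "x \<in> V2" "z x = t" by auto
      from t(2) obtain N1 N2 where N12: "N1 \<subseteq> V1" "N2 \<subseteq> V2" "\<forall>a\<in>N1. \<forall>b\<in>N2. \<not> R a b" "t \<in> z ` N1" "t \<in> z ` N2"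
        unfolding O'_def by auto
      from N12(4) obtain n1 where n1: "n1 \<in> N1" "z n1 = t" by auto
      from N12(5) obtain n2 where n2: "n2 \<in> N2" "z n2 = t" by auto
      note N = N12(1-3) x n1 n2
      have "R n1 x" by (rule good_inj[OF V(1)]) (use N in auto)
      moreover have "R x n2" by (rule good_inj[OF V(2)]) (use N in auto)
      moreover have "n1 \<in> topspace X" "x \<in> topspace X" "n2 \<in> topspace X" using N sub[OF V(1)] sub[OF V(2)] by auto
      ultimately have "R n1 n2" by (metis trans)
      then show False using N12(3) n1 n2 by simp
    qed
    moreover have "?S \<inter> ?I \<noteq> {}" using a by blast
    ultimately have "O' \<inter> ?I = {}"
      using I S O' cover unfolding connected_def by blast
    moreover have "z b1 \<in> ?I" using b by (metis IntI imageI)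
    ultimately have "z b1 \<in> ?S" using cover by blast
    then obtain x where x: "x \<in> V1" "x \<in> V2" "z x = z b1" by auto
    have "R b1 x" by (rule good_inj[OF V(1)]) (use b x in auto)
    moreover have "R x b2" by (rule good_inj[OF V(2)]) (use b x in auto)
    moreover have "b1 \<in> topspace X" "x \<in> topspace X" "b2 \<in> topspace X" using b x sub[OF V(1)] sub[OF V(2)] by auto
    ultimately show ?thesis by (metis trans)
  qed
  have union: "good (\<Union>\<V>)" if "\<And>V. V \<in> \<V> \<Longrightarrow> good V" "\<And>V1 V2. V1 \<in> \<V> \<Longrightarrow> V2 \<in> \<V> \<Longrightarrow> V1 \<inter> V2 \<noteq> {}"
    and ne: "x0 \<in> \<Inter>\<V>" for \<V> x0
    unfolding good_def
  proof (intro conjI)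
    show "openin X (\<Union>\<V>)" using that by (auto simp: good_def)
    show "\<forall>x\<in>\<Union>\<V>. \<forall>y\<in>topspace X. R x y \<longrightarrow> y \<in> \<Union>\<V>" using that(1) unfolding good_def by blast
    have "z ` \<Union>\<V> = \<Union> ((`) z ` \<V>)" by blast
    moreover have "connected (\<Union> ((`) z ` \<V>))"
    proof (rule connected_Union)
      show "connected s" if "s \<in> (`) z ` \<V>" for s using that \<open>\<And>V. V \<in> \<V> \<Longrightarrow> good V\<close> by (auto simp: good_def)
      show "\<Inter> ((`) z ` \<V>) \<noteq> {}" using ne by (metis (no_types, lifting) INT_I InterD empty_iff imageI)
    qed
    ultimately show "connected (z ` \<Union>\<V>)" by simp
    show "\<forall>x\<in>\<Union>\<V>. \<forall>y\<in>\<Union>\<V>. z x = z y \<longrightarrow> R x y"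
    proof (intro ballI impI)
      fix x y assume "x \<in> \<Union>\<V>" "y \<in> \<Union>\<V>" and zz: "z x = z y"
      then obtain V1 V2 where V: "V1 \<in> \<V>" "V2 \<in> \<V>" "x \<in> V1" "y \<in> V2" by blast
      show "R x y"
        by (rule agree[of V1 V2 x0]) (use V that zz in auto)
    qed
  qed
  have good_loc: "\<exists>U. good U \<and> x \<in> U" if x: "x \<in> topspace X" for x
  proof -
    obtain U where U: "openin X U" "x \<in> U" "connected (z ` U)" "\<forall>a\<in>U. \<forall>b\<in>U. z a = z b \<longrightarrow> R a b"
      using loc[OF x] by blast
    define S where "S = {y \<in> topspace X. \<exists>x\<in>U. R x y}"
    have Ut: "U \<subseteq> topspace X" using U openin_subset by blast
    have SE: "\<exists>x. x \<in> U \<and> x \<in> topspace X \<and> y \<in> topspace X \<and> R x y" if "y \<in> S" for y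
      using that Ut by (auto simp: S_def)
    have US: "U \<subseteq> S" using refl Ut by (auto simp: S_def)
    have "z ` S = z ` U"
    proof
      show "z ` S \<subseteq> z ` U"
      proof
        fix t assume "t \<in> z ` S"
        then obtain y where y: "t = z y" "y \<in> S" by auto
        obtain x where x: "x \<in> U" "x \<in> topspace X" "y \<in> topspace X" "R x y" using SE[OF y(2)] by metis
        have "t = z x" using inv[OF x(2-4)] y(1) by simp
        then show "t \<in> z ` U" using x(1) by (rule image_eqI)
      qed
      show "z ` U \<subseteq> z ` S" using US by (rule image_mono)
    qed
    then have 1: "connected (z ` S)" using U(3) by simp
    have 2: "R y1 y2" if y: "y1 \<in> S" "y2 \<in> S" "z y1 = z y2" for y1 y2
    proof -
      obtain x1 where x1: "x1 \<in> U" "x1 \<in> topspace X" "y1 \<in> topspace X" "R x1 y1" using SE[OF y(1)] by metis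
      obtain x2 where x2: "x2 \<in> U" "x2 \<in> topspace X" "y2 \<in> topspace X" "R x2 y2" using SE[OF y(2)] by metis
      have "z x1 = z x2" using inv[OF x1(2,3,4)] inv[OF x2(2,3,4)] y(3) by simp
      then have "R x1 x2" using U(4) x1(1) x2(1) by simp
      then have "R y1 x2" by (rule trans[OF x1(3,2) x2(2) sym[OF x1(2,3,4)]])
      then show ?thesis by (rule trans[OF x1(3) x2(2,3) _ x2(4)])
    qed
    have 3: "y' \<in> S" if "y \<in> S" "y' \<in> topspace X" "R y y'" for y y'
    proof -
      from SE[OF that(1)] obtain x where x: "x \<in> U" "x \<in> topspace X" "y \<in> topspace X" "R x y" by metis
      have "R x y'" by (rule trans[OF x(2,3) that(2) x(4) that(3)])
      then show ?thesis using x(1) that(2) by (auto simp: S_def)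
    qed
    have 4: "openin X S" unfolding S_def by (rule satur[OF U(1)])
    have "good S" unfolding good_def using 1 2 3 4 by (intro conjI ballI impI)
    then show ?thesis using US U(2) by (intro exI[of _ S]) auto
  qed
  define \<V> where "\<V> = {V. good V \<and> a \<in> V}"
  define V where "V = \<Union>\<V>"
  have goodV: "good V"
    unfolding V_def by (rule union[of _ a]) (auto simp: \<V>_def)
  have aV: "a \<in> V" using good_loc[OF ab(1)] unfolding V_def \<V>_def by blast
  have "closedin X V"
  proof -
    have "X closure_of V \<subseteq> V"
    proof
      fix y assume y: "y \<in> X closure_of V"
      then have yt: "y \<in> topspace X" by (meson closure_of_subset_topspace subsetD)
      obtain U where U: "good U" "y \<in> U" using good_loc[OF yt] by blast
      then have "openin X U" by (simp add: good_def)
      then obtain x where x: "x \<in> V" "x \<in> U" using y U(2) by (auto simp: in_closure_of)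
      have "good (\<Union>{V, U})"
        by (rule union[of _ x]) (use goodV U x in auto)
      then have "\<Union>{V, U} \<in> \<V>" using aV by (auto simp: \<V>_def)
      then show "y \<in> V" using U(2) unfolding V_def by blast
    qed
    then show ?thesis using sub[OF goodV] closure_of_subset_eq by blast
  qed
  moreover have "openin X V" using goodV by (simp add: good_def)
  ultimately have "V = topspace X" using conn aV unfolding connected_space_clopen_in by blast
  then show ?thesis using goodV ab by (simp add: good_def)
qed

text \<open>The data of a rotationally symmetric end: an action of the rotations on the complement of \<open>K\<close>, for
  which \<open>f\<close> is equivariant.\<close>

locale rotational_end = scalar_flat_hypersurface T M f
  for T :: "'n::finite itself" and M :: "'a topology" and f :: "'a \<Rightarrow> real^'d" +
  fixes p \<nu> :: "real^'d" and K :: "'a set" and \<Phi> :: "real^'d^'d \<Rightarrow> 'a \<Rightarrow> 'a"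
  assumes norm_\<nu>: "norm \<nu> = 1" and compact_K: "compactin M K"
    and cont_\<Phi>: "continuous_map (prod_topology (top_of_set (rotations_fixing \<nu>)) (subtopology M (topspace M - K)))
        (subtopology M (topspace M - K)) (\<lambda>(A, x). \<Phi> A x)"
    and \<Phi>_1: "\<And>x. x \<in> topspace M - K \<Longrightarrow> \<Phi> (mat 1) x = x"
    and \<Phi>_mult: "\<And>A B x. A \<in> rotations_fixing \<nu> \<Longrightarrow> B \<in> rotations_fixing \<nu> \<Longrightarrow> x \<in> topspace M - K \<Longrightarrow>
        \<Phi> (A ** B) x = \<Phi> A (\<Phi> B x)"
    and f_\<Phi>: "\<And>A x. A \<in> rotations_fixing \<nu> \<Longrightarrow> x \<in> topspace M - K \<Longrightarrow> f (\<Phi> A x) = p + A *v (f x - p)"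
begin

abbreviation "E \<equiv> topspace M - K"
abbreviation "G \<equiv> rotations_fixing \<nu>"

lemma open_E: "openin M E"
  using compactin_imp_closedin[OF Hausdorff_M compact_K] by blast

lemma \<Phi>_in_E: "A \<in> G \<Longrightarrow> x \<in> E \<Longrightarrow> \<Phi> A x \<in> E"
  using continuous_map_image_subset_topspace[OF cont_\<Phi>] by (auto simp: image_subset_iff)

text \<open>Joint continuity of the action, in terms of neighbourhoods in \<open>M\<close>.\<close>

lemma \<Phi>_near:
  assumes A: "A \<in> G" and x: "x \<in> E" and U: "openin M U" "\<Phi> A x \<in> U"
  obtains S N where "open S" "A \<in> S" "openin M N" "x \<in> N" "N \<subseteq> E"
    "\<And>B y. B \<in> S \<inter> G \<Longrightarrow> y \<in> N \<Longrightarrow> \<Phi> B y \<in> U"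
proof -
  let ?E = "subtopology M E"
  let ?P = "prod_topology (top_of_set G) ?E"
  let ?W = "{q \<in> topspace ?P. (\<lambda>(A, x). \<Phi> A x) q \<in> U \<inter> E}"
  have "openin ?E (U \<inter> E)" using U(1) by (auto simp: openin_subtopology)
  then have "openin ?P ?W" by (rule openin_continuous_map_preimage[OF cont_\<Phi>])
  moreover have "(A, x) \<in> ?W" using A x U(2) \<Phi>_in_E[OF A x] by simp
  ultimately have "\<exists>S' N. openin (top_of_set G) S' \<and> openin ?E N \<and> A \<in> S' \<and> x \<in> N \<and> S' \<times> N \<subseteq> ?W"
    unfolding openin_prod_topology_alt by blast
  then obtain S' N where SN: "openin (top_of_set G) S'" "openin ?E N" "A \<in> S'" "x \<in> N" "S' \<times> N \<subseteq> ?W"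
    by blast
  obtain S where S: "open S" "S' = G \<inter> S" using SN(1) by (auto simp: openin_open)
  have "openin M N" using SN(2) open_E openin_trans_full by blast
  moreover have "N \<subseteq> E" using openin_subset[OF SN(2)] by auto
  moreover have "\<Phi> B y \<in> U" if "B \<in> S \<inter> G" "y \<in> N" for B y
  proof -
    have "(B, y) \<in> S' \<times> N" using that S(2) by simp
    then have "(B, y) \<in> ?W" using SN(5) by (rule subsetD[rotated])
    then show ?thesis by simp
  qed
  moreover have "A \<in> S" using SN(3) S(2) by simp
  ultimately show ?thesis by (intro that[OF S(1) _ _ SN(4)])
qed

lemma \<Phi>_inverse: "A \<in> G \<Longrightarrow> x \<in> E \<Longrightarrow> \<Phi> (transpose A) (\<Phi> A x) = x"
  using \<Phi>_mult[of "transpose A" A x] \<Phi>_1[of x] rotations_fixing_group(3,4)[of A \<nu>] by simp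

definition "R x y \<longleftrightarrow> (\<exists>A\<in>G. \<Phi> A x = y)"

lemma R_refl: "x \<in> E \<Longrightarrow> R x x"
  unfolding R_def using \<Phi>_1 rotations_fixing_group(1) by blast

lemma R_sym: "x \<in> E \<Longrightarrow> R x y \<Longrightarrow> R y x"
  unfolding R_def using \<Phi>_inverse rotations_fixing_group(3) by blast

lemma R_trans: "x \<in> E \<Longrightarrow> R x y \<Longrightarrow> R y w \<Longrightarrow> R x w"
  unfolding R_def using \<Phi>_mult rotations_fixing_group(2) by metis

lemma \<nu>_mult: "A \<in> G \<Longrightarrow> \<nu> \<bullet> (A *v y) = \<nu> \<bullet> y"
proof -
  assume A: "A \<in> G"
  have "\<nu> \<bullet> (A *v y) = (transpose A *v \<nu>) \<bullet> y" by (simp add: dot_lmul_matrix)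
  also have "transpose A *v \<nu> = \<nu>"
    using rotations_fixing_group(3)[OF A] by (simp add: rotations_fixing_def del: transpose_matrix_vector)
  finally show ?thesis .
qed

lemma height_\<Phi>: "A \<in> G \<Longrightarrow> x \<in> E \<Longrightarrow> \<nu> \<bullet> f (\<Phi> A x) = \<nu> \<bullet> f x"
  by (simp add: f_\<Phi> inner_add_right \<nu>_mult inner_diff_right)

lemma height_R: "x \<in> E \<Longrightarrow> R x y \<Longrightarrow> \<nu> \<bullet> f y = \<nu> \<bullet> f x"
  unfolding R_def using height_\<Phi> by blast

lemma saturation_open:
  assumes U: "openin M U" "U \<subseteq> E" shows "openin M {y \<in> E. \<exists>x\<in>U. R x y}"
proof (subst openin_subopen, intro ballI)
  fix y assume y: "y \<in> {y \<in> E. \<exists>x\<in>U. R x y}"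
  then obtain x A where x: "x \<in> U" "A \<in> G" "\<Phi> A x = y" "y \<in> E" unfolding R_def by blast
  have tA: "transpose A \<in> G" using x rotations_fixing_group(3) by blast
  have "\<Phi> (transpose A) y \<in> U" using \<Phi>_inverse x U by auto
  then obtain S N where N: "open S" "transpose A \<in> S" "openin M N" "y \<in> N" "N \<subseteq> E"
    "\<And>B w. B \<in> S \<inter> G \<Longrightarrow> w \<in> N \<Longrightarrow> \<Phi> B w \<in> U"
    using \<Phi>_near[OF tA x(4) U(1)] by metis
  have "w \<in> {y \<in> E. \<exists>x\<in>U. R x y}" if "w \<in> N" for w
  proof -
    have "\<Phi> (transpose A) w \<in> U" using N(2,6) tA that by blast
    moreover have "R (\<Phi> (transpose A) w) w"
      using R_sym[of w] N(5) that tA unfolding R_def by blast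
    ultimately show ?thesis using N(5) that by blast
  qed
  then show "\<exists>T. openin M T \<and> y \<in> T \<and> T \<subseteq> {y \<in> E. \<exists>x\<in>U. R x y}" using N by blast
qed

text \<open>For each rotation the two points have neighbourhoods that the nearby rotations do not connect;
  since the group is compact, finitely many of these neighbourhoods suffice.\<close>

lemma orbits_separated:
  assumes x: "x \<in> E" and y: "y \<in> E" and xy: "\<not> R x y"
  shows "\<exists>N1 N2. openin M N1 \<and> openin M N2 \<and> x \<in> N1 \<and> y \<in> N2 \<and> N1 \<subseteq> E \<and> N2 \<subseteq> E \<and> (\<forall>a\<in>N1. \<forall>b\<in>N2. \<not> R a b)"
proof -
  have "\<exists>S N1 N2. open S \<and> A \<in> S \<and> openin M N1 \<and> openin M N2 \<and> x \<in> N1 \<and> y \<in> N2 \<and> N1 \<subseteq> E \<and>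
       (\<forall>B\<in>S\<inter>G. \<forall>a\<in>N1. \<Phi> B a \<notin> N2)" if A: "A \<in> G" for A
  proof -
    have "\<Phi> A x \<noteq> y" using xy A by (auto simp: R_def)
    moreover have "\<Phi> A x \<in> topspace M" "y \<in> topspace M" using \<Phi>_in_E[OF A x] y by auto
    ultimately obtain O1 O2 where O: "openin M O1" "openin M O2" "\<Phi> A x \<in> O1" "y \<in> O2" "disjnt O1 O2"
      using Hausdorff_M unfolding Hausdorff_space_def by metis
    obtain S N where "open S" "A \<in> S" "openin M N" "x \<in> N" "N \<subseteq> E" "\<And>B y. B \<in> S \<inter> G \<Longrightarrow> y \<in> N \<Longrightarrow> \<Phi> B y \<in> O1"
      using \<Phi>_near[OF A x O(1,3)] by metis
    then show ?thesis using O by (intro exI[of _ S] exI[of _ N] exI[of _ O2]) (auto simp: disjnt_iff)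
  qed
  then obtain S N1 N2 where S: "\<And>A. A \<in> G \<Longrightarrow> open (S A) \<and> A \<in> S A \<and> openin M (N1 A) \<and> openin M (N2 A) \<and> x \<in> N1 A \<and> y \<in> N2 A \<and> N1 A \<subseteq> E \<and>
       (\<forall>B\<in>S A\<inter>G. \<forall>a\<in>N1 A. \<Phi> B a \<notin> N2 A)" by metis
  obtain D where D: "finite D" "D \<subseteq> G" "G \<subseteq> \<Union> (S ` D)"
  proof (rule compactE_image[OF compact_rotations_fixing, of G S \<nu>])
    show "open (S A)" if "A \<in> G" for A using S that by blast
    show "G \<subseteq> (\<Union>A\<in>G. S A)" using S by blast
  qed (use that in blast)
  have D0: "D \<noteq> {}" using D rotations_fixing_group(1)[of \<nu>] by auto
  show ?thesis
  proof (intro exI conjI)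
    show "openin M (\<Inter> (N1 ` D))" "openin M (E \<inter> \<Inter> (N2 ` D))"
      using D D0 S open_E by (auto intro!: openin_Inter openin_Int)
    show "x \<in> \<Inter> (N1 ` D)" "y \<in> E \<inter> \<Inter> (N2 ` D)" "\<Inter> (N1 ` D) \<subseteq> E" "E \<inter> \<Inter> (N2 ` D) \<subseteq> E"
      using S D D0 y by blast+
    show "\<forall>a\<in>\<Inter> (N1 ` D). \<forall>b\<in>E \<inter> \<Inter> (N2 ` D). \<not> R a b"
    proof (intro ballI notI)
      fix a b assume a: "a \<in> \<Inter> (N1 ` D)" and b: "b \<in> E \<inter> \<Inter> (N2 ` D)" and "R a b"
      then obtain B where B: "B \<in> G" "\<Phi> B a = b" unfolding R_def by blast
      then obtain A where "A \<in> D" "B \<in> S A" using D(3) by blast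
      then show False using S[of A] D(2) a b B by blast
    qed
  qed
qed

lemma compact_orbit: assumes "x \<in> E" shows "compactin M ((\<lambda>A. \<Phi> A x) ` G)"
proof -
  have "continuous_map (top_of_set G) (subtopology M E) ((\<lambda>(A, x). \<Phi> A x) \<circ> (\<lambda>A. (A, x)))"
    by (rule continuous_map_compose[OF _ cont_\<Phi>]) (use assms in \<open>auto intro!: continuous_map_pairedI\<close>)
  then have "continuous_map (top_of_set G) M (\<lambda>A. \<Phi> A x)"
    by (simp add: continuous_map_in_subtopology comp_def)
  moreover have "compactin (top_of_set G) G"
    using compact_rotations_fixing by (simp add: compactin_subtopology)
  ultimately show ?thesis using image_compactin by blast
qed

text \<open>For small angles the rotated point stays in the chart, so its difference quotients approach the
  tangent space as well as the rotation field. The tangent space is closed.\<close>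

lemma rotation_field_tangent_unit:
  assumes c: "chart (ball u r) \<phi>" "\<phi> ` ball u r \<subseteq> E" and v: "v \<in> ball u r"
    and a: "norm a = 1" "a \<bullet> \<nu> = 0" and b: "norm b = 1" "b \<bullet> \<nu> = 0" and ab: "a \<bullet> b = 0"
  shows "((f (\<phi> v) - p) \<bullet> a) *\<^sub>R b - ((f (\<phi> v) - p) \<bullet> b) *\<^sub>R a \<in> range (frechet_derivative (f \<circ> \<phi>) (at v))"
proof -
  interpret I: immersion "f \<circ> \<phi>" "ball u r" using chart_immersion[OF c(1)] .
  let ?F = "f \<circ> \<phi>" and ?D = "frechet_derivative (f \<circ> \<phi>) (at v)"
  define X where "X = f (\<phi> v) - p"
  define J where "J = (X \<bullet> a) *\<^sub>R b - (X \<bullet> b) *\<^sub>R a"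
  define A where "A t = rotate_to a (cos t *\<^sub>R a + sin t *\<^sub>R b)" for t
  have aa: "a \<bullet> a = 1" "b \<bullet> b = 1" using a b by (simp_all add: dot_square_norm)
  have xE: "\<phi> v \<in> E" using c v by blast
  have ev0: "\<forall>\<^sub>F t in at_right 0. cos t \<noteq> -1 \<and> t > (0::real)"
  proof -
    have "cos t > 0" if "0 < t" "t < pi/2" for t :: real using cos_gt_zero that by simp
    then have "cos t \<noteq> -1 \<and> t > 0" if "0 < t" "t < pi/2" for t :: real using that by fastforce
    then show ?thesis using pi_half_gt_zero
      unfolding eventually_at_right_field by (intro exI[of _ "pi/2"]) auto
  qed
  have AG: "A t \<in> G" if "cos t \<noteq> -1" for t
  proof -
    have "norm (cos t *\<^sub>R a + sin t *\<^sub>R b) = 1"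
      by (simp add: norm_eq_1 inner_add_left inner_add_right aa ab inner_commute[of b a] power2_eq_square[symmetric])
    then show ?thesis unfolding A_def using a b ab aa that card_d card_n
      by (intro rotate_to_in_rotations) (auto simp: inner_add_left inner_add_right)
  qed
  have A1: "(A \<longlongrightarrow> mat 1) (at_right 0)"
  proof -
    have "((\<lambda>t. cos t *\<^sub>R a + sin t *\<^sub>R b) \<longlongrightarrow> cos 0 *\<^sub>R a + sin 0 *\<^sub>R b) (at_right (0::real))"
      by (intro tendsto_intros)
    then have "(A \<longlongrightarrow> rotate_to a a) (at_right 0)"
      unfolding A_def using aa by (intro tendsto_rotate_to tendsto_const) auto
    then show ?thesis using rotate_to_same[OF a(1)] by simp
  qed
  have lim: "((\<lambda>t. (A t *v X - X) /\<^sub>R t) \<longlongrightarrow> J) (at_right 0)"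
  proof -
    have "((\<lambda>t. ((cos t - 1) / t) *\<^sub>R ((a \<bullet> X) *\<^sub>R a + (b \<bullet> X) *\<^sub>R b) + (sin t / t) *\<^sub>R J) \<longlongrightarrow>
        0 *\<^sub>R ((a \<bullet> X) *\<^sub>R a + (b \<bullet> X) *\<^sub>R b) + 1 *\<^sub>R J) (at_right (0::real))"
    proof (intro tendsto_intros)
      have "(cos has_real_derivative 0) (at 0)" using DERIV_cos[of 0] by simp
      then show "((\<lambda>t. (cos t - 1) / t) \<longlongrightarrow> 0) (at_right (0::real))"
        unfolding has_field_derivative_iff by (auto intro: tendsto_mono[OF at_le])
      have "(sin has_real_derivative 1) (at 0)" using DERIV_sin[of 0] by simp
      then show "((\<lambda>t. sin t / t) \<longlongrightarrow> 1) (at_right (0::real))"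
        unfolding has_field_derivative_iff by (auto intro: tendsto_mono[OF at_le])
    qed
    moreover have "\<forall>\<^sub>F t in at_right 0. ((cos t - 1) / t) *\<^sub>R ((a \<bullet> X) *\<^sub>R a + (b \<bullet> X) *\<^sub>R b) + (sin t / t) *\<^sub>R J = (A t *v X - X) /\<^sub>R t"
      using ev0
    proof eventually_elim
      case (elim t)
      then have "A t *v X - X = (cos t - 1) *\<^sub>R ((a \<bullet> X) *\<^sub>R a + (b \<bullet> X) *\<^sub>R b) + sin t *\<^sub>R J"
        unfolding A_def J_def using rotate_to_cos_sin[OF a(1) b(1) ab, of t X] by (simp add: inner_commute)
      then show ?case by (simp add: scaleR_add_right divide_inverse ac_simps)
    qed
    ultimately show ?thesis by (simp add: tendsto_cong)
  qed
  obtain \<kappa> where \<kappa>: "\<kappa> > 0" "\<And>b. \<kappa> * norm b \<le> norm (?D b)" by (rule I.DF_bounded_below[OF v]) blast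
  have "J \<in> closure (range ?D)"
    unfolding closure_approachable
  proof (intro allI impI)
    fix e :: real assume e: "e > 0"
    (* the linear approximation error, relative to the angle t, has to stay below e/2 when the
       displacement in the chart is at most 2 t (norm J + 1) / kappa *)
    define \<epsilon> where "\<epsilon> = min (\<kappa> / 2) (e * \<kappa> / (4 * (norm J + 1)))"
    have J1: "norm J + 1 > 0" by (simp add: add_nonneg_pos)
    have \<epsilon>: "\<epsilon> > 0" "\<epsilon> \<le> \<kappa> / 2" "\<epsilon> \<le> e * \<kappa> / (4 * (norm J + 1))" using \<kappa>(1) e J1 unfolding \<epsilon>_def by (auto simp only: min_less_iff_conj min.cobounded1 min.cobounded2 half_gt_zero_iff intro!: divide_pos_pos mult_pos_pos)
    obtain \<delta> where \<delta>: "\<delta> > 0" "ball v \<delta> \<subseteq> ball u r"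
      "\<And>x y. x \<in> ball v \<delta> \<Longrightarrow> y \<in> ball v \<delta> \<Longrightarrow> norm (?F x - ?F y - ?D (x - y)) \<le> \<epsilon> * norm (x - y)"
      by (rule I.strong_differentiability[OF v \<epsilon>(1)]) blast
    have "openin M (\<phi> ` ball v \<delta>)" using chartD(5)[OF c(1) _ \<delta>(2)] by auto
    moreover have "\<Phi> (mat 1) (\<phi> v) \<in> \<phi> ` ball v \<delta>" using \<Phi>_1[OF xE] \<delta>(1) by simp
    ultimately obtain S N where SN: "open S" "mat 1 \<in> S" "openin M N" "\<phi> v \<in> N" "N \<subseteq> E"
      "\<And>B y. B \<in> S \<inter> G \<Longrightarrow> y \<in> N \<Longrightarrow> \<Phi> B y \<in> \<phi> ` ball v \<delta>"
      using \<Phi>_near[OF rotations_fixing_group(1) xE] by metis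
    have "\<forall>\<^sub>F t in at_right 0. A t \<in> S" using A1 SN(1,2) by (simp add: topological_tendstoD)
    moreover have "\<forall>\<^sub>F t in at_right 0. dist ((A t *v X - X) /\<^sub>R t) J < min 1 (e/2)"
      using lim e by (intro tendstoD) auto
    ultimately have "\<forall>\<^sub>F t in at_right 0. A t \<in> S \<and> dist ((A t *v X - X) /\<^sub>R t) J < min 1 (e/2) \<and> cos t \<noteq> -1 \<and> t > 0"
      using ev0 by eventually_elim simp
    from eventually_happens'[OF trivial_limit_at_right_real this]
    obtain t where t: "A t \<in> S" "dist ((A t *v X - X) /\<^sub>R t) J < 1" "dist ((A t *v X - X) /\<^sub>R t) J < e/2" "cos t \<noteq> -1" "t > 0"
      by auto
    then obtain x where x: "x \<in> ball v \<delta>" "\<Phi> (A t) (\<phi> v) = \<phi> x" using SN(4,6) AG by blast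
    have FX: "?F x - ?F v = A t *v X - X"
      using f_\<Phi>[OF AG[OF t(4)] xE] by (simp add: x(2)[symmetric] X_def)
    let ?h = "x - v"
    have est: "norm (?F x - ?F v - ?D ?h) \<le> \<epsilon> * norm ?h" using \<delta>(3)[OF x(1), of v] \<delta>(1) by simp
    have "\<kappa> * norm ?h \<le> norm (?F x - ?F v) + \<epsilon> * norm ?h"
      using \<kappa>(2)[of ?h] est norm_triangle_ineq4[of "?F x - ?F v" "?F x - ?F v - ?D ?h"] by simp
    also have "\<epsilon> * norm ?h \<le> \<kappa> / 2 * norm ?h" using \<epsilon>(2) by (intro mult_right_mono) auto
    finally have "\<kappa> * norm ?h \<le> 2 * norm (?F x - ?F v)" by simp
    moreover have "norm (?F x - ?F v) \<le> t * (norm J + 1)"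
    proof -
      have "norm ((A t *v X - X) /\<^sub>R t) \<le> norm J + 1"
        using t(2) norm_triangle_sub[of "(A t *v X - X) /\<^sub>R t" J] by (simp add: dist_norm)
      then show ?thesis unfolding FX using t(5) by (simp add: divide_inverse_commute[symmetric] divide_le_eq mult.commute)
    qed
    ultimately have hb: "norm ?h \<le> 2 * (t * (norm J + 1)) / \<kappa>" using \<kappa>(1) by (simp add: pos_le_divide_eq mult.commute)
    have "norm (?F x - ?F v - ?D ?h) \<le> (e * \<kappa> / (4 * (norm J + 1))) * (2 * (t * (norm J + 1)) / \<kappa>)"
      using est hb \<epsilon> e \<kappa> by (intro order_trans[OF est] mult_mono) auto
    also have "\<dots> = e / 2 * t"
    proof -
      have "(e * \<kappa> / (4 * j)) * (2 * (t * j) / \<kappa>) = e / 2 * t" if "j > 0" for j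
        using that \<kappa>(1) by (simp add: field_simps)
      then show ?thesis using J1 by blast
    qed
    finally have "norm ((?F x - ?F v - ?D ?h) /\<^sub>R t) \<le> e / 2"
      using t(5) by (simp add: divide_inverse_commute[symmetric] divide_le_eq)
    then have "dist (?D ?h /\<^sub>R t) ((A t *v X - X) /\<^sub>R t) \<le> e / 2"
      unfolding FX[symmetric] by (simp add: dist_norm norm_minus_commute scaleR_diff_right algebra_simps)
    then have "dist (?D ?h /\<^sub>R t) J < e"
      using t(3) dist_triangle[of "?D ?h /\<^sub>R t" J "(A t *v X - X) /\<^sub>R t"] by simp
    moreover have "?D ?h /\<^sub>R t \<in> range ?D" by (metis linear_cmul[OF I.linear_DF[OF v]] rangeI)
    ultimately show "\<exists>y\<in>range ?D. dist y J < e" by blast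
  qed
  moreover have "closed (range ?D)"
    using I.linear_DF[OF v] by (intro closed_subspace) (simp add: linear_subspace_image)
  ultimately show ?thesis by (simp add: J_def X_def)
qed

text \<open>The rotation field is bilinear and alternating in \<open>a\<close> and \<open>b\<close>, so orthonormal pairs suffice.\<close>

lemma rotation_field_tangent:
  assumes c: "chart (ball u r) \<phi>" "\<phi> ` ball u r \<subseteq> E" and v: "v \<in> ball u r"
    and a: "a \<bullet> \<nu> = 0" and b: "b \<bullet> \<nu> = 0"
  shows "\<exists>k. frechet_derivative (f \<circ> \<phi>) (at v) k = ((f (\<phi> v) - p) \<bullet> a) *\<^sub>R b - ((f (\<phi> v) - p) \<bullet> b) *\<^sub>R a"
proof -
  interpret I: immersion "f \<circ> \<phi>" "ball u r" using chart_immersion[OF c(1)] .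
  define X where "X = f (\<phi> v) - p"
  let ?D = "frechet_derivative (f \<circ> \<phi>) (at v)"
  define J where "J a b = (X \<bullet> a) *\<^sub>R b - (X \<bullet> b) *\<^sub>R a" for a b
  have sub: "subspace (range ?D)" using I.linear_DF[OF v] by (simp add: linear_subspace_image)
  have "J a b \<in> range ?D"
  proof (cases "a = 0")
    case True
    then show ?thesis using subspace_0[OF sub] by (simp add: J_def)
  next
    case a0: False
    define b' where "b' = b - ((a \<bullet> b) / (a \<bullet> a)) *\<^sub>R a"
    have b': "a \<bullet> b' = 0" "b' \<bullet> \<nu> = 0" using a0 a b by (simp_all add: b'_def inner_diff_right inner_diff_left)
    have J: "J a b = J a b'" by (simp add: J_def b'_def inner_diff_right algebra_simps)
    show ?thesis
    proof (cases "b' = 0")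
      case True
      then show ?thesis using subspace_0[OF sub] unfolding J by (simp add: J_def)
    next
      case b0: False
      have "J (a /\<^sub>R norm a) (b' /\<^sub>R norm b') \<in> range ?D"
        unfolding J_def X_def
        by (rule rotation_field_tangent_unit[OF c v]) (use a0 b0 a b b' in auto)
      then have "(norm a * norm b') *\<^sub>R J (a /\<^sub>R norm a) (b' /\<^sub>R norm b') \<in> range ?D"
        by (rule subspace_scale[OF sub])
      moreover have "(norm a * norm b') *\<^sub>R J (a /\<^sub>R norm a) (b' /\<^sub>R norm b') = J a b'"
        using a0 b0 by (simp add: J_def scaleR_diff_right field_simps)
      ultimately show ?thesis using J by simp
    qed
  qed
  then show ?thesis unfolding J_def X_def by (metis rangeE)
qed

lemma chart_rotational:
  assumes c: "chart (ball u r) \<phi>" "\<phi> ` ball u r \<subseteq> E"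
  shows "rotational_immersion (f \<circ> \<phi>) (ball u r) p \<nu>"
proof -
  interpret I: immersion "f \<circ> \<phi>" "ball u r" using chart_immersion[OF c(1)] .
  show ?thesis
  proof
    show "norm \<nu> = 1" "CARD('d) = CARD('n) + 1" "3 \<le> CARD('n)" using norm_\<nu> card_d card_n by auto
    show "\<exists>k. frechet_derivative (f \<circ> \<phi>) (at u') k = (((f \<circ> \<phi>) u' - p) \<bullet> a) *\<^sub>R b - (((f \<circ> \<phi>) u' - p) \<bullet> b) *\<^sub>R a"
      if "u' \<in> ball u r" "a \<bullet> \<nu> = 0" "b \<bullet> \<nu> = 0" for u' a b
      using rotation_field_tangent[OF c that] by simp
    show "scalar_curvature (induced_metric (f \<circ> \<phi>)) v = 0" if "v \<in> ball u r" for v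
      using flat c(1) that unfolding scalar_flat_def by blast
  qed
qed

abbreviation "height x \<equiv> \<nu> \<bullet> f x"

text \<open>The height is constant near \<open>x\<close>. On the end this turns out to be the same as being a
  critical point of the height, but it is evident that it does not depend on a chart.\<close>

definition "stationary x \<longleftrightarrow> (\<exists>U c. openin M U \<and> x \<in> U \<and> (\<forall>y\<in>U. height y = c))"

lemma open_stationary: "openin M W \<Longrightarrow> openin M {x \<in> W. stationary x}"
proof (subst openin_subopen, intro ballI)
  fix x assume W: "openin M W" and x: "x \<in> {x \<in> W. stationary x}"
  then obtain U c where U: "openin M U" "x \<in> U" "\<forall>y\<in>U. height y = c" unfolding stationary_def by blast
  have "U \<inter> W \<subseteq> {x \<in> W. stationary x}" using U unfolding stationary_def by blast
  then show "\<exists>T. openin M T \<and> x \<in> T \<and> T \<subseteq> {x \<in> W. stationary x}"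
    using U W x by (intro exI[of _ "U \<inter> W"]) auto
qed

lemma chart_dichotomy:
  assumes r: "r > 0" and c: "chart (ball u r) \<phi>" "\<phi> ` ball u r \<subseteq> E"
  shows "(\<forall>v\<in>ball u r. stationary (\<phi> v)) \<or> (\<forall>v\<in>ball u r. \<not> stationary (\<phi> v))"
proof -
  interpret I: rotational_immersion "f \<circ> \<phi>" "ball u r" p \<nu> using chart_rotational[OF c] .
  consider "\<forall>v\<in>ball u r. I.w v = 0" | "\<forall>v\<in>ball u r. I.w v \<noteq> 0" using I.horizontal_dichotomy by auto
  then show ?thesis
  proof cases
    case 1
    then obtain a where a: "\<And>v. v \<in> ball u r \<Longrightarrow> \<nu> \<bullet> (f \<circ> \<phi>) v = a"
      using I.height_constant[of thesis] by (metis convex_ball I.height_constant)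
    have "stationary (\<phi> v)" if "v \<in> ball u r" for v
      unfolding stationary_def using that chartD(4)[OF c(1)] a
      by (intro exI[of _ "\<phi> ` ball u r"] exI[of _ a]) auto
    then show ?thesis by blast
  next
    case 2
    have "\<not> stationary (\<phi> v)" if v: "v \<in> ball u r" for v
    proof
      assume "stationary (\<phi> v)"
      then obtain U a where U: "openin M U" "\<phi> v \<in> U" "\<forall>y\<in>U. height y = a" unfolding stationary_def by blast
      have "I.w v = 0"
        by (rule I.w_0_if_height_constant[OF chart_preimage_open[OF c(1) U(1)], of v a]) (use U v in auto)
      then show False using 2 v by blast
    qed
    then show ?thesis by blast
  qed
qed

lemma stationary_dichotomy:
  assumes W: "openin M W" "connectedin M W" "W \<subseteq> E"
  shows "(\<forall>x\<in>W. stationary x) \<or> (\<forall>x\<in>W. \<not> stationary x)"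
proof (rule ccontr)
  assume n: "\<not> ?thesis"
  have "openin M {x \<in> W. \<not> stationary x}"
  proof (subst openin_subopen, intro ballI)
    fix x assume x: "x \<in> {x \<in> W. \<not> stationary x}"
    then have xW: "x \<in> W" by simp
    obtain u r \<phi> where c: "r > 0" "chart (ball u r) \<phi>" "\<phi> u = x" "\<phi> ` ball u r \<subseteq> W"
      by (rule chart_ball[OF xW W(1)])
    have cE: "\<phi> ` ball u r \<subseteq> E" using c(4) W(3) by blast
    have "u \<in> ball u r" using c(1) by simp
    then have "\<forall>v\<in>ball u r. \<not> stationary (\<phi> v)"
      using chart_dichotomy[OF c(1,2) cE] x c(3) by auto
    then show "\<exists>T. openin M T \<and> x \<in> T \<and> T \<subseteq> {x \<in> W. \<not> stationary x}"
      using chartD(4)[OF c(2)] c by (intro exI[of _ "\<phi> ` ball u r"]) auto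
  qed
  moreover have "openin M {x \<in> W. stationary x}" using open_stationary[OF W(1)] .
  moreover have "W \<subseteq> {x \<in> W. stationary x} \<union> {x \<in> W. \<not> stationary x}" by blast
  moreover have "{x \<in> W. stationary x} \<inter> {x \<in> W. \<not> stationary x} \<inter> W = {}" by blast
  moreover have "{x \<in> W. stationary x} \<inter> W \<noteq> {}" "{x \<in> W. \<not> stationary x} \<inter> W \<noteq> {}" using n by blast+
  ultimately show False using W(2) unfolding connectedin by blast
qed

lemma stationary_constant:
  assumes W: "openin M W" "connectedin M W" and st: "\<forall>x\<in>W. stationary x" and a: "a \<in> W" "b \<in> W"
  shows "height a = height b"
proof (rule ccontr)
  assume ne: "height a \<noteq> height b"
  have op: "openin M {x \<in> W. P (height x)}" for P
  proof (subst openin_subopen, intro ballI)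
    fix x assume x: "x \<in> {x \<in> W. P (height x)}"
    then obtain U c where U: "openin M U" "x \<in> U" "\<forall>y\<in>U. height y = c" using st unfolding stationary_def by blast
    then show "\<exists>T. openin M T \<and> x \<in> T \<and> T \<subseteq> {x \<in> W. P (height x)}"
      using x W(1) by (intro exI[of _ "U \<inter> W"]) auto
  qed
  have "openin M {x \<in> W. height x = height a}" "openin M {x \<in> W. height x \<noteq> height a}" by (rule op)+
  moreover have "W \<subseteq> {x \<in> W. height x = height a} \<union> {x \<in> W. height x \<noteq> height a}" by blast
  moreover have "{x \<in> W. height x = height a} \<inter> {x \<in> W. height x \<noteq> height a} \<inter> W = {}" by blast
  moreover have "{x \<in> W. height x = height a} \<inter> W \<noteq> {}" "{x \<in> W. height x \<noteq> height a} \<inter> W \<noteq> {}" using a ne by auto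
  ultimately show False using W(2) unfolding connectedin by blast
qed

text \<open>Where the height is not stationary, two nearby points of the same height can be rotated to the
  same direction from the axis by a small rotation; then they differ only in the radial direction,
  which is transversal to the hypersurface, so they coincide.\<close>

lemma equal_height_same_orbit:
  assumes r: "r > 0" and c: "chart (ball u r) \<phi>" "\<phi> ` ball u r \<subseteq> E" and ns: "\<not> stationary (\<phi> u)"
  obtains \<eta> where "\<eta> > 0" "ball u \<eta> \<subseteq> ball u r"
    "\<And>v1 v2. v1 \<in> ball u \<eta> \<Longrightarrow> v2 \<in> ball u \<eta> \<Longrightarrow> height (\<phi> v1) = height (\<phi> v2) \<Longrightarrow> R (\<phi> v1) (\<phi> v2)"
proof -
  interpret I: rotational_immersion "f \<circ> \<phi>" "ball u r" p \<nu> using chart_rotational[OF c] .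
  let ?F = "f \<circ> \<phi>"
  have u: "u \<in> ball u r" using r by simp
  have w0: "\<forall>v\<in>ball u r. I.w v \<noteq> 0 \<and> I.X v \<noteq> 0"
  proof (rule ccontr)
    assume "\<not> ?thesis"
    then have "\<forall>v\<in>ball u r. I.w v = 0" using I.horizontal_dichotomy by auto
    then obtain a where a: "\<And>v. v \<in> ball u r \<Longrightarrow> \<nu> \<bullet> (f \<circ> \<phi>) v = a"
      by (metis convex_ball I.height_constant)
    then have "stationary (\<phi> u)"
      unfolding stationary_def using u chartD(4)[OF c(1)]
      by (intro exI[of _ "\<phi> ` ball u r"] exI[of _ a]) auto
    then show False using ns by simp
  qed
  then have X0: "I.X u \<noteq> 0" and w0u: "I.w u \<noteq> 0" using u by auto
  obtain N where N: "norm N = 1" "\<And>i. N \<bullet> partial_deriv i ?F u = 0" by (rule I.exists_unit_normal[OF u]) blast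
  define e where "e v = I.X v /\<^sub>R norm (I.X v)" for v
  have e1: "norm (e v) = 1" "e v \<bullet> \<nu> = 0" if "v \<in> ball u r" for v
    using w0 that I.X_orth by (auto simp: e_def)
  have N\<nu>: "N \<bullet> e u \<noteq> 0"
    \<comment> \<open>the unit normal is a combination of the radial and the axial direction; were it axial, the
      tangent plane would be horizontal\<close>
  proof
    assume Ne: "N \<bullet> e u = 0"
    define a where "a = N - (\<nu> \<bullet> N) *\<^sub>R \<nu>"
    have a\<nu>: "a \<bullet> \<nu> = 0" by (simp add: a_def inner_diff_left I.\<nu>\<nu> inner_commute[of \<nu> N])
    have ae: "a \<bullet> e u = 0" using Ne e1(2)[OF u] by (simp add: a_def inner_diff_left inner_commute[of \<nu> "e u"])
    obtain k where k: "frechet_derivative ?F (at u) k = ((?F u - p) \<bullet> e u) *\<^sub>R a - ((?F u - p) \<bullet> a) *\<^sub>R e u"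
      using I.rotation_tangent[OF u e1(2)[OF u] a\<nu>] by blast
    have "(?F u - p) \<bullet> e u = I.X u \<bullet> e u" using I.inner_X[OF e1(2)[OF u]] by simp
    also have "\<dots> = norm (I.X u)" using X0 by (simp add: e_def dot_square_norm power2_eq_square)
    finally have 1: "(?F u - p) \<bullet> e u = norm (I.X u)" .
    have "I.X u = norm (I.X u) *\<^sub>R e u" using X0 by (simp add: e_def)
    then have "(?F u - p) \<bullet> a = 0" using I.inner_X[OF a\<nu>, of u] ae by (metis inner_commute inner_scaleR_right mult_zero_right)
    then have "frechet_derivative ?F (at u) k = norm (I.X u) *\<^sub>R a" using k 1 by simp
    moreover have "N \<bullet> frechet_derivative ?F (at u) k = 0" using N(2) by (simp add: I.DF_eq[OF u] inner_sum_right)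
    ultimately have "N \<bullet> a = 0" using X0 by simp
    moreover have "\<nu> \<bullet> a = 0" using a\<nu> by (simp add: inner_commute)
    ultimately have "a \<bullet> a = 0" by (subst a_def) (simp add: inner_diff_left)
    then have "N = (\<nu> \<bullet> N) *\<^sub>R \<nu>" by (simp add: a_def)
    then have "norm N = \<bar>\<nu> \<bullet> N\<bar>" using norm_\<nu> by (metis norm_scaleR mult.right_neutral)
    then have "\<bar>\<nu> \<bullet> N\<bar> = 1" using N(1) by simp
    then have "(\<nu> \<bullet> N)\<^sup>2 = 1" by (simp add: power2_eq_1_iff abs_if split: if_splits)
    then show False using I.\<nu>_decomp(2)[OF u N] w0u by simp
  qed
  define \<beta> where "\<beta> = \<bar>N \<bullet> e u\<bar> / 2"
  have \<beta>: "\<beta> > 0" using N\<nu> by (simp add: \<beta>_def)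
  have contF: "continuous_on (ball u r) ?F" by (rule chartD(6)[OF c(1)])
  have contX: "continuous_on (ball u r) I.X"
    unfolding I.X_def[abs_def] by (intro continuous_intros contF)
  have conte: "continuous_on (ball u r) e"
    unfolding e_def using w0 by (intro continuous_intros contX) auto
  then have cte: "(e \<longlongrightarrow> e u) (at u)" using u by (simp add: continuous_on_eq_continuous_at continuous_at)
  have "\<forall>\<^sub>F v in at u. dist (e v) (e u) < \<beta>" using cte \<beta> by (rule tendstoD)
  then obtain d1 where d1: "d1 > 0" "\<And>v. dist v u < d1 \<Longrightarrow> dist (e v) (e u) < \<beta>"
    using \<beta> unfolding eventually_at by (metis UNIV_I dist_self)
  obtain \<kappa> where \<kappa>: "\<kappa> > 0" "\<And>b. \<kappa> * norm b \<le> norm (frechet_derivative ?F (at u) b)"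
    by (rule I.DF_bounded_below[OF u]) blast
  define \<epsilon> where "\<epsilon> = min (\<kappa> / 4) (\<kappa> * \<beta> / 4)"
  have \<epsilon>: "\<epsilon> > 0" "\<epsilon> \<le> \<kappa> / 4" "\<epsilon> \<le> \<kappa> * \<beta> / 4" using \<kappa> \<beta> by (auto simp: \<epsilon>_def)
  obtain d2 where d2: "d2 > 0" "ball u d2 \<subseteq> ball u r"
    "\<And>x y. x \<in> ball u d2 \<Longrightarrow> y \<in> ball u d2 \<Longrightarrow> norm (?F x - ?F y - frechet_derivative ?F (at u) (x - y)) \<le> \<epsilon> * norm (x - y)"
    by (rule I.strong_differentiability[OF u \<epsilon>(1)]) blast
  define d where "d = min d1 d2"
  have d: "d > 0" "ball u d \<subseteq> ball u d2" "ball u d \<subseteq> ball u r" using d1 d2 by (auto simp: d_def)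
  (* Images that differ by a radial vector belong to the same point: a chord of the hypersurface has
     a small component along N compared with its length, a radial vector does not. *)
  have radial: "v1 = v2" if v: "v1 \<in> ball u d" "v2 \<in> ball u d" and s: "?F v1 - ?F v2 = s *\<^sub>R e v2" for v1 v2 s
  proof (rule ccontr)
    let ?h = "v1 - v2"
    assume "v1 \<noteq> v2"
    then have h: "norm ?h > 0" by simp
    have est: "norm (?F v1 - ?F v2 - frechet_derivative ?F (at u) ?h) \<le> \<epsilon> * norm ?h"
      using d2(3) v d(2) by blast
    have "dist v2 u < d1" using v(2) by (simp add: d_def dist_commute)
    then have ev: "norm (e v2 - e u) < \<beta>" using d1(2)[of v2] by (simp add: dist_norm)
    have "\<bar>N \<bullet> (e v2 - e u)\<bar> \<le> norm (e v2 - e u)" using Cauchy_Schwarz_ineq2[of N "e v2 - e u"] N(1) by simp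
    then have "\<bar>N \<bullet> e v2\<bar> \<ge> \<beta>" using ev unfolding inner_diff_right \<beta>_def by linarith
    then have "\<bar>s\<bar> * \<beta> \<le> \<bar>s * (N \<bullet> e v2)\<bar>" by (simp add: abs_mult mult_left_mono)
    also have "s * (N \<bullet> e v2) = N \<bullet> (?F v1 - ?F v2 - frechet_derivative ?F (at u) ?h)"
      using s N(2) by (simp add: inner_diff_right I.DF_eq[OF u] inner_sum_right)
    also have "\<bar>\<dots>\<bar> \<le> \<epsilon> * norm ?h"
      using Cauchy_Schwarz_ineq2[of N "?F v1 - ?F v2 - frechet_derivative ?F (at u) ?h"] N(1) est by simp
    also have "\<dots> \<le> \<kappa> * \<beta> / 4 * norm ?h" using \<epsilon>(3) by (intro mult_right_mono) auto
    finally have "\<bar>s\<bar> * \<beta> \<le> (\<kappa> / 4 * norm ?h) * \<beta>" by (simp add: ac_simps)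
    then have s1: "\<bar>s\<bar> \<le> \<kappa> / 4 * norm ?h" using \<beta> by (rule mult_right_le_imp_le)
    have "v2 \<in> ball u r" using v(2) d(3) by blast
    then have "norm (?F v1 - ?F v2) = \<bar>s\<bar>" using s e1(1) by simp
    moreover have "\<kappa> * norm ?h \<le> norm (?F v1 - ?F v2) + \<epsilon> * norm ?h"
      using \<kappa>(2)[of ?h] est norm_triangle_ineq4[of "?F v1 - ?F v2" "?F v1 - ?F v2 - frechet_derivative ?F (at u) ?h"] by simp
    moreover have "\<epsilon> * norm ?h \<le> \<kappa> / 4 * norm ?h" using \<epsilon>(2) by (intro mult_right_mono) auto
    ultimately have "\<kappa> * norm ?h \<le> \<kappa> / 2 * norm ?h" using s1 by argo
    then show False using h \<kappa>(1) by simp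
  qed
  have uE: "\<phi> u \<in> E" using c(2) u by blast
  have "openin M (\<phi> ` ball u d)" using chartD(5)[OF c(1) _ d(3)] by auto
  moreover have "\<Phi> (mat 1) (\<phi> u) \<in> \<phi> ` ball u d" using \<Phi>_1[OF uE] d(1) by simp
  ultimately obtain S Q where SQ: "open S" "mat 1 \<in> S" "openin M Q" "\<phi> u \<in> Q" "Q \<subseteq> E"
      "\<And>B y. B \<in> S \<inter> G \<Longrightarrow> y \<in> Q \<Longrightarrow> \<Phi> B y \<in> \<phi> ` ball u d"
    using \<Phi>_near[OF rotations_fixing_group(1) uE] by metis
  have eu: "e u \<bullet> e u = 1" using e1(1)[OF u] by (simp add: dot_square_norm)
  (* for directions near e u the rotation between them is small enough to keep the point in the chart *)
  have "\<forall>\<^sub>F q in nhds (e u) \<times>\<^sub>F nhds (e u). rotate_to (fst q) (snd q) \<in> S \<and> fst q \<bullet> snd q > 0"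
  proof (intro eventually_conj)
    have lim: "(fst \<longlongrightarrow> e u) (nhds (e u) \<times>\<^sub>F nhds (e u))" "(snd \<longlongrightarrow> e u) (nhds (e u) \<times>\<^sub>F nhds (e u))"
      by (simp_all add: filterlim_fst filterlim_snd)
    have "((\<lambda>q. rotate_to (fst q) (snd q)) \<longlongrightarrow> rotate_to (e u) (e u)) (nhds (e u) \<times>\<^sub>F nhds (e u))"
      using lim eu by (intro tendsto_rotate_to) auto
    then have "((\<lambda>q. rotate_to (fst q) (snd q)) \<longlongrightarrow> mat 1) (nhds (e u) \<times>\<^sub>F nhds (e u))"
      using rotate_to_same[OF e1(1)[OF u]] by simp
    then show "\<forall>\<^sub>F q in nhds (e u) \<times>\<^sub>F nhds (e u). rotate_to (fst q) (snd q) \<in> S"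
      using SQ(1,2) by (rule topological_tendstoD)
    have "((\<lambda>q. fst q \<bullet> snd q) \<longlongrightarrow> e u \<bullet> e u) (nhds (e u) \<times>\<^sub>F nhds (e u))"
      using lim by (rule tendsto_inner)
    then show "\<forall>\<^sub>F q in nhds (e u) \<times>\<^sub>F nhds (e u). fst q \<bullet> snd q > 0"
      using eu by (intro order_tendstoD) auto
  qed
  then obtain P1 P2 where P: "eventually P1 (nhds (e u))" "eventually P2 (nhds (e u))"
    "\<And>a b. P1 a \<Longrightarrow> P2 b \<Longrightarrow> rotate_to a b \<in> S \<and> a \<bullet> b > 0"
    unfolding eventually_prod_filter by force
  have "\<forall>\<^sub>F a in nhds (e u). P1 a \<and> P2 a" using P by (intro eventually_conj)
  then obtain O' where O': "open O'" "e u \<in> O'" "\<And>a. a \<in> O' \<Longrightarrow> P1 a \<and> P2 a" unfolding eventually_nhds by blast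
  have "open (ball u r \<inter> e -` O')" using conte O'(1) by (intro continuous_open_preimage) auto
  moreover have "open (ball u r \<inter> \<phi> -` Q)" using chart_preimage_open[OF c(1) SQ(3)] .
  ultimately have "open (ball u r \<inter> e -` O' \<inter> (ball u r \<inter> \<phi> -` Q) \<inter> ball u d)" by auto
  moreover have "u \<in> ball u r \<inter> e -` O' \<inter> (ball u r \<inter> \<phi> -` Q) \<inter> ball u d" using u O' SQ d by auto
  ultimately obtain \<eta> where \<eta>: "\<eta> > 0" "ball u \<eta> \<subseteq> ball u r \<inter> e -` O' \<inter> (ball u r \<inter> \<phi> -` Q) \<inter> ball u d"
    using open_contains_ball by blast
  show ?thesis
  proof (rule that[OF \<eta>(1)])
    show "ball u \<eta> \<subseteq> ball u r" using \<eta> by blast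
    fix v1 v2 assume v: "v1 \<in> ball u \<eta>" "v2 \<in> ball u \<eta>" "height (\<phi> v1) = height (\<phi> v2)"
    have v1: "v1 \<in> ball u r" "e v1 \<in> O'" "\<phi> v1 \<in> Q" and v2: "v2 \<in> ball u r" "e v2 \<in> O'" "v2 \<in> ball u d"
      using v(1,2) \<eta>(2) by auto
    define A where "A = rotate_to (e v1) (e v2)"
    have ab: "A \<in> S" "e v1 \<bullet> e v2 > 0" using P(3) O'(3) v1 v2 by (auto simp: A_def)
    have AG: "A \<in> G"
      unfolding A_def using e1[OF v1(1)] e1[OF v2(1)] ab(2) card_d card_n by (intro rotate_to_in_rotations) auto
    obtain v3 where v3: "v3 \<in> ball u d" "\<Phi> A (\<phi> v1) = \<phi> v3" using SQ(6) ab(1) AG v1(3) by blast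
    have E1: "\<phi> v1 \<in> E" using c(2) v1(1) by blast
    (* after the rotation, v3 has the height and the direction of v2 *)
    have X: "?F v - p = norm (I.X v) *\<^sub>R e v + ((?F v - p) \<bullet> \<nu>) *\<^sub>R \<nu>" if "v \<in> ball u r" for v
      using w0 that by (simp add: e_def I.X_def)
    have hp: "(?F v1 - p) \<bullet> \<nu> = (?F v2 - p) \<bullet> \<nu>" using v(3) by (simp add: inner_commute[of _ \<nu>] inner_diff_right)
    have "?F v3 = p + A *v (?F v1 - p)" using f_\<Phi>[OF AG E1] v3(2) by simp
    also have "?F v1 - p = norm (I.X v1) *\<^sub>R e v1 + ((?F v1 - p) \<bullet> \<nu>) *\<^sub>R \<nu>" by (rule X[OF v1(1)])
    also have "A *v \<dots> = norm (I.X v1) *\<^sub>R e v2 + ((?F v1 - p) \<bullet> \<nu>) *\<^sub>R \<nu>"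
    proof -
      have "A *v e v1 = e v2" unfolding A_def using e1[OF v1(1)] e1[OF v2(1)] ab(2) by (intro rotate_to_maps) auto
      moreover have "A *v \<nu> = \<nu>" using AG by (simp add: rotations_fixing_def)
      ultimately show ?thesis by (simp add: matrix_vector_right_distrib matrix_vector_mult_scaleR)
    qed
    finally have 3: "?F v3 - p = norm (I.X v1) *\<^sub>R e v2 + ((?F v2 - p) \<bullet> \<nu>) *\<^sub>R \<nu>" unfolding hp by simp
    have "?F v3 - ?F v2 = (?F v3 - p) - (?F v2 - p)" by simp
    also have "\<dots> = (norm (I.X v1) *\<^sub>R e v2 + ((?F v2 - p) \<bullet> \<nu>) *\<^sub>R \<nu>) - (norm (I.X v2) *\<^sub>R e v2 + ((?F v2 - p) \<bullet> \<nu>) *\<^sub>R \<nu>)"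
      unfolding 3 by (subst (2) X[OF v2(1)]) (rule refl)
    also have "\<dots> = (norm (I.X v1) - norm (I.X v2)) *\<^sub>R e v2" by (simp add: scaleR_diff_left)
    finally have "?F v3 - ?F v2 = (norm (I.X v1) - norm (I.X v2)) *\<^sub>R e v2" .
    then have "v3 = v2" using radial[OF v3(1) v2(3)] by blast
    then show "R (\<phi> v1) (\<phi> v2)" unfolding R_def using AG v3(2) by blast
  qed
qed

text \<open>A point where the height is not stationary is not a critical point, so the height takes both larger
  and smaller values nearby.\<close>

lemma height_open:
  assumes U: "openin M U" "U \<subseteq> E" and ns: "\<forall>x\<in>U. \<not> stationary x"
  shows "open (height ` U)"
proof (subst open_subopen, intro ballI)
  fix t assume "t \<in> height ` U"
  then obtain x where x: "x \<in> U" "t = height x" by blast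
  obtain u r \<phi> where c: "r > 0" "chart (ball u r) \<phi>" "\<phi> u = x" "\<phi> ` ball u r \<subseteq> U"
    by (rule chart_ball[OF x(1) U(1)])
  have cE: "\<phi> ` ball u r \<subseteq> E" using c(4) U(2) by blast
  interpret I: rotational_immersion "f \<circ> \<phi>" "ball u r" p \<nu> using chart_rotational[OF c(2) cE] .
  have u: "u \<in> ball u r" using c(1) by simp
  have "\<exists>b. \<nu> \<bullet> frechet_derivative (f \<circ> \<phi>) (at u) b \<noteq> 0"
  proof (rule ccontr)
    assume "\<not> ?thesis"
    then have "I.z i u = 0" for i by (simp add: I.z_def flip: I.DF_axis)
    then have "I.w u = 0" by (simp add: I.w_def)
    then have "\<forall>v\<in>ball u r. I.w v = 0" using I.horizontal_dichotomy u by auto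
    then obtain a where a: "\<And>v. v \<in> ball u r \<Longrightarrow> \<nu> \<bullet> (f \<circ> \<phi>) v = a"
      by (metis convex_ball I.height_constant)
    then have "stationary x"
      unfolding stationary_def using u c(3) chartD(4)[OF c(2)]
      by (intro exI[of _ "\<phi> ` ball u r"] exI[of _ a]) auto
    then show False using ns x by blast
  qed
  then obtain b where b: "\<nu> \<bullet> frechet_derivative (f \<circ> \<phi>) (at u) b > 0"
  proof -
    obtain b where "\<nu> \<bullet> frechet_derivative (f \<circ> \<phi>) (at u) b \<noteq> 0" using \<open>\<exists>b. _\<close> by blast
    moreover have "\<nu> \<bullet> frechet_derivative (f \<circ> \<phi>) (at u) (- b) = - (\<nu> \<bullet> frechet_derivative (f \<circ> \<phi>) (at u) b)"
      by (simp add: linear_neg[OF I.linear_DF[OF u]])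
    ultimately show ?thesis using that[of b] that[of "- b"] by linarith
  qed
  define \<phi>1 where "\<phi>1 s = height (\<phi> (u + s *\<^sub>R b))" for s
  define q where "q = r / (norm b + 1)"
  have q: "q > 0" using c(1) by (simp add: q_def add_nonneg_pos)
  have inb: "u + s *\<^sub>R b \<in> ball u r" if "\<bar>s\<bar> < q" for s
  proof -
    have "\<bar>s\<bar> * norm b \<le> \<bar>s\<bar> * (norm b + 1)" by (simp add: mult_left_mono)
    also have "\<dots> < r" using that by (simp add: q_def pos_less_divide_eq add_nonneg_pos)
    finally show ?thesis by (simp add: dist_norm)
  qed
  have 1: "((\<lambda>s. u + s *\<^sub>R b) has_derivative (\<lambda>s. s *\<^sub>R b)) (at 0)"
    by (auto intro!: derivative_eq_intros)
  have "(\<phi>1 has_derivative (\<lambda>s. \<nu> \<bullet> frechet_derivative (f \<circ> \<phi>) (at u) (s *\<^sub>R b))) (at 0)"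
    using has_derivative_compose[OF 1, of "\<lambda>x. \<nu> \<bullet> (f \<circ> \<phi>) x"] I.height_has_derivative[OF u] unfolding \<phi>1_def[abs_def] by simp
  then have der: "(\<phi>1 has_real_derivative (\<nu> \<bullet> frechet_derivative (f \<circ> \<phi>) (at u) b)) (at 0)"
    by (simp add: has_field_derivative_def linear_cmul[OF I.linear_DF[OF u]] mult_commute_abs)
  obtain s1 where s1: "s1 > 0" "\<And>s. 0 < s \<Longrightarrow> s < s1 \<Longrightarrow> \<phi>1 0 < \<phi>1 s" using DERIV_pos_inc_right[OF der b] by auto
  obtain s2 where s2: "s2 > 0" "\<And>s. 0 < s \<Longrightarrow> s < s2 \<Longrightarrow> \<phi>1 (- s) < \<phi>1 0" using DERIV_pos_inc_left[OF der b] by auto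
  define s where "s = min (min s1 s2) q / 2"
  have s: "0 < s" "s < s1" "s < s2" "s < q" using s1(1) s2(1) q by (auto simp: s_def)
  have img: "height ` (\<phi> ` ball u r) = (\<lambda>v. \<nu> \<bullet> (f \<circ> \<phi>) v) ` ball u r" by (auto simp: image_comp)
  have "connected (height ` (\<phi> ` ball u r))"
    unfolding img by (intro connected_continuous_image continuous_intros chartD(6)[OF c(2)]) simp
  moreover have "\<phi>1 s \<in> height ` (\<phi> ` ball u r)" "\<phi>1 (- s) \<in> height ` (\<phi> ` ball u r)"
    using inb[of s] inb[of "- s"] s by (auto simp: \<phi>1_def)
  ultimately have "{\<phi>1 (- s)..\<phi>1 s} \<subseteq> height ` (\<phi> ` ball u r)" by (intro connected_contains_Icc)
  moreover have "height ` (\<phi> ` ball u r) \<subseteq> height ` U" using c(4) by (intro image_mono)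
  moreover have "t \<in> {\<phi>1 (- s)<..<\<phi>1 s}" using s1(2)[of s] s2(2)[of s] s x(2) c(3) by (simp add: \<phi>1_def)
  ultimately show "\<exists>T. open T \<and> t \<in> T \<and> T \<subseteq> height ` U"
    by (intro exI[of _ "{\<phi>1 (- s)<..<\<phi>1 s}"]) (auto simp: subset_iff)
qed

text \<open>The orbit relation and the height satisfy the hypotheses of \<open>classes_distinguished_globally\<close> on a
  connected open piece of the end without stationary points.\<close>

lemma level_is_orbit:
  assumes W: "openin M W" "connectedin M W" "W \<subseteq> E" and ns: "\<forall>x\<in>W. \<not> stationary x"
    and ab: "a \<in> W" "b \<in> W" "height a = height b"
  shows "R a b"
proof -
  let ?X = "subtopology M W"
  have tX: "topspace ?X = W" using openin_subset[OF W(1)] by auto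
  have oX: "openin ?X U \<longleftrightarrow> openin M U \<and> U \<subseteq> W" for U
    using W(1) by (simp add: openin_open_subtopology)
  show ?thesis
  proof (rule classes_distinguished_globally[of ?X R height a b], unfold tX oX)
    show "connected_space ?X" using W(2) by (simp add: connectedin_def)
    show "R x x" if "x \<in> W" for x using R_refl W(3) that by blast
    show "R y x" if "x \<in> W" "y \<in> W" "R x y" for x y using R_sym W(3) that by blast
    show "R x w" if "x \<in> W" "y \<in> W" "w \<in> W" "R x y" "R y w" for x y w using R_trans W(3) that by blast
    show "height x = height y" if "x \<in> W" "y \<in> W" "R x y" for x y using height_R[of x y] W(3) that by auto
    show "openin M {y \<in> W. \<exists>x\<in>U. R x y} \<and> {y \<in> W. \<exists>x\<in>U. R x y} \<subseteq> W" if "openin M U \<and> U \<subseteq> W" for U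
    proof -
      have "openin M ({y \<in> E. \<exists>x\<in>U. R x y} \<inter> W)"
        by (intro openin_Int saturation_open W(1)) (use that W(3) in auto)
      moreover have "{y \<in> E. \<exists>x\<in>U. R x y} \<inter> W = {y \<in> W. \<exists>x\<in>U. R x y}" using W(3) by blast
      ultimately show ?thesis by auto
    qed
    show "\<exists>N1 N2. (openin M N1 \<and> N1 \<subseteq> W) \<and> (openin M N2 \<and> N2 \<subseteq> W) \<and> x \<in> N1 \<and> y \<in> N2 \<and> (\<forall>a\<in>N1. \<forall>b\<in>N2. \<not> R a b)"
      if xy: "x \<in> W" "y \<in> W" "\<not> R x y" for x y
    proof -
      have "x \<in> E" "y \<in> E" using xy W(3) by auto
      from orbits_separated[OF this xy(3)] obtain N1 N2 where N: "openin M N1" "openin M N2" "x \<in> N1" "y \<in> N2"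
        "\<forall>a\<in>N1. \<forall>b\<in>N2. \<not> R a b" by blast
      then show ?thesis using xy W(1) by (intro exI[of _ "N1 \<inter> W"] exI[of _ "N2 \<inter> W"]) auto
    qed
    show "\<exists>U. (openin M U \<and> U \<subseteq> W) \<and> x \<in> U \<and> connected (height ` U) \<and> (\<forall>a\<in>U. \<forall>b\<in>U. height a = height b \<longrightarrow> R a b)"
      if x: "x \<in> W" for x
    proof -
      obtain u r \<phi> where c: "r > 0" "chart (ball u r) \<phi>" "\<phi> u = x" "\<phi> ` ball u r \<subseteq> W"
        by (rule chart_ball[OF x W(1)])
      have cE: "\<phi> ` ball u r \<subseteq> E" using c(4) W(3) by blast
      have "\<not> stationary (\<phi> u)" using ns x c(3) by simp
      then obtain \<eta> where \<eta>: "\<eta> > 0" "ball u \<eta> \<subseteq> ball u r"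
        "\<And>v1 v2. v1 \<in> ball u \<eta> \<Longrightarrow> v2 \<in> ball u \<eta> \<Longrightarrow> height (\<phi> v1) = height (\<phi> v2) \<Longrightarrow> R (\<phi> v1) (\<phi> v2)"
        using equal_height_same_orbit[OF c(1,2) cE] by metis
      have img: "height ` (\<phi> ` ball u \<eta>) = (\<lambda>v. \<nu> \<bullet> (f \<circ> \<phi>) v) ` ball u \<eta>" by (auto simp: image_comp)
      have "connected (height ` (\<phi> ` ball u \<eta>))"
        unfolding img using continuous_on_subset[OF chartD(6)[OF c(2)] \<eta>(2)]
        by (intro connected_continuous_image continuous_intros) simp_all
      moreover have "openin M (\<phi> ` ball u \<eta>)" using chartD(5)[OF c(2) _ \<eta>(2)] by simp
      moreover have "\<phi> ` ball u \<eta> \<subseteq> W" using c(4) \<eta>(2) by blast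
      moreover have "x \<in> \<phi> ` ball u \<eta>" using c(3) \<eta>(1) by auto
      moreover have "\<forall>a\<in>\<phi> ` ball u \<eta>. \<forall>b\<in>\<phi> ` ball u \<eta>. height a = height b \<longrightarrow> R a b" using \<eta>(3) by auto
      ultimately show ?thesis by (intro exI[of _ "\<phi> ` ball u \<eta>"]) simp
    qed
    show "open (height ` U)" if "openin M U \<and> U \<subseteq> W" for U
      by (rule height_open) (use that W(3) ns in auto)
  qed (use ab in auto)
qed

lemma sublevel_not_compact:
  assumes "compactin M {x \<in> topspace M. height x \<le> c}" "a \<in> topspace M" "height a < c"
  shows False
  using superlevel_not_compact[where l = "- \<nu>" and c = "- c" and a = a] assms by simp

lemma closed_levels:
  "closedin M {x \<in> topspace M. height x \<ge> c}" "closedin M {x \<in> topspace M. height x \<le> c}"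
proof -
  have "closedin M {x \<in> topspace M. f x \<in> {X. \<nu> \<bullet> X \<ge> c}}" "closedin M {x \<in> topspace M. f x \<in> {X. \<nu> \<bullet> X \<le> c}}"
    by (intro closedin_continuous_map_preimage[OF continuous_f]; simp add: closed_halfspace_ge closed_halfspace_le)+
  then show "closedin M {x \<in> topspace M. height x \<ge> c}" "closedin M {x \<in> topspace M. height x \<le> c}" by simp_all
qed

text \<open>If the height is constant on the end, levels above and below that constant bound compact sets. If it
  is nowhere stationary there, then the orbit of a point \<open>x\<close> of the end is the whole level of \<open>x\<close> in the
  end. The end that remains after its removal avoids this level, hence lies on one side of it; the
  compact rest contains all points of the other side, and there are such points because the height is
  open.\<close>

theorem height_constant_on_M:
  assumes one: "one_ended M" shows "\<exists>c. \<forall>x\<in>topspace M. height x = c"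
proof -
  obtain W where W: "openin M W" "connectedin M W" "W \<subseteq> E" "W \<noteq> {}" "compactin M (topspace M - W)"
    and uniq: "\<And>D. D \<in> connected_components_of (subtopology M E) \<Longrightarrow> \<not> compactin M (M closure_of D) \<Longrightarrow> D = W"
    by (rule end_complement_compact[OF one compact_K]) blast
  show ?thesis
  proof (cases "\<forall>x\<in>W. stationary x")
    case True
    obtain x0 where x0: "x0 \<in> W" using W(4) by blast
    have cW: "height x = height x0" if "x \<in> W" for x
      using stationary_constant[OF W(1,2) True that x0] .
    have "height x = height x0" if x: "x \<in> topspace M" for x
    proof (rule ccontr)
      assume "height x \<noteq> height x0"
      then consider "height x > height x0" | "height x < height x0" by linarith
      then show False
      proof cases
        case 1
        let ?c = "(height x + height x0) / 2"
        have "{x \<in> topspace M. height x \<ge> ?c} \<subseteq> topspace M - W" using cW 1 by force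
        then have "compactin M {x \<in> topspace M. height x \<ge> ?c}"
          using closed_compactin[OF W(5) _ closed_levels(1)] by blast
        then show False using superlevel_not_compact[where l = \<nu> and c = ?c and a = x] x 1 by simp
      next
        case 2
        let ?c = "(height x + height x0) / 2"
        have "{x \<in> topspace M. height x \<le> ?c} \<subseteq> topspace M - W" using cW 2 by force
        then have "compactin M {x \<in> topspace M. height x \<le> ?c}"
          using closed_compactin[OF W(5) _ closed_levels(2)] by blast
        then show False using sublevel_not_compact[of ?c x] x 2 by simp
      qed
    qed
    then show ?thesis by blast
  next
    case False
    then have ns: "\<forall>x\<in>W. \<not> stationary x" using stationary_dichotomy[OF W(1-3)] by blast
    obtain x where x: "x \<in> W" using W(4) by blast
    have xE: "x \<in> E" using x W(3) by blast
    define c where "c = height x"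
    define Orb where "Orb = (\<lambda>A. \<Phi> A x) ` G"
    (* Q is the end after the removal of the orbit; it is contained in W since it is connected and
       not relatively compact *)
    have K': "compactin M (K \<union> Orb)" using compact_K compact_orbit[OF xE] by (simp add: compactin_Un Orb_def)
    obtain Q where Q: "openin M Q" "connectedin M Q" "Q \<subseteq> topspace M - (K \<union> Orb)" "Q \<noteq> {}"
        "compactin M (topspace M - Q)" "\<not> compactin M (M closure_of Q)"
      by (rule end_complement_compact[OF one K']) blast
    have "Q \<subseteq> W"
    proof -
      have Qc: "connectedin (subtopology M E) Q" using Q by (auto simp: connectedin_subtopology)
      have "subtopology M E \<noteq> trivial_topology"
        using connectedin_subset_topspace[OF Qc] Q(4) by (metis null_topspace_iff_trivial subset_empty)
      with Qc obtain D where D: "D \<in> connected_components_of (subtopology M E)" "Q \<subseteq> D"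
        using exists_connected_component_of_superset[of "subtopology M E" Q] by auto
      have "M closure_of Q \<subseteq> M closure_of D" using D(2) by (rule closure_of_mono)
      then have "\<not> compactin M (M closure_of D)"
        using Q(6) closed_compactin[of M "M closure_of D" "M closure_of Q"] closedin_closure_of[of M Q] by blast
      then show ?thesis using uniq[OF D(1)] D(2) by simp
    qed
    have avoid: "height y \<noteq> c" if "y \<in> Q" for y
    proof
      assume "height y = c"
      then have "R x y" using level_is_orbit[OF W(1-3) ns x] that \<open>Q \<subseteq> W\<close> by (auto simp: c_def)
      then show False using that Q(3) by (auto simp: R_def Orb_def)
    qed
    have side: "(\<forall>y\<in>Q. height y > c) \<or> (\<forall>y\<in>Q. height y < c)"
    proof (rule ccontr)
      assume "\<not> ?thesis"
      then obtain y1 y2 where y: "y1 \<in> Q" "y2 \<in> Q" "height y1 < c" "height y2 > c"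
        using avoid by (metis linorder_neqE_linordered_idom)
      have "continuous_map M euclideanreal height"
        using continuous_map_compose[OF continuous_f, of euclideanreal "\<lambda>X. \<nu> \<bullet> X"]
        by (simp add: comp_def continuous_on_inner)
      then have "connected (height ` Q)"
        using connectedin_continuous_map_image[OF _ Q(2)] connectedin_iff_connected by blast
      then have "c \<in> height ` Q" using y connected_contains_Icc[of "height ` Q" "height y1" "height y2"] by force
      then show False using avoid by auto
    qed
    have oW: "open (height ` W)" using height_open[OF W(1,3) ns] .
    moreover have "c \<in> height ` W" using x by (auto simp: c_def)
    ultimately obtain e where e: "e > 0" "ball c e \<subseteq> height ` W" using open_contains_ball by blast
    have "c + e/2 \<in> height ` W" "c - e/2 \<in> height ` W" using e by (auto simp: dist_real_def subset_iff)
    then obtain a1 a2 where a: "a1 \<in> W" "height a1 > c" "a2 \<in> W" "height a2 < c" using e(1) by auto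
    have aM: "a1 \<in> topspace M" "a2 \<in> topspace M" using a openin_subset[OF W(1)] by auto
    from side show ?thesis
    proof
      assume "\<forall>y\<in>Q. height y > c"
      then have "{x \<in> topspace M. height x \<le> c} \<subseteq> topspace M - Q" by force
      then have "compactin M {x \<in> topspace M. height x \<le> c}" using closed_compactin[OF Q(5) _ closed_levels(2)] by blast
      then show ?thesis using sublevel_not_compact aM a by blast
    next
      assume "\<forall>y\<in>Q. height y < c"
      then have "{x \<in> topspace M. height x \<ge> c} \<subseteq> topspace M - Q" by force
      then have "compactin M {x \<in> topspace M. height x \<ge> c}" using closed_compactin[OF Q(5) _ closed_levels(1)] by blast
      then show ?thesis using superlevel_not_compact aM a by blast
    qed
  qed
qed

end

section \<open>Schwarzschild ends\<close>

lemma schwarzschild_radius_power: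
  assumes m: "m > 0" and n: "n \<ge> 3"
  shows "schwarzschild_radius n m > 0" "schwarzschild_radius n m ^ (n - 2) = 2 * m"
proof -
  show pos: "schwarzschild_radius n m > 0" using m by (simp add: schwarzschild_radius_def)
  have "schwarzschild_radius n m ^ (n - 2) = schwarzschild_radius n m powr real (n - 2)"
    using pos by (rule powr_realpow[symmetric])
  also have "\<dots> = (2 * m) powr 1" using n by (simp add: schwarzschild_radius_def powr_powr)
  finally show "schwarzschild_radius n m ^ (n - 2) = 2 * m" using m by simp
qed

text \<open>The integrand has an inverse square root singularity at the horizon and is dominated by the
  corresponding multiple of \<open>1 / sqrt (s - r0)\<close>. Without integrability the height function would
  degenerate to a constant.\<close>

lemma schwarzschild_integrable:
  assumes m: "m > 0" and n: "n \<ge> 3"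
  shows "(\<lambda>s. sqrt (2 * m / (s ^ (n - 2) - 2 * m))) integrable_on {schwarzschild_radius n m..b}"
proof -
  define r0 where "r0 = schwarzschild_radius n m"
  obtain k where k: "n - 2 = Suc k" using n by (cases "n - 2") auto
  have r0: "r0 > 0" and r0k: "r0 ^ Suc k = 2 * m"
    using schwarzschild_radius_power[OF m n] k by (simp_all add: r0_def)
  define c where "c = sqrt (2 * m / r0 ^ k)"
  have c: "c \<ge> 0" using m r0 by (simp add: c_def)
  have dom: "(\<lambda>s. c / sqrt (s - r0)) integrable_on {r0..b}"
  proof (cases "r0 \<le> b")
    case True
    have "((\<lambda>s. c / sqrt (s - r0)) has_integral (2 * c * sqrt (b - r0) - 2 * c * sqrt (r0 - r0))) {r0..b}"
    proof (rule fundamental_theorem_of_calculus_interior[OF True])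
      show "continuous_on {r0..b} (\<lambda>s. 2 * c * sqrt (s - r0))" by (intro continuous_intros)
      fix s assume s: "s \<in> {r0<..<b}"
      have "((\<lambda>s. 2 * c * sqrt (s - r0)) has_real_derivative c / sqrt (s - r0)) (at s)"
      proof -
        have a: "((\<lambda>s. s - r0) has_real_derivative 1) (at s)"
          by (auto intro!: derivative_eq_intros)
        have b: "(sqrt has_real_derivative inverse (sqrt (s - r0)) / 2) (at (s - r0))"
          using s by (intro DERIV_real_sqrt) simp
        have "2 * c * (inverse x / 2 * 1) = c / x" for x :: real by (simp add: inverse_eq_divide)
        then show ?thesis
          using DERIV_cmult[OF DERIV_chain2[of sqrt _ "\<lambda>s. s - r0", OF b a], of "2 * c"] by (simp only:)
      qed
      then show "((\<lambda>s. 2 * c * sqrt (s - r0)) has_vector_derivative c / sqrt (s - r0)) (at s)"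
        by (simp add: has_real_derivative_iff_has_vector_derivative)
    qed
    then show ?thesis by blast
  qed (simp add: integrable_on_empty)
  have "(\<lambda>s. sqrt (2 * m / (s ^ Suc k - 2 * m))) integrable_on {r0..b}"
  proof (rule measurable_bounded_by_integrable_imp_integrable[OF _ dom])
    have "(\<lambda>s. sqrt (2 * m / (s ^ Suc k - 2 * m))) \<in> borel_measurable lborel" by measurable
    then show "(\<lambda>s. sqrt (2 * m / (s ^ Suc k - 2 * m))) \<in> borel_measurable (lebesgue_on {r0..b})"
      by (intro measurable_restrict_space1 measurable_completion)
    show "{r0..b} \<in> sets lebesgue" by simp
    fix s assume s: "s \<in> {r0..b}"
    show "norm (sqrt (2 * m / (s ^ Suc k - 2 * m))) \<le> c / sqrt (s - r0)"
    proof (cases "s = r0")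
      case True
      then show ?thesis using r0k by simp
    next
      case False
      then have sr: "s > r0" using s by simp
      have "r0 ^ k * (s - r0) \<le> s ^ k * (s - r0)" using sr r0 by (intro mult_right_mono power_mono) auto
      also have "s ^ k * (s - r0) = s ^ Suc k - r0 * s ^ k" by (simp add: algebra_simps)
      also have "\<dots> \<le> s ^ Suc k - r0 * r0 ^ k" using sr r0 by (simp add: power_mono)
      finally have le: "r0 ^ k * (s - r0) \<le> s ^ Suc k - 2 * m" using r0k by simp
      have pos: "r0 ^ k * (s - r0) > 0" using r0 sr by simp
      have "2 * m / (s ^ Suc k - 2 * m) \<le> 2 * m / (r0 ^ k * (s - r0))"
        using le pos m by (intro divide_left_mono) auto
      then have "sqrt (2 * m / (s ^ Suc k - 2 * m)) \<le> sqrt (2 * m / r0 ^ k / (s - r0))"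
        by (simp add: divide_divide_eq_left)
      also have "\<dots> = c / sqrt (s - r0)" by (simp only: c_def real_sqrt_divide)
      finally show ?thesis using le pos m by simp
    qed
  qed
  then show ?thesis by (simp only: k r0_def[symmetric])
qed

lemma schwarzschild_height_strict_mono:
  assumes m: "m > 0" and n: "n \<ge> 3" and a: "schwarzschild_radius n m < a" "a < b"
  shows "schwarzschild_height n m C a < schwarzschild_height n m C b"
proof -
  let ?g = "\<lambda>s. sqrt (2 * m / (s ^ (n - 2) - 2 * m))"
  define r0 where "r0 = schwarzschild_radius n m"
  have r0: "r0 > 0" and r0k: "r0 ^ (n - 2) = 2 * m"
    using schwarzschild_radius_power[OF m n] by (simp_all add: r0_def)
  have int: "?g integrable_on {r0..b}" unfolding r0_def by (rule schwarzschild_integrable[OF m n])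
  have int2: "?g integrable_on {a..b}"
    by (rule integrable_on_subinterval[OF int]) (use a in \<open>auto simp: r0_def\<close>)
  have split: "integral {r0..b} ?g = integral {r0..a} ?g + integral {a..b} ?g"
    using Henstock_Kurzweil_Integration.integral_combine[OF _ _ int, of a] a by (simp add: r0_def)
  have pos: "s ^ (n - 2) - 2 * m > 0" if "s \<ge> a" for s
  proof -
    have "r0 ^ (n - 2) < s ^ (n - 2)" using that a r0 n by (intro power_strict_mono) (auto simp: r0_def)
    then show ?thesis using r0k by simp
  qed
  have "?g b \<le> ?g s" if "s \<in> {a..b}" for s
  proof -
    have "s ^ (n - 2) \<le> b ^ (n - 2)" using that a r0 by (intro power_mono) (auto simp: r0_def)
    then show ?thesis using pos[of s] pos[of b] that m by (intro real_sqrt_le_mono divide_left_mono) auto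
  qed
  then have "integral {a..b} (\<lambda>s. ?g b) \<le> integral {a..b} ?g"
    by (intro integral_le int2) auto
  then have "(b - a) * ?g b \<le> integral {a..b} ?g" using a by simp
  moreover have "(b - a) * ?g b > 0" using pos[of b] a m by simp
  ultimately show ?thesis using split by (simp add: schwarzschild_height_def r0_def)
qed

text \<open>Coordinates of the hyperplane in \<open>real^'n\<close>: \<open>A\<close> embeds isometrically and \<open>B\<close> recovers the
  coordinates.\<close>

lemma hyperplane_isometry:
  assumes \<nu>: "\<nu> \<noteq> (0 :: real^'d)" and d: "CARD('d) = CARD('n::finite) + 1"
  obtains A :: "real^'n \<Rightarrow> real^'d" and B :: "real^'d \<Rightarrow> real^'n" where
    "linear A" "linear B" "\<And>w. norm (A w) = norm w" "\<And>w. B (A w) = w"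
    "range A = {y. y \<bullet> \<nu> = 0}" "\<And>y. y \<bullet> \<nu> = 0 \<Longrightarrow> A (B y) = y"
proof -
  have sub: "subspace {y :: real^'d. y \<bullet> \<nu> = 0}"
    using subspace_hyperplane[of \<nu>] by (simp add: inner_commute)
  have "dim {y :: real^'d. y \<bullet> \<nu> = 0} = CARD('d) - 1"
    using dim_hyperplane[OF \<nu>] by (simp add: inner_commute)
  then have "dim (UNIV :: (real^'n) set) = dim {y :: real^'d. y \<bullet> \<nu> = 0}" using d by simp
  then obtain A :: "real^'n \<Rightarrow> real^'d" where A: "linear A" "A ` UNIV = {y. y \<bullet> \<nu> = 0}" "\<And>x. x \<in> UNIV \<Longrightarrow> norm (A x) = norm x"
    using isometry_subspaces[OF subspace_UNIV sub] by metis
  have "inj A" using A by (simp add: linear_injective_0) (metis norm_eq_zero)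
  then obtain B where B: "linear B" "B \<circ> A = id" using linear_injective_left_inverse[OF A(1)] by blast
  have BA: "B (A w) = w" for w using B(2) by (metis comp_apply id_apply)
  moreover have "A (B y) = y" if "y \<bullet> \<nu> = 0" for y
  proof -
    have "y \<in> range A" using that A(2) by simp
    then show ?thesis using BA by auto
  qed
  ultimately show ?thesis using that[of A B] A B by auto
qed

context scalar_flat_hypersurface begin

text \<open>Outside a large sphere the graph is connected and not relatively compact, so it is the end and the
  rest of the hypersurface is compact. The end lies above the height of that sphere, and points of the
  graph slightly inside the sphere lie below it.\<close>

theorem no_schwarzschild_end:
  assumes one: "one_ended M" and m: "m > 0" and S: "schwarzschild_outside_compact CARD('n) m M f"
  shows False
proof -
  obtain p \<nu> K C0 where \<nu>: "norm \<nu> = 1" and K: "compact K" "K \<subseteq> hyperplane p \<nu>"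
    and Kball: "hyperplane p \<nu> \<inter> ball p (schwarzschild_radius CARD('n) m) \<subseteq> K"
    and injE: "inj_on f {x \<in> topspace M. f x - ((f x - p) \<bullet> \<nu>) *\<^sub>R \<nu> \<notin> K}"
    and imE: "f ` {x \<in> topspace M. f x - ((f x - p) \<bullet> \<nu>) *\<^sub>R \<nu> \<notin> K} =
        {y + schwarzschild_height CARD('n) m C0 (norm (y - p)) *\<^sub>R \<nu> |y. y \<in> hyperplane p \<nu> - K}"
    using S unfolding schwarzschild_outside_compact_def Let_def by auto
  define r0 where "r0 = schwarzschild_radius CARD('n) m"
  define h where "h = schwarzschild_height CARD('n) m C0"
  define pr where "pr y = y - ((y - p) \<bullet> \<nu>) *\<^sub>R \<nu>" for y
  define E where "E = {x \<in> topspace M. pr (f x) \<notin> K}"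
  have \<nu>\<nu>: "\<nu> \<bullet> \<nu> = 1" "\<nu> \<noteq> 0" using \<nu> by (auto simp: dot_square_norm)
  have pr_h: "(pr y - p) \<bullet> \<nu> = 0" for y by (simp add: pr_def inner_diff_left \<nu>\<nu>)
  have injE: "inj_on f E" using injE by (simp add: E_def pr_def)
  have imE: "f ` E = {y + h (norm (y - p)) *\<^sub>R \<nu> |y. y \<in> hyperplane p \<nu> - K}"
    using imE by (simp add: E_def pr_def h_def)
  have graph: "f x = pr (f x) + h (norm (pr (f x) - p)) *\<^sub>R \<nu>" if "x \<in> E" for x
  proof -
    have "f x \<in> f ` E" using that by blast
    then obtain y where y: "f x = y + h (norm (y - p)) *\<^sub>R \<nu>" "(y - p) \<bullet> \<nu> = 0"
      unfolding imE hyperplane_def by blast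
    have "(f x - p) \<bullet> \<nu> = h (norm (y - p))"
      using y by (simp add: inner_add_left inner_diff_left \<nu>\<nu>)
    then have "pr (f x) = y" using y(1) by (simp add: pr_def)
    then show ?thesis using y(1) by simp
  qed
  have height: "\<nu> \<bullet> f x = \<nu> \<bullet> p + h (norm (pr (f x) - p))" if "x \<in> E" for x
  proof -
    have "\<nu> \<bullet> f x = \<nu> \<bullet> pr (f x) + h (norm (pr (f x) - p))"
      using arg_cong[OF graph[OF that], of "inner \<nu>"] by (simp add: inner_add_right \<nu>\<nu>)
    moreover have "\<nu> \<bullet> pr (f x) = \<nu> \<bullet> p" using pr_h[of "f x"] by (simp add: inner_diff_right inner_commute[of _ \<nu>])
    ultimately show ?thesis by simp
  qed
  obtain A :: "real^'n \<Rightarrow> real^'d" and B where A: "linear A" "linear B" "\<And>w. norm (A w) = norm w" "\<And>w. B (A w) = w"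
    "range A = {y. y \<bullet> \<nu> = 0}" "\<And>y. y \<bullet> \<nu> = 0 \<Longrightarrow> A (B y) = y"
    by (rule hyperplane_isometry[OF \<nu>\<nu>(2) card_d]) blast
  have A\<nu>: "A w \<bullet> \<nu> = 0" for w using A(5) by auto
  (* q gives the coordinates of the orthogonal projection; it identifies E with the domain of the graph *)
  define q where "q x = B (pr (f x) - p)" for x
  have Aq: "A (q x) = pr (f x) - p" for x using A(6)[OF pr_h] by (simp add: q_def)
  have nq: "norm (q x) = norm (pr (f x) - p)" for x using A(3)[of "q x"] by (simp add: Aq)
  have linB: "bounded_linear B" using A(2) linear_conv_bounded_linear by blast
  have cont_q: "continuous_map M euclidean q"
  proof -
    have "continuous_on UNIV (\<lambda>y. B (pr y - p))"
      unfolding pr_def by (intro bounded_linear.continuous_on[OF linB] continuous_intros)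
    then have "continuous_map euclidean euclidean (\<lambda>y. B (pr y - p))" by simp
    from continuous_map_compose[OF continuous_f this] show ?thesis by (simp add: comp_def q_def[abs_def])
  qed
  define \<Omega> where "\<Omega> = {w. p + A w \<notin> K}"
  have \<Omega>: "open \<Omega>"
  proof -
    have linA: "bounded_linear A" using A(1) linear_conv_bounded_linear by blast
    have "continuous_on UNIV (\<lambda>w. p + A w)" by (intro continuous_intros bounded_linear.continuous_on[OF linA])
    then have "open ((\<lambda>w. p + A w) -` (- K))" using K(1) by (intro open_vimage) (auto simp: compact_imp_closed open_Compl)
    then show ?thesis by (simp add: \<Omega>_def vimage_def)
  qed
  have E_q: "x \<in> E \<longleftrightarrow> x \<in> topspace M \<and> q x \<in> \<Omega>" for x
    by (simp add: E_def \<Omega>_def Aq)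
  have openE: "openin M E"
  proof -
    have "openin M {x \<in> topspace M. q x \<in> \<Omega>}" using openin_continuous_map_preimage[OF cont_q] \<Omega> by simp
    moreover have "E = {x \<in> topspace M. q x \<in> \<Omega>}" using E_q by auto
    ultimately show ?thesis by simp
  qed
  have inj_q: "inj_on q E"
  proof (rule inj_onI)
    fix x y assume xy: "x \<in> E" "y \<in> E" "q x = q y"
    then have "pr (f x) = pr (f y)" using Aq[of x] Aq[of y] by simp
    then have "f x = f y" using graph[OF xy(1)] graph[OF xy(2)] by simp
    then show "x = y" using injE xy by (simp add: inj_on_def)
  qed
  have surj_q: "\<exists>x\<in>E. q x = w" if "w \<in> \<Omega>" for w
  proof -
    have "p + A w \<in> hyperplane p \<nu> - K" using that A\<nu> by (simp add: hyperplane_def \<Omega>_def)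
    then have "p + A w + h (norm (A w)) *\<^sub>R \<nu> \<in> f ` E" unfolding imE by force
    then obtain x where x: "x \<in> E" "f x = p + A w + h (norm (A w)) *\<^sub>R \<nu>" by auto
    have "pr (f x) = p + A w" using x(2) A\<nu>[of w] by (simp add: pr_def inner_add_left \<nu>\<nu>)
    then show ?thesis using x(1) A(4) by (intro bexI[of _ x]) (simp_all add: q_def)
  qed
  define s where "s = inv_into E q"
  have sE: "s w \<in> E" "q (s w) = w" if "w \<in> \<Omega>" for w
    using surj_q[OF that] unfolding s_def by (auto intro: inv_into_into f_inv_into_f)
  have sq: "s (q x) = x" if "x \<in> E" for x unfolding s_def using inj_q that by simp
  have cont_s: "continuous_map (top_of_set \<Omega>) M s"
    unfolding s_def using surj_q by (intro continuous_inv_into cont_q inj_q openE \<Omega>) blast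
  obtain b where b: "b > 0" "\<And>y. y \<in> K \<Longrightarrow> norm (y - p) < b"
  proof -
    have "bounded ((\<lambda>y. y - p) ` K)" using K(1) compact_imp_bounded bounded_minus_comp
      by (metis bounded_translation_minus)
    then obtain b where "b > 0" "\<And>y. y \<in> K \<Longrightarrow> norm (y - p) < b" unfolding bounded_pos_less by auto
    then show ?thesis using that by blast
  qed
  (* the graph is defined outside radius R1; the end is cut off at R, so that the radius R1 is left
     over for a point of the graph below it *)
  define R1 where "R1 = max b (r0 + 1)"
  define R where "R = R1 + 1"
  have R: "r0 < R1" "R1 < R" "R1 > 0" "b \<le> R1" using b by (auto simp: R1_def R_def)
  have big: "w \<in> \<Omega>" if "norm w \<ge> R1" for w
  proof -
    have "p + A w \<notin> K" using b(2)[of "p + A w"] that R(4) A(3) by fastforce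
    then show ?thesis by (simp add: \<Omega>_def)
  qed
  define Out where "Out = {x \<in> topspace M. norm (q x) > R}"
  define Sph where "Sph = {x \<in> topspace M. norm (q x) = R}"
  have inE: "x \<in> E" if "x \<in> topspace M" "norm (q x) \<ge> R1" for x using E_q big that by blast
  have Sph: "compactin M Sph"
  proof -
    have "compactin (top_of_set \<Omega>) (sphere 0 R)" using big R(2) by (auto simp: compactin_subtopology)
    then have "compactin M (s ` sphere 0 R)" using image_compactin cont_s by blast
    moreover have "s ` sphere 0 R = Sph"
    proof
      show "s ` sphere 0 R \<subseteq> Sph" using big R(2) sE E_q by (auto simp: Sph_def)
      show "Sph \<subseteq> s ` sphere 0 R"
      proof
        fix x assume x: "x \<in> Sph"
        then have "s (q x) = x" using sq[OF inE] R(2) by (auto simp: Sph_def)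
        moreover have "q x \<in> sphere 0 R" using x by (simp add: Sph_def)
        ultimately show "x \<in> s ` sphere 0 R" by (metis imageI)
      qed
    qed
    ultimately show ?thesis by simp
  qed
  have norm_q: "continuous_map M euclideanreal (\<lambda>x. norm (q x))"
    using cont_q by (rule continuous_map_norm)
  have openOut: "openin M Out" "openin M {x \<in> topspace M. norm (q x) < R}"
    using openin_continuous_map_preimage[OF norm_q, of "{R<..}"] openin_continuous_map_preimage[OF norm_q, of "{..<R}"]
    by (simp_all add: Out_def)
  have connOut: "connectedin M Out"
  proof -
    have "connected (- cball (0::real^'n) R)" using card_n by (intro connected_complement_bounded_convex) auto
    then have "connectedin (top_of_set \<Omega>) (- cball 0 R)" using big R(2) by (auto simp: connectedin_subtopology)
    then have "connectedin M (s ` (- cball 0 R))" using connectedin_continuous_map_image[OF cont_s] by blast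
    moreover have "s ` (- cball 0 R) = Out"
    proof
      show "s ` (- cball 0 R) \<subseteq> Out" using big R(2) sE E_q by (auto simp: Out_def)
      show "Out \<subseteq> s ` (- cball 0 R)"
      proof
        fix x assume x: "x \<in> Out"
        then have "s (q x) = x" using sq[OF inE] R(2) by (auto simp: Out_def)
        moreover have "q x \<in> - cball 0 R" using x by (simp add: Out_def)
        ultimately show "x \<in> s ` (- cball 0 R)" by (metis imageI)
      qed
    qed
    ultimately show ?thesis by simp
  qed
  have noncompact: "\<not> compactin M (M closure_of Out)"
  proof
    assume "compactin M (M closure_of Out)"
    then have "compact (q ` (M closure_of Out))" using image_compactin[OF _ cont_q] by simp
    then have "bounded (q ` (M closure_of Out))" by (rule compact_imp_bounded)
    then obtain b' where "\<forall>y\<in>q ` (M closure_of Out). norm y \<le> b'" unfolding bounded_iff ..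
    then have B: "norm (q x) \<le> b'" if "x \<in> M closure_of Out" for x using that by simp
    define w :: "real^'n" where "w = (max b' R + 1) *\<^sub>R axis undefined 1"
    have nw: "norm w = max b' R + 1" using R by (simp add: w_def)
    then have w\<Omega>: "w \<in> \<Omega>" using big R by simp
    have "s w \<in> Out" using sE[OF w\<Omega>] E_q nw by (simp add: Out_def)
    moreover have "Out \<subseteq> M closure_of Out" by (rule closure_of_subset) (auto simp: Out_def)
    ultimately have "s w \<in> M closure_of Out" by blast
    then have "norm (q (s w)) \<le> b'" by (rule B)
    then show False unfolding sE(2)[OF w\<Omega>] nw by linarith
  qed
  obtain C where C: "compactin M (topspace M - C)"
    and uniq: "\<And>D. D \<in> connected_components_of (subtopology M (topspace M - Sph)) \<Longrightarrow>
       \<not> compactin M (M closure_of D) \<Longrightarrow> D = C"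
    by (rule end_complement_compact[OF one Sph]) blast
  have OutSph: "Out \<subseteq> topspace M - Sph" by (auto simp: Out_def Sph_def)
  have cO: "connectedin (subtopology M (topspace M - Sph)) Out"
    using connOut OutSph by (simp add: connectedin_subtopology)
  obtain x0 where x0: "x0 \<in> Out"
    using noncompact by (metis closure_of_empty compactin_empty ex_in_conv)
  have "subtopology M (topspace M - Sph) \<noteq> trivial_topology"
    using connectedin_subset_topspace[OF cO] x0 by (metis empty_iff null_topspace_iff_trivial subsetD)
  with cO obtain D where D: "D \<in> connected_components_of (subtopology M (topspace M - Sph))" "Out \<subseteq> D"
    using exists_connected_component_of_superset[of "subtopology M (topspace M - Sph)" Out] by auto
  have "D \<subseteq> Out"
  proof (rule ccontr)
    assume n: "\<not> D \<subseteq> Out"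
    have "connectedin M D" using connectedin_connected_components_of[OF D(1)] by (simp add: connectedin_subtopology)
    moreover have Dsub: "D \<subseteq> topspace M - Sph" using connected_components_of_subset[OF D(1)] by auto
    moreover have "D \<subseteq> Out \<union> {x \<in> topspace M. norm (q x) < R}" using Dsub by (auto simp: Out_def Sph_def)
    moreover have "Out \<inter> {x \<in> topspace M. norm (q x) < R} \<inter> D = {}" by (auto simp: Out_def)
    moreover have "Out \<inter> D \<noteq> {}" using x0 D(2) by blast
    moreover have "{x \<in> topspace M. norm (q x) < R} \<inter> D \<noteq> {}" using n calculation(3) by blast
    ultimately show False using openOut unfolding connectedin by metis
  qed
  then have "D = Out" using D(2) by blast
  then have "Out = C" using uniq D noncompact by blast
  then have comp: "compactin M (topspace M - Out)" using C by simp
  have mono: "h a < h c" if "r0 < a" "a < c" for a c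
    unfolding h_def using schwarzschild_height_strict_mono[OF m card_n] that by (simp add: r0_def)
  define c where "c = \<nu> \<bullet> p + h R"
  have "{x \<in> topspace M. (- \<nu>) \<bullet> f x \<ge> - c} \<subseteq> topspace M - Out"
  proof
    fix x assume x: "x \<in> {x \<in> topspace M. (- \<nu>) \<bullet> f x \<ge> - c}"
    have "x \<notin> Out"
    proof
      assume o: "x \<in> Out"
      then have "x \<in> E" "R < norm (q x)" using inE R(2) by (auto simp: Out_def)
      then have "\<nu> \<bullet> f x > c" using height mono[of R "norm (q x)"] R(1,2) by (simp add: c_def nq)
      then show False using x by simp
    qed
    then show "x \<in> topspace M - Out" using x by simp
  qed
  moreover have "closedin M {x \<in> topspace M. f x \<in> {X. (- \<nu>) \<bullet> X \<ge> - c}}"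
    by (intro closedin_continuous_map_preimage[OF continuous_f]) (simp only: closed_closedin[symmetric] closed_halfspace_ge)
  ultimately have Q: "compactin M {x \<in> topspace M. (- \<nu>) \<bullet> f x \<ge> - c}"
    using closed_compactin[OF comp] by (simp only: mem_Collect_eq)
  define w :: "real^'n" where "w = R1 *\<^sub>R axis undefined 1"
  have nw: "norm w = R1" using R by (simp add: w_def)
  then have w\<Omega>: "w \<in> \<Omega>" using big by simp
  have "\<nu> \<bullet> f (s w) = \<nu> \<bullet> p + h R1" using height[OF sE(1)[OF w\<Omega>]] nq[of "s w"] sE(2)[OF w\<Omega>] nw by simp
  then have "(- \<nu>) \<bullet> f (s w) > - c" using mono[OF R(1,2)] by (simp add: c_def)
  then show False using superlevel_not_compact[OF Q, of "s w"] sE(1)[OF w\<Omega>] E_q by blast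
qed

end

section \<open>Lengths of curves\<close>

lemma norm_vector_derivative_affine:
  fixes g G :: "real \<Rightarrow> 'b::real_normed_vector"
  assumes g: "g differentiable (at (m * t + c))" and N: "open N" "t \<in> N" "\<And>s. s \<in> N \<Longrightarrow> G s = g (m * s + c)"
  shows "norm (vector_derivative G (at t)) = \<bar>m\<bar> * norm (vector_derivative g (at (m * t + c)))"
proof -
  let ?D = "vector_derivative g (at (m * t + c))"
  have gD: "(g has_vector_derivative ?D) (at (m * t + c))"
    using g vector_derivative_works by blast
  have "((\<lambda>s. m * s + c) has_vector_derivative m) (at t)"
    by (auto intro!: derivative_eq_intros)
  from vector_diff_chain_at[OF this gD] have "((\<lambda>s. g (m * s + c)) has_vector_derivative m *\<^sub>R ?D) (at t)"
    by (simp add: comp_def)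
  then have "(G has_vector_derivative m *\<^sub>R ?D) (at t)"
    by (rule has_vector_derivative_transform_within_open[OF _ N(1,2)]) (simp add: N(3))
  then show ?thesis by (simp add: vector_derivative_at)
qed

lemma valid_path_differentiable:
  assumes "valid_path g" obtains S where "finite S" "\<And>t. t \<in> {0..1} - S \<Longrightarrow> g differentiable (at t)"
  using assms unfolding valid_path_def piecewise_C1_differentiable_on_def C1_differentiable_on_eq by blast

text \<open>A curve is at least as long as its chord; the bound for all \<open>s\<close> keeps a short curve near its start.\<close>

lemma valid_path_length_bound:
  fixes g :: "real \<Rightarrow> 'b::euclidean_space"
  assumes g: "valid_path g" and L: "((\<lambda>t. norm (vector_derivative g (at t))) has_integral L) {0..1}"
    and s: "0 \<le> s" "s \<le> 1"
  shows "norm (g s - g 0) \<le> L"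
proof -
  obtain S where S: "finite S" "\<And>t. t \<in> {0..1} - S \<Longrightarrow> g differentiable (at t)"
    by (rule valid_path_differentiable[OF g]) blast
  have "continuous_on {0..1} g" using g by (simp add: valid_path_def piecewise_C1_differentiable_on_def)
  then have "continuous_on {0..s} g" by (rule continuous_on_subset) (use s in auto)
  then have int: "((\<lambda>t. vector_derivative g (at t)) has_integral (g s - g 0)) {0..s}"
    using S s by (intro fundamental_theorem_of_calculus_interior_strong[OF S(1) s(1)])
      (auto simp: vector_derivative_works[symmetric])
  have n: "(\<lambda>t. norm (vector_derivative g (at t))) integrable_on {0..s}"
    by (rule integrable_on_subinterval[OF has_integral_integrable[OF L]]) (use s in auto)
  have "norm (g s - g 0) = norm (integral {0..s} (\<lambda>t. vector_derivative g (at t)))"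
    using int by (simp add: integral_unique)
  also have "\<dots> \<le> integral {0..s} (\<lambda>t. norm (vector_derivative g (at t)))"
    by (rule integral_norm_bound_integral[OF has_integral_integrable[OF int] n]) simp
  also have "\<dots> \<le> integral {0..1} (\<lambda>t. norm (vector_derivative g (at t)))"
    by (rule integral_subset_le) (use s n has_integral_integrable[OF L] in auto)
  also have "\<dots> = L" using L by (simp add: integral_unique)
  finally show ?thesis .
qed

lemma curve_lengths_reverse:
  assumes "L \<in> curve_lengths M f x y" shows "L \<in> curve_lengths M f y x"
proof -
  obtain \<gamma> where \<gamma>: "continuous_map (top_of_set {0..1::real}) M \<gamma>" "\<gamma> 0 = x" "\<gamma> 1 = y" "valid_path (f \<circ> \<gamma>)"
    and L: "((\<lambda>t. norm (vector_derivative (f \<circ> \<gamma>) (at t))) has_integral L) {0..1}"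
    using assms unfolding curve_lengths_def by blast
  define \<gamma>' where "\<gamma>' t = \<gamma> (1 - t)" for t :: real
  have fg: "f \<circ> \<gamma>' = reversepath (f \<circ> \<gamma>)" by (simp add: fun_eq_iff \<gamma>'_def reversepath_def)
  obtain S where S: "finite S" "\<And>t. t \<in> {0..1} - S \<Longrightarrow> (f \<circ> \<gamma>) differentiable (at t)"
    by (rule valid_path_differentiable[OF \<gamma>(4)]) blast
  have c: "continuous_map (top_of_set {0..1}) (top_of_set {0..1}) (\<lambda>t::real. 1 - t)"
    by (auto simp: continuous_map_in_subtopology intro!: continuous_intros)
  have 1: "continuous_map (top_of_set {0..1}) M \<gamma>'"
    using continuous_map_compose[OF c \<gamma>(1)] by (simp add: \<gamma>'_def[abs_def] comp_def)
  have "(\<lambda>x::real. 1 - x) ` {0..1} = {0..1}" by (auto intro!: image_eqI[of _ _ "1 - _"])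
  then have "((\<lambda>t. norm (vector_derivative (f \<circ> \<gamma>) (at (1 - t)))) has_integral L) {0..1}"
    using has_integral_affinity01[OF L, of "-1" 1] by (simp add: algebra_simps)
  then have "((\<lambda>t. norm (vector_derivative (f \<circ> \<gamma>') (at t))) has_integral L) {0..1}"
  proof (rule has_integral_spike_finite[rotated 2])
    show "finite ((-) 1 ` S)" using S by simp
    fix t assume t: "t \<in> {0..1} - (-) 1 ` S"
    have "1 - t \<notin> S"
    proof
      assume "1 - t \<in> S"
      then have "1 - (1 - t) \<in> (-) 1 ` S" by blast
      then show False using t by simp
    qed
    then have "1 - t \<in> {0..1} - S" using t by simp
    then have "(f \<circ> \<gamma>) differentiable (at (-1 * t + 1))" using S(2)[of "1 - t"] by (simp add: algebra_simps)
    from norm_vector_derivative_affine[OF this open_UNIV, of "f \<circ> \<gamma>'"]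
    show "norm (vector_derivative (f \<circ> \<gamma>') (at t)) = norm (vector_derivative (f \<circ> \<gamma>) (at (1 - t)))"
      by (simp add: \<gamma>'_def algebra_simps)
  qed
  moreover have "valid_path (f \<circ> \<gamma>')" using \<gamma>(4) by (simp add: fg)
  ultimately show ?thesis
    using 1 \<gamma>(2,3) unfolding curve_lengths_def by (intro CollectI exI[of _ \<gamma>']) (simp add: \<gamma>'_def)
qed

lemma curve_lengths_join:
  assumes "L1 \<in> curve_lengths M f x y" "L2 \<in> curve_lengths M f y w"
  shows "L1 + L2 \<in> curve_lengths M f x w"
proof -
  obtain \<gamma>1 where \<gamma>1: "continuous_map (top_of_set {0..1::real}) M \<gamma>1" "\<gamma>1 0 = x" "\<gamma>1 1 = y" "valid_path (f \<circ> \<gamma>1)"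
    and L1: "((\<lambda>t. norm (vector_derivative (f \<circ> \<gamma>1) (at t))) has_integral L1) {0..1}"
    using assms(1) unfolding curve_lengths_def by blast
  obtain \<gamma>2 where \<gamma>2: "continuous_map (top_of_set {0..1::real}) M \<gamma>2" "\<gamma>2 0 = y" "\<gamma>2 1 = w" "valid_path (f \<circ> \<gamma>2)"
    and L2: "((\<lambda>t. norm (vector_derivative (f \<circ> \<gamma>2) (at t))) has_integral L2) {0..1}"
    using assms(2) unfolding curve_lengths_def by blast
  define \<gamma> where "\<gamma> t = (if t \<le> 1/2 then \<gamma>1 (2 * t) else \<gamma>2 (2 * t - 1))" for t :: real
  have fg: "f \<circ> \<gamma> = (f \<circ> \<gamma>1) +++ (f \<circ> \<gamma>2)" by (simp add: fun_eq_iff \<gamma>_def joinpaths_def)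
  have vp: "valid_path (f \<circ> \<gamma>)"
    unfolding fg using \<gamma>1 \<gamma>2 by (intro valid_path_join) (auto simp: pathfinish_def pathstart_def)
  have cont: "continuous_map (top_of_set {0..1}) M \<gamma>"
    unfolding \<gamma>_def
  proof (rule continuous_map_cases_le)
    have c1: "continuous_map (subtopology (top_of_set {0..1}) {x \<in> topspace (top_of_set {0..1}). x \<le> 1/2}) (top_of_set {0..1}) (\<lambda>t::real. 2 * t)"
      by (auto simp: continuous_map_in_subtopology subtopology_subtopology intro!: continuous_intros)
    show "continuous_map (subtopology (top_of_set {0..1}) {x \<in> topspace (top_of_set {0..1}). x \<le> 1/2}) M (\<lambda>t. \<gamma>1 (2 * t))"
      using continuous_map_compose[OF c1 \<gamma>1(1)] by (simp add: comp_def)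
    have c2: "continuous_map (subtopology (top_of_set {0..1}) {x \<in> topspace (top_of_set {0..1}). 1/2 \<le> x}) (top_of_set {0..1}) (\<lambda>t::real. 2 * t - 1)"
      by (auto simp: continuous_map_in_subtopology subtopology_subtopology intro!: continuous_intros)
    show "continuous_map (subtopology (top_of_set {0..1}) {x \<in> topspace (top_of_set {0..1}). 1/2 \<le> x}) M (\<lambda>t. \<gamma>2 (2 * t - 1))"
      using continuous_map_compose[OF c2 \<gamma>2(1)] by (simp add: comp_def)
    show "\<gamma>1 (2 * t) = \<gamma>2 (2 * t - 1)" if "t = 1/2" for t :: real unfolding that using \<gamma>1 \<gamma>2 by simp
  qed auto
  have half1: "((\<lambda>t. norm (vector_derivative (f \<circ> \<gamma>) (at t))) has_integral L1) {0..1/2}"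
  proof -
    obtain S where S: "finite S" "\<And>t. t \<in> {0..1} - S \<Longrightarrow> (f \<circ> \<gamma>1) differentiable (at t)"
      by (rule valid_path_differentiable[OF \<gamma>1(4)]) blast
    have "(\<lambda>x::real. x / 2) ` {0..1} = {0..1/2}"
      using image_affinity_atLeastAtMost_div[of 2 0 0 "1::real"] by simp
    then have "((\<lambda>t. 2 * norm (vector_derivative (f \<circ> \<gamma>1) (at (2 * t)))) has_integral L1) {0..1/2}"
      using has_integral_mult_right[OF has_integral_affinity01[OF L1, of 2 0], of 2] by simp
    then show ?thesis
    proof (rule has_integral_spike_finite[rotated 2])
      show "finite (insert (1/2) ((\<lambda>t. t / 2) ` S))" using S by simp
      fix t assume t: "t \<in> {0..1/2} - insert (1/2) ((\<lambda>t. t / 2) ` S)"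
      have "2 * t \<notin> S"
      proof
        assume "2 * t \<in> S"
        then have "2 * t / 2 \<in> (\<lambda>t. t / 2) ` S" by (rule imageI)
        then show False using t by simp
      qed
      then have "(f \<circ> \<gamma>1) differentiable (at (2 * t + 0))" using S(2)[of "2 * t"] t by simp
      from norm_vector_derivative_affine[OF this, of "{..<1/2}" "f \<circ> \<gamma>"]
      show "norm (vector_derivative (f \<circ> \<gamma>) (at t)) = 2 * norm (vector_derivative (f \<circ> \<gamma>1) (at (2 * t)))"
        using t by (simp add: \<gamma>_def)
    qed
  qed
  have half2: "((\<lambda>t. norm (vector_derivative (f \<circ> \<gamma>) (at t))) has_integral L2) {1/2..1}"
  proof -
    obtain S where S: "finite S" "\<And>t. t \<in> {0..1} - S \<Longrightarrow> (f \<circ> \<gamma>2) differentiable (at t)"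
      by (rule valid_path_differentiable[OF \<gamma>2(4)]) blast
    have "(\<lambda>x::real. x / 2 + 1/2) ` {0..1} = {1/2..1}"
      using image_affinity_atLeastAtMost_div[of 2 "1/2" 0 "1::real"] by simp
    then have "((\<lambda>t. 2 * norm (vector_derivative (f \<circ> \<gamma>2) (at (2 * t - 1)))) has_integral L2) {1/2..1}"
      using has_integral_mult_right[OF has_integral_affinity01[OF L2, of 2 "-1"], of 2] by simp
    then show ?thesis
    proof (rule has_integral_spike_finite[rotated 2])
      show "finite (insert (1/2) ((\<lambda>t. (t + 1) / 2) ` S))" using S by simp
      fix t assume t: "t \<in> {1/2..1} - insert (1/2) ((\<lambda>t. (t + 1) / 2) ` S)"
      have "2 * t - 1 \<notin> S"
      proof
        assume "2 * t - 1 \<in> S"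
        then have "(2 * t - 1 + 1) / 2 \<in> (\<lambda>t. (t + 1) / 2) ` S" by (rule imageI)
        then show False using t by simp
      qed
      then have "(f \<circ> \<gamma>2) differentiable (at (2 * t + -1))" using S(2)[of "2 * t - 1"] t by simp
      from norm_vector_derivative_affine[OF this, of "{1/2<..}" "f \<circ> \<gamma>"]
      show "norm (vector_derivative (f \<circ> \<gamma>) (at t)) = 2 * norm (vector_derivative (f \<circ> \<gamma>2) (at (2 * t - 1)))"
        using t by (simp add: \<gamma>_def)
    qed
  qed
  have "((\<lambda>t. norm (vector_derivative (f \<circ> \<gamma>) (at t))) has_integral (L1 + L2)) {0..1}"
    by (rule has_integral_combine[OF _ _ half1 half2]) auto
  moreover have "\<gamma> 0 = x" "\<gamma> 1 = w" using \<gamma>1 \<gamma>2 by (auto simp: \<gamma>_def)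
  ultimately show ?thesis using cont vp unfolding curve_lengths_def by blast
qed

section \<open>Complete hypersurfaces in a hyperplane\<close>

text \<open>A hypersurface in the hyperplane \<open>p + range A\<close>, where \<open>h\<close> gives the coordinates of its points. The
  last assumption says that \<open>h\<close> is a local homeomorphism.\<close>

locale flat_development =
  fixes M :: "'a topology" and f :: "'a \<Rightarrow> real^'d" and h :: "'a \<Rightarrow> real^'n" and p :: "real^'d" and A :: "real^'n \<Rightarrow> real^'d"
  assumes H: "Hausdorff_space M" and conn: "connected_space M"
    and linA: "linear A" and isoA: "\<And>w. norm (A w) = norm w"
    and cont_h: "continuous_map M euclidean h"
    and f_eq: "\<And>x. x \<in> topspace M \<Longrightarrow> f x = p + A (h x)"
    and local_section: "\<And>x. x \<in> topspace M \<Longrightarrow> \<exists>\<epsilon>>0. \<exists>t. continuous_map (top_of_set (ball (h x) \<epsilon>)) M t \<and>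
        (\<forall>w\<in>ball (h x) \<epsilon>. h (t w) = w) \<and> t (h x) = x \<and> openin M (t ` ball (h x) \<epsilon>)"
begin

definition "sect S t \<longleftrightarrow> continuous_map (top_of_set S) M t \<and> (\<forall>w\<in>S. h (t w) = w)"

lemma sect_subset: "sect S t \<Longrightarrow> T \<subseteq> S \<Longrightarrow> sect T t"
  unfolding sect_def by (metis continuous_map_from_subtopology inf.absorb2 subsetD subtopology_subtopology)

lemma sect_topspace: "sect S t \<Longrightarrow> w \<in> S \<Longrightarrow> t w \<in> topspace M"
  unfolding sect_def using continuous_map_image_subset_topspace by fastforce

lemma h_locally_injective:
  assumes "x \<in> topspace M" obtains U where "openin M U" "x \<in> U" "inj_on h U"
proof -
  obtain \<epsilon> t where t: "\<epsilon> > 0" "\<forall>w\<in>ball (h x) \<epsilon>. h (t w) = w" "t (h x) = x" "openin M (t ` ball (h x) \<epsilon>)"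
    using local_section[OF assms] by blast
  have "x \<in> t ` ball (h x) \<epsilon>" using t(1,3) by (metis centre_in_ball imageI)
  moreover have "inj_on h (t ` ball (h x) \<epsilon>)" using t(2) by (auto simp: inj_on_def)
  ultimately show ?thesis using that t(4) by blast
qed

text \<open>Agreement is a closed condition because the space is Hausdorff, and an open one because \<open>h\<close> is
  locally injective.\<close>

lemma lifts_agree:
  assumes X: "connected_space X" and s: "continuous_map X M s" and t: "continuous_map X M t"
    and eq: "\<And>y. y \<in> topspace X \<Longrightarrow> h (s y) = h (t y)"
    and y0: "y0 \<in> topspace X" "s y0 = t y0" and y: "y \<in> topspace X"
  shows "s y = t y"
proof -
  let ?S = "{y \<in> topspace X. s y = t y}"
  have "closedin X ?S" by (rule closedin_continuous_maps_eq[OF H s t])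
  moreover have "openin X ?S"
  proof (subst openin_subopen, intro ballI)
    fix y assume y: "y \<in> ?S"
    then have "s y \<in> topspace M" using continuous_map_image_subset_topspace[OF s] by blast
    then obtain U where U: "openin M U" "s y \<in> U" "inj_on h U" by (rule h_locally_injective)
    have "openin X {z \<in> topspace X. s z \<in> U}" "openin X {z \<in> topspace X. t z \<in> U}"
      using openin_continuous_map_preimage[OF s U(1)] openin_continuous_map_preimage[OF t U(1)] .
    then have "openin X ({z \<in> topspace X. s z \<in> U} \<inter> {z \<in> topspace X. t z \<in> U})" by (rule openin_Int)
    moreover have "{z \<in> topspace X. s z \<in> U} \<inter> {z \<in> topspace X. t z \<in> U} \<subseteq> ?S"
      using U(3) eq by (auto simp: inj_on_def)
    moreover have "y \<in> {z \<in> topspace X. s z \<in> U} \<inter> {z \<in> topspace X. t z \<in> U}" using y U(2) by auto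
    ultimately show "\<exists>T. openin X T \<and> y \<in> T \<and> T \<subseteq> ?S" by blast
  qed
  ultimately have "?S = topspace X" using X y0 unfolding connected_space_clopen_in by blast
  then show ?thesis using y by blast
qed

lemma sections_agree:
  assumes "sect S s" "sect T t" "connected (S \<inter> T)" "w0 \<in> S \<inter> T" "s w0 = t w0" "w \<in> S \<inter> T"
  shows "s w = t w"
proof -
  have 1: "sect (S \<inter> T) s" "sect (S \<inter> T) t" using sect_subset assms(1,2) by blast+
  show ?thesis
    by (rule lifts_agree[of "top_of_set (S \<inter> T)" s t w0])
      (use 1 assms(3-6) in \<open>auto simp: sect_def connected_space_subtopology\<close>)
qed

text \<open>The developed curve is as long as the curve, so it stays in the ball. There the section lifts it
  again, and lifts are unique. Thus a section identifies the metric ball of the same radius.\<close>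

lemma curve_stays_in_section:
  assumes L: "L \<in> curve_lengths M f x y" "L < \<epsilon>" and x: "x \<in> topspace M" and t: "sect (ball (h x) \<epsilon>) t" "t (h x) = x"
  shows "h y \<in> ball (h x) \<epsilon>" "t (h y) = y"
proof -
  obtain \<gamma> where \<gamma>: "continuous_map (top_of_set {0..1::real}) M \<gamma>" "\<gamma> 0 = x" "\<gamma> 1 = y" "valid_path (f \<circ> \<gamma>)"
    and L': "((\<lambda>t. norm (vector_derivative (f \<circ> \<gamma>) (at t))) has_integral L) {0..1}"
    using L(1) unfolding curve_lengths_def by blast
  have top: "\<gamma> s \<in> topspace M" if "s \<in> {0..1}" for s
    using continuous_map_image_subset_topspace[OF \<gamma>(1)] that by auto
  have inb: "h (\<gamma> s) \<in> ball (h x) \<epsilon>" if s: "s \<in> {0..1}" for s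
  proof -
    have "norm ((f \<circ> \<gamma>) s - (f \<circ> \<gamma>) 0) \<le> L" using valid_path_length_bound[OF \<gamma>(4) L'] s by simp
    moreover have "(f \<circ> \<gamma>) s - (f \<circ> \<gamma>) 0 = A (h (\<gamma> s) - h x)"
      using f_eq top[OF s] top[of 0] \<gamma>(2) by (simp add: linear_diff[OF linA])
    ultimately have "norm (h (\<gamma> s) - h x) \<le> L" by (simp add: isoA)
    then show ?thesis using L(2) by (simp add: dist_norm norm_minus_commute)
  qed
  have "continuous_map (top_of_set {0..1}) (top_of_set (ball (h x) \<epsilon>)) (h \<circ> \<gamma>)"
    using continuous_map_compose[OF \<gamma>(1) cont_h] inb by (simp add: continuous_map_in_subtopology image_subset_iff)
  moreover have "continuous_map (top_of_set (ball (h x) \<epsilon>)) M t" using t(1) by (simp add: sect_def)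
  ultimately have c: "continuous_map (top_of_set {0..1}) M (t \<circ> (h \<circ> \<gamma>))" by (rule continuous_map_compose)
  have "(t \<circ> (h \<circ> \<gamma>)) 1 = \<gamma> 1"
  proof (rule lifts_agree[OF _ c \<gamma>(1), of 0])
    show "connected_space (top_of_set {0..1::real})" by (simp add: connected_space_subtopology)
    show "h ((t \<circ> (h \<circ> \<gamma>)) s) = h (\<gamma> s)" if "s \<in> topspace (top_of_set {0..1})" for s
      using t(1) inb that by (simp add: sect_def)
  qed (use \<gamma> t in auto)
  then show "t (h y) = y" using \<gamma>(3) by simp
  show "h y \<in> ball (h x) \<epsilon>" using inb[of 1] \<gamma>(3) by simp
qed

lemma curve_length_ge:
  assumes L: "L \<in> curve_lengths M f x y" and x: "x \<in> topspace M" "y \<in> topspace M"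
  shows "norm (h y - h x) \<le> L"
proof -
  obtain \<gamma> where \<gamma>: "\<gamma> 0 = x" "\<gamma> 1 = y" "valid_path (f \<circ> \<gamma>)"
    and L': "((\<lambda>t. norm (vector_derivative (f \<circ> \<gamma>) (at t))) has_integral L) {0..1}"
    using L unfolding curve_lengths_def by blast
  have "norm ((f \<circ> \<gamma>) 1 - (f \<circ> \<gamma>) 0) \<le> L" using valid_path_length_bound[OF \<gamma>(3) L', of 1] by simp
  moreover have "(f \<circ> \<gamma>) 1 - (f \<circ> \<gamma>) 0 = A (h y - h x)"
    using f_eq x \<gamma> by (simp add: linear_diff[OF linA])
  ultimately show ?thesis by (simp add: isoA)
qed

text \<open>The lift of a straight segment by a section is a curve in \<open>M\<close>.\<close>

lemma segment_length:
  assumes t: "sect S t" and S: "convex S" and w: "w1 \<in> S" "w2 \<in> S"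
  shows "norm (w2 - w1) \<in> curve_lengths M f (t w1) (t w2)"
proof -
  define \<sigma> where "\<sigma> r = w1 + r *\<^sub>R (w2 - w1)" for r
  define \<gamma> where "\<gamma> = t \<circ> \<sigma>"
  have inS: "\<sigma> r \<in> S" if "r \<in> {0..1}" for r
  proof -
    have "\<sigma> r = (1 - r) *\<^sub>R w1 + r *\<^sub>R w2" by (simp add: \<sigma>_def algebra_simps)
    then show ?thesis using convexD_alt[OF S w] that by simp
  qed
  have "continuous_on {0..1} \<sigma>" unfolding \<sigma>_def by (intro continuous_intros)
  then have "continuous_map (top_of_set {0..1}) (top_of_set S) \<sigma>" using inS by (auto simp: continuous_map_in_subtopology)
  moreover have "continuous_map (top_of_set S) M t" using t by (simp add: sect_def)
  ultimately have cont: "continuous_map (top_of_set {0..1}) M \<gamma>" unfolding \<gamma>_def by (rule continuous_map_compose)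
  have eq: "(f \<circ> \<gamma>) r = p + A w1 + r *\<^sub>R A (w2 - w1)" if r: "r \<in> {0..1}" for r
  proof -
    have "\<gamma> r \<in> topspace M" using sect_topspace[OF t inS[OF r]] by (simp add: \<gamma>_def)
    moreover have "h (\<gamma> r) = \<sigma> r" using t inS[OF r] by (simp add: sect_def \<gamma>_def)
    ultimately show ?thesis
      using f_eq by (simp add: \<sigma>_def linear_add[OF linA] linear_cmul[OF linA])
  qed
  have der: "((f \<circ> \<gamma>) has_vector_derivative A (w2 - w1)) (at r)" if r: "r \<in> {0<..<1}" for r
  proof -
    have "((\<lambda>r. p + A w1 + r *\<^sub>R A (w2 - w1)) has_vector_derivative A (w2 - w1)) (at r)"
      by (auto intro!: derivative_eq_intros)
    then show ?thesis
      by (rule has_vector_derivative_transform_within_open[of _ _ _ "{0<..<1}"]) (use r eq in auto)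
  qed
  have "valid_path (f \<circ> \<gamma>)"
    unfolding valid_path_def piecewise_C1_differentiable_on_def
  proof (intro conjI exI[of _ "{0, 1}"])
    have "continuous_on {0..1} (\<lambda>r. p + A w1 + r *\<^sub>R A (w2 - w1))" by (intro continuous_intros)
    then show "continuous_on {0..1} (f \<circ> \<gamma>)" by (rule continuous_on_eq) (rule eq[symmetric])
    show "(f \<circ> \<gamma>) C1_differentiable_on {0..1} - {0, 1}"
      unfolding C1_differentiable_on_def by (intro exI[of _ "\<lambda>_. A (w2 - w1)"]) (auto intro!: der)
  qed auto
  moreover have "((\<lambda>r. norm (vector_derivative (f \<circ> \<gamma>) (at r))) has_integral norm (w2 - w1)) {0..1}"
  proof (rule has_integral_spike_finite[of "{0, 1}"])
    show "((\<lambda>r::real. norm (w2 - w1)) has_integral norm (w2 - w1)) {0..1}"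
      using has_integral_const_real[of "norm (w2 - w1)" 0 1] by simp
    show "norm (vector_derivative (f \<circ> \<gamma>) (at r)) = norm (w2 - w1)" if "r \<in> {0..1} - {0, 1}" for r
      using vector_derivative_at[OF der[of r]] that isoA by simp
  qed simp
  ultimately show ?thesis
    using cont unfolding curve_lengths_def by (intro CollectI exI[of _ \<gamma>]) (simp add: \<gamma>_def \<sigma>_def)
qed

lemma section_at:
  assumes "x \<in> topspace M"
  obtains \<epsilon> t where "\<epsilon> > 0" "sect (ball (h x) \<epsilon>) t" "t (h x) = x" "openin M (t ` ball (h x) \<epsilon>)" "x \<in> t ` ball (h x) \<epsilon>"
proof -
  obtain \<epsilon> t where t: "\<epsilon> > 0" "continuous_map (top_of_set (ball (h x) \<epsilon>)) M t"
    "\<forall>w\<in>ball (h x) \<epsilon>. h (t w) = w" "t (h x) = x" "openin M (t ` ball (h x) \<epsilon>)"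
    using local_section[OF assms] by blast
  have "x \<in> t ` ball (h x) \<epsilon>" using t(1,4) by (metis centre_in_ball imageI)
  then show ?thesis using that[of \<epsilon> t] t by (simp add: sect_def)
qed

text \<open>The points that can be reached from \<open>x\<close> form an open set with open complement, since neighbouring
  points are joined by lifted segments.\<close>

lemma curve_lengths_nonempty:
  assumes x: "x \<in> topspace M" "y \<in> topspace M" shows "curve_lengths M f x y \<noteq> {}"
proof -
  let ?S = "{y \<in> topspace M. curve_lengths M f x y \<noteq> {}}"
  have near: "curve_lengths M f y z \<noteq> {}"
    if t: "sect (ball w \<epsilon>) t" and yz: "y \<in> t ` ball w \<epsilon>" "z \<in> t ` ball w \<epsilon>" for w \<epsilon> t y z
    using segment_length[OF t convex_ball] yz by blast
  have "openin M ?S"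
  proof (subst openin_subopen, intro ballI)
    fix y assume y: "y \<in> ?S"
    then obtain L where L: "L \<in> curve_lengths M f x y" by auto
    have "y \<in> topspace M" using y by simp
    then obtain \<epsilon> t where t: "sect (ball (h y) \<epsilon>) t" "openin M (t ` ball (h y) \<epsilon>)" "y \<in> t ` ball (h y) \<epsilon>" by (rule section_at)
    have "t ` ball (h y) \<epsilon> \<subseteq> ?S"
    proof
      fix z assume z: "z \<in> t ` ball (h y) \<epsilon>"
      then obtain L' where "L' \<in> curve_lengths M f y z" using near[OF t(1,3)] by blast
      then have "L + L' \<in> curve_lengths M f x z" by (rule curve_lengths_join[OF L])
      moreover have "z \<in> topspace M" using z openin_subset[OF t(2)] by blast
      ultimately show "z \<in> ?S" by blast
    qed
    then show "\<exists>T. openin M T \<and> y \<in> T \<and> T \<subseteq> ?S" using t by blast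
  qed
  moreover have "openin M (topspace M - ?S)"
  proof (subst openin_subopen, intro ballI)
    fix y assume y: "y \<in> topspace M - ?S"
    then have "y \<in> topspace M" by simp
    then obtain \<epsilon> t where t: "sect (ball (h y) \<epsilon>) t" "openin M (t ` ball (h y) \<epsilon>)" "y \<in> t ` ball (h y) \<epsilon>" by (rule section_at)
    have "t ` ball (h y) \<epsilon> \<subseteq> topspace M - ?S"
    proof
      fix z assume z: "z \<in> t ` ball (h y) \<epsilon>"
      have "z \<notin> ?S"
      proof
        assume "z \<in> ?S"
        then obtain L where L: "L \<in> curve_lengths M f x z" by auto
        obtain L' where "L' \<in> curve_lengths M f z y" using near[OF t(1) z t(3)] by blast
        then have "L + L' \<in> curve_lengths M f x y" by (rule curve_lengths_join[OF L])
        then show False using y by auto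
      qed
      then show "z \<in> topspace M - ?S" using z openin_subset[OF t(2)] by blast
    qed
    then show "\<exists>T. openin M T \<and> y \<in> T \<and> T \<subseteq> topspace M - ?S" using t by blast
  qed
  moreover have "x \<in> ?S"
  proof -
    obtain \<epsilon> t where "sect (ball (h x) \<epsilon>) t" "x \<in> t ` ball (h x) \<epsilon>" by (rule section_at[OF x(1)])
    then show ?thesis using near x(1) by blast
  qed
  ultimately have "?S = topspace M"
    using conn unfolding connected_space_clopen_in closedin_def by blast
  then show ?thesis using x by blast
qed

abbreviation "d \<equiv> riemannian_dist M f"

lemma d_le: "x \<in> topspace M \<Longrightarrow> y \<in> topspace M \<Longrightarrow> L \<in> curve_lengths M f x y \<Longrightarrow> d x y \<le> L"
  unfolding riemannian_dist_def
  by (auto intro!: cInf_lower bdd_belowI[of _ 0] order_trans[OF norm_ge_zero curve_length_ge])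

lemma d_ge:
  assumes "x \<in> topspace M" "y \<in> topspace M" shows "norm (h y - h x) \<le> d x y"
  unfolding riemannian_dist_def using assms curve_lengths_nonempty curve_length_ge
  by (auto intro!: cInf_greatest)

lemma d_less:
  assumes "x \<in> topspace M" "y \<in> topspace M" "d x y < e"
  obtains L where "L \<in> curve_lengths M f x y" "L < e"
  using cInf_lessD[OF curve_lengths_nonempty[OF assms(1,2)], of e] assms unfolding riemannian_dist_def by auto

lemma d_segment: "sect S t \<Longrightarrow> convex S \<Longrightarrow> w1 \<in> S \<Longrightarrow> w2 \<in> S \<Longrightarrow> d (t w1) (t w2) \<le> norm (w2 - w1)"
  by (intro d_le segment_length sect_topspace)

text \<open>Distinct points with the same image have positive distance because of \<open>curve_stays_in_section\<close>.\<close>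

lemma Metric_space_d: "Metric_space (topspace M) d"
proof
  fix x y
  show "0 \<le> d x y"
  proof (cases "x \<in> topspace M \<and> y \<in> topspace M")
    case True
    then show ?thesis using d_ge[of x y] norm_ge_zero[of "h y - h x"] by linarith
  qed (auto simp: riemannian_dist_def)
  have "curve_lengths M f x y = curve_lengths M f y x" by (intro equalityI subsetI; erule curve_lengths_reverse)
  then show "d x y = d y x" by (auto simp: riemannian_dist_def)
next
  fix x y assume xy: "x \<in> topspace M" "y \<in> topspace M"
  obtain \<epsilon> t where t: "\<epsilon> > 0" "sect (ball (h x) \<epsilon>) t" "t (h x) = x" by (rule section_at[OF xy(1)])
  show "d x y = 0 \<longleftrightarrow> x = y"
  proof
    assume d0: "d x y = 0"
    then obtain L where "L \<in> curve_lengths M f x y" "L < \<epsilon>" using d_less[OF xy, of \<epsilon>] t(1) by auto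
    then have "t (h y) = y" using curve_stays_in_section[OF _ _ xy(1) t(2,3)] by blast
    moreover have "h y = h x" using d_ge[OF xy] d0 by simp
    ultimately show "x = y" using t(3) by simp
  next
    assume "x = y"
    moreover have "d (t (h x)) (t (h x)) \<le> norm (h x - h x)" using t(1) by (intro d_segment[OF t(2)]) auto
    ultimately show "d x y = 0" using d_ge[OF xy] t(3) by simp
  qed
next
  fix x y z assume xyz: "x \<in> topspace M" "y \<in> topspace M" "z \<in> topspace M"
  show "d x z \<le> d x y + d y z"
  proof (rule field_le_epsilon)
    fix e :: real assume e: "e > 0"
    obtain L1 where L1: "L1 \<in> curve_lengths M f x y" "L1 < d x y + e/2" by (rule d_less[OF xyz(1,2), of "d x y + e/2"]) (use e in auto)
    obtain L2 where L2: "L2 \<in> curve_lengths M f y z" "L2 < d y z + e/2" by (rule d_less[OF xyz(2,3), of "d y z + e/2"]) (use e in auto)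
    have "d x z \<le> L1 + L2" using curve_lengths_join[OF L1(1) L2(1)] by (rule d_le[OF xyz(1,3)])
    then show "d x z \<le> d x y + d y z + e" using L1 L2 by linarith
  qed
qed

lemma open_image_section:
  assumes S: "open S" and s: "sect S s" shows "openin M (s ` S)"
proof (subst openin_subopen, intro ballI)
  fix x assume "x \<in> s ` S"
  then obtain w where w: "w \<in> S" "x = s w" by blast
  have xM: "x \<in> topspace M" using sect_topspace[OF s w(1)] w(2) by simp
  have hx: "h x = w" using s w by (simp add: sect_def)
  obtain \<epsilon> t where t: "\<epsilon> > 0" "sect (ball (h x) \<epsilon>) t" "t (h x) = x" "openin M (t ` ball (h x) \<epsilon>)" by (rule section_at[OF xM])
  obtain r where r: "r > 0" "ball w r \<subseteq> S" using S w(1) open_contains_ball by blast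
  let ?B = "ball w (min r \<epsilon>)"
  have agree: "s v = t v" if "v \<in> ?B" for v
    by (rule sections_agree[OF sect_subset[OF s, of ?B] sect_subset[OF t(2), of ?B], of w])
      (use that r t hx w in \<open>auto intro: order_trans[OF _ r(2)]\<close>)
  let ?U = "{y \<in> t ` ball (h x) \<epsilon>. h y \<in> ?B}"
  have "openin M {y \<in> topspace M. h y \<in> ?B}" by (rule openin_continuous_map_preimage[OF cont_h]) (simp only: open_openin[symmetric] open_ball)
  then have "openin M (t ` ball (h x) \<epsilon> \<inter> {y \<in> topspace M. h y \<in> ?B})" using t(4) by (intro openin_Int)
  moreover have "t ` ball (h x) \<epsilon> \<inter> {y \<in> topspace M. h y \<in> ?B} = ?U" using openin_subset[OF t(4)] by auto
  ultimately have "openin M ?U" by simp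
  moreover have "x \<in> ?U" using t(1,3) hx r(1) by (auto intro!: image_eqI[of _ t "h x"])
  moreover have "?U \<subseteq> s ` S"
  proof
    fix y assume "y \<in> ?U"
    then obtain v where v: "v \<in> ball (h x) \<epsilon>" "y = t v" "h y \<in> ?B" by blast
    then have "v \<in> ?B" using t(2) by (simp add: sect_def)
    then have "y = s v" "v \<in> S" using agree[of v] v(2) r(2) by auto
    then show "y \<in> s ` S" by blast
  qed
  ultimately show "\<exists>T. openin M T \<and> x \<in> T \<and> T \<subseteq> s ` S" by blast
qed

text \<open>The image of a section is open because \<open>h\<close> is a local homeomorphism, and closed as the set where the
  section inverts \<open>h\<close> from the left.\<close>

lemma global_section_homeomorphic:
  assumes s: "sect UNIV s" shows "homeomorphic_map M euclidean h" "\<And>x. x \<in> topspace M \<Longrightarrow> s (h x) = x"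
proof -
  have cs: "continuous_map euclidean M s" using s by (simp add: sect_def)
  have c2: "continuous_map M M (s \<circ> h)" by (rule continuous_map_compose[OF cont_h cs])
  have "closedin M {x \<in> topspace M. (s \<circ> h) x = id x}"
    by (rule closedin_continuous_maps_eq[OF H c2 continuous_map_id])
  moreover have "{x \<in> topspace M. (s \<circ> h) x = id x} = s ` UNIV"
  proof
    show "s ` UNIV \<subseteq> {x \<in> topspace M. (s \<circ> h) x = id x}"
      using s sect_topspace[OF s] by (auto simp: sect_def)
    show "{x \<in> topspace M. (s \<circ> h) x = id x} \<subseteq> s ` UNIV" by (auto intro: image_eqI[of _ s, OF sym])
  qed
  moreover have "openin M (s ` UNIV)" by (rule open_image_section[OF open_UNIV s])
  ultimately have "s ` UNIV = topspace M"
    using conn unfolding connected_space_clopen_in by (metis UNIV_not_empty image_is_empty)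
  show sh: "s (h x) = x" if "x \<in> topspace M" for x
  proof -
    have "x \<in> s ` UNIV" using that \<open>s ` UNIV = topspace M\<close> by simp
    then show ?thesis using s by (auto simp: sect_def)
  qed
  have "homeomorphic_maps M euclidean h s"
    unfolding homeomorphic_maps_def using cont_h cs sh s by (auto simp: sect_def)
  then show "homeomorphic_map M euclidean h" by (metis homeomorphic_maps_map)
qed

lemma sect_glue:
  assumes "\<And>w. w \<in> S \<Longrightarrow> \<exists>N t. open N \<and> w \<in> N \<and> sect N t \<and> (\<forall>v\<in>N \<inter> S. s v = t v)" and S: "open S"
  shows "sect S s"
proof -
  have hs: "h (s w) = w" "s w \<in> topspace M" if "w \<in> S" for w
  proof -
    from assms(1)[OF that] obtain N t where "w \<in> N" "sect N t" "\<forall>v\<in>N \<inter> S. s v = t v" by blast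
    then show "h (s w) = w" "s w \<in> topspace M" using that sect_topspace by (auto simp: sect_def)
  qed
  have "continuous_map (top_of_set S) M s"
    unfolding continuous_map_def
  proof (intro conjI allI impI)
    show "s \<in> topspace (top_of_set S) \<rightarrow> topspace M" using hs(2) by auto
    fix U assume U: "openin M U"
    have "open {w \<in> S. s w \<in> U}"
    proof (subst open_subopen, intro ballI)
      fix w assume w: "w \<in> {w \<in> S. s w \<in> U}"
      then have wS: "w \<in> S" by simp
      obtain N t where N: "open N" "w \<in> N" "sect N t" "\<forall>v\<in>N \<inter> S. s v = t v" using assms(1)[OF wS] by blast
      have "openin (top_of_set N) {v \<in> topspace (top_of_set N). t v \<in> U}"
        using N(3) U unfolding sect_def by (intro openin_continuous_map_preimage) auto
      then have "open {v \<in> N. t v \<in> U}" using openin_open_eq[OF N(1)] by auto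
      then have "open ({v \<in> N. t v \<in> U} \<inter> S)" using S by (rule open_Int)
      moreover have "w \<in> {v \<in> N. t v \<in> U} \<inter> S" using w N by auto
      moreover have "{v \<in> N. t v \<in> U} \<inter> S \<subseteq> {w \<in> S. s w \<in> U}" using N(4) by auto
      ultimately show "\<exists>T. open T \<and> w \<in> T \<and> T \<subseteq> {w \<in> S. s w \<in> U}" by blast
    qed
    then show "openin (top_of_set S) {w \<in> topspace (top_of_set S). s w \<in> U}"
      by (intro open_subset) auto
  qed
  then show ?thesis using hs by (simp add: sect_def)
qed

text \<open>Sections over concentric balls with the same value at the centre agree on the smaller ball.\<close>

lemma sections_union:
  assumes Z: "\<And>\<rho>. \<rho> \<in> Z \<Longrightarrow> \<rho> > 0 \<and> (\<exists>t. sect (ball a \<rho>) t \<and> t a = x)"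
  shows "\<exists>s. sect (\<Union>\<rho>\<in>Z. ball a \<rho>) s \<and> (Z \<noteq> {} \<longrightarrow> s a = x)"
proof -
  obtain t where t: "\<And>\<rho>. \<rho> \<in> Z \<Longrightarrow> \<rho> > 0 \<and> sect (ball a \<rho>) (t \<rho>) \<and> t \<rho> a = x" using Z by metis
  define c where "c w = (SOME \<rho>. \<rho> \<in> Z \<and> w \<in> ball a \<rho>)" for w
  define s where "s w = t (c w) w" for w
  have cw: "c w \<in> Z \<and> w \<in> ball a (c w)" if "\<rho> \<in> Z" "w \<in> ball a \<rho>" for w \<rho>
    unfolding c_def by (rule someI[of _ \<rho>]) (use that in simp)
  have st: "s w = t \<rho> w" if r: "\<rho> \<in> Z" "w \<in> ball a \<rho>" for w \<rho>
    unfolding s_def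
  proof (rule sections_agree[of "ball a (c w)" "t (c w)" "ball a \<rho>" "t \<rho>" a w])
    show "connected (ball a (c w) \<inter> ball a \<rho>)" by (intro convex_connected convex_Int convex_ball)
  qed (use r cw[OF r] t[OF r(1)] t[of "c w"] in auto)
  have "sect (\<Union>\<rho>\<in>Z. ball a \<rho>) s"
  proof (rule sect_glue)
    fix w assume "w \<in> (\<Union>\<rho>\<in>Z. ball a \<rho>)"
    then obtain \<rho> where "\<rho> \<in> Z" "w \<in> ball a \<rho>" by blast
    then show "\<exists>N t. open N \<and> w \<in> N \<and> sect N t \<and> (\<forall>v\<in>N \<inter> (\<Union>\<rho>\<in>Z. ball a \<rho>). s v = t v)"
      using st t by (intro exI[of _ "ball a \<rho>"] exI[of _ "t \<rho>"]) auto
  qed auto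
  moreover have "s a = x" if "\<rho> \<in> Z" for \<rho> using st[OF that] t[OF that] by simp
  ultimately show ?thesis by blast
qed

text \<open>Otherwise there are points of the ball at which the radius of a section has to shrink to zero. A
  subsequence of them converges, and the corresponding points of the hypersurface form a Cauchy sequence
  since segments of the ball lift. Near their limit in \<open>M\<close> there is a section of a fixed radius.\<close>

lemma uniform_section_radius:
  assumes comp: "complete_hypersurface M f" and s: "sect (ball a \<rho>) s"
  shows "\<exists>\<eta>>0. \<forall>w\<in>ball a \<rho>. \<exists>t. sect (ball w \<eta>) t \<and> t w = s w"
proof (rule ccontr)
  interpret MS: Metric_space "topspace M" d by (rule Metric_space_d)
  assume "\<not> ?thesis"
  then have n: "\<exists>w\<in>ball a \<rho>. \<forall>t. sect (ball w \<eta>) t \<longrightarrow> t w \<noteq> s w" if "\<eta> > 0" for \<eta> using that by simp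
  have "\<exists>w\<in>ball a \<rho>. \<forall>t. sect (ball w (inverse (real (Suc k)))) t \<longrightarrow> t w \<noteq> s w" for k by (rule n) simp
  then obtain w where w: "\<And>k. w k \<in> ball a \<rho>" "\<And>k t. sect (ball (w k) (inverse (real (Suc k)))) t \<Longrightarrow> t (w k) \<noteq> s (w k)"
    by metis
  have "bounded (range w)" using w(1) by (intro bounded_subset[OF bounded_ball[of a \<rho>]]) auto
  then obtain l r where lr: "strict_mono r" "(w \<circ> r) \<longlonglongrightarrow> l" using bounded_imp_convergent_subsequence by blast
  define \<sigma> where "\<sigma> k = s (w (r k))" for k
  have \<sigma>M: "\<sigma> k \<in> topspace M" for k using sect_topspace[OF s w(1)] by (simp add: \<sigma>_def)
  have "MS.MCauchy \<sigma>"
    unfolding MS.MCauchy_def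
  proof (intro conjI allI impI)
    show "range \<sigma> \<subseteq> topspace M" using \<sigma>M by auto
    fix e :: real assume "e > 0"
    then obtain N where N: "\<And>m n. m \<ge> N \<Longrightarrow> n \<ge> N \<Longrightarrow> dist ((w \<circ> r) m) ((w \<circ> r) n) < e"
      using LIMSEQ_imp_Cauchy[OF lr(2)] unfolding Cauchy_def by blast
    have "d (\<sigma> m) (\<sigma> n) < e" if "m \<ge> N" "n \<ge> N" for m n
    proof -
      have "d (\<sigma> m) (\<sigma> n) \<le> norm (w (r n) - w (r m))"
        unfolding \<sigma>_def by (rule d_segment[OF s convex_ball w(1) w(1)])
      also have "\<dots> < e" using N[OF that] by (simp add: dist_norm norm_minus_commute)
      finally show ?thesis .
    qed
    then show "\<exists>N. \<forall>n n'. N \<le> n \<longrightarrow> N \<le> n' \<longrightarrow> d (\<sigma> n) (\<sigma> n') < e" by blast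
  qed
  then obtain x where x: "limitin MS.mtopology \<sigma> x sequentially"
    using comp unfolding complete_hypersurface_def MS.mcomplete_def by blast
  then have xM: "x \<in> topspace M" and lim: "\<And>\<epsilon>. \<epsilon> > 0 \<Longrightarrow> \<exists>N. \<forall>n\<ge>N. \<sigma> n \<in> topspace M \<and> d (\<sigma> n) x < \<epsilon>"
    unfolding MS.limit_metric_sequentially by auto
  obtain \<epsilon> t where t: "\<epsilon> > 0" "sect (ball (h x) \<epsilon>) t" "t (h x) = x" by (rule section_at[OF xM])
  obtain N where N: "\<And>n. n \<ge> N \<Longrightarrow> d (\<sigma> n) x < \<epsilon> / 2" using lim[of "\<epsilon> / 2"] t(1) by auto
  obtain k where k: "k \<ge> N" "inverse (real (Suc k)) < \<epsilon> / 2"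
  proof -
    obtain k0 where "inverse (real (Suc k0)) < \<epsilon> / 2" using reals_Archimedean[of "\<epsilon> / 2"] t(1) by auto
    then have "inverse (real (Suc (max N k0))) < \<epsilon> / 2"
      by (rule le_less_trans[rotated]) (simp add: le_imp_inverse_le)
    then show ?thesis by (intro that[of "max N k0"]) auto
  qed
  let ?w = "w (r k)"
  have hw: "h (\<sigma> k) = ?w" using s w(1) by (simp add: \<sigma>_def sect_def)
  have dk: "d x (\<sigma> k) < \<epsilon> / 2" using N[OF k(1)] MS.commute by simp
  have "norm (h (\<sigma> k) - h x) \<le> d x (\<sigma> k)" by (rule d_ge[OF xM \<sigma>M])
  then have near: "dist (h x) ?w < \<epsilon> / 2" using dk hw by (simp add: dist_norm norm_minus_commute)
  have "d x (\<sigma> k) < \<epsilon>" using dk t(1) by simp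
  then obtain L where L: "L \<in> curve_lengths M f x (\<sigma> k)" "L < \<epsilon>" by (rule d_less[OF xM \<sigma>M])
  have tw: "t ?w = s ?w" using curve_stays_in_section(2)[OF L xM t(2,3)] hw by (simp add: \<sigma>_def)
  have "ball ?w (inverse (real (Suc (r k)))) \<subseteq> ball (h x) \<epsilon>"
  proof
    fix v assume "v \<in> ball ?w (inverse (real (Suc (r k))))"
    then have "dist ?w v < inverse (real (Suc (r k)))" by simp
    also have "\<dots> \<le> inverse (real (Suc k))" using seq_suble[OF lr(1), of k] by (simp add: le_imp_inverse_le)
    finally have "dist (h x) v < \<epsilon>" using near k(2) dist_triangle[of "h x" v ?w] by linarith
    then show "v \<in> ball (h x) \<epsilon>" by simp
  qed
  then have "sect (ball ?w (inverse (real (Suc (r k))))) t" by (rule sect_subset[OF t(2)])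
  then show False using w(2) tw by blast
qed

text \<open>A section over a ball therefore extends to a larger concentric ball: pull a point back into the
  ball radially and use the section there.\<close>

lemma section_extends:
  assumes comp: "complete_hypersurface M f" and \<rho>: "\<rho> > 0" and s: "sect (ball a \<rho>) s"
  obtains \<rho>' s' where "\<rho>' > \<rho>" "sect (ball a \<rho>') s'" "s' a = s a"
proof -
  obtain \<eta>0 where \<eta>0: "\<eta>0 > 0" "\<And>w. w \<in> ball a \<rho> \<Longrightarrow> \<exists>t. sect (ball w \<eta>0) t \<and> t w = s w"
    using uniform_section_radius[OF comp s] by blast
  define \<eta> where "\<eta> = \<eta>0 / 2"
  have \<eta>: "\<eta> > 0" "\<eta>0 = 2 * \<eta>" using \<eta>0(1) by (auto simp: \<eta>_def)
  obtain t where t: "\<And>w. w \<in> ball a \<rho> \<Longrightarrow> sect (ball w (2 * \<eta>)) (t w) \<and> t w w = s w" using \<eta>0(2) \<eta>(2) by metis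
  define \<theta> where "\<theta> = \<rho> / (\<rho> + \<eta>)"
  have \<theta>: "0 < \<theta>" "\<theta> < 1" "\<theta> * (\<rho> + \<eta>) = \<rho>" "(1 - \<theta>) * (\<rho> + \<eta>) = \<eta>"
    using \<rho> \<eta> by (auto simp: \<theta>_def field_simps)
  define \<mu> where "\<mu> v = a + \<theta> *\<^sub>R (v - a)" for v
  have \<mu>1: "\<mu> v \<in> ball a \<rho>" if "v \<in> ball a (\<rho> + \<eta>)" for v
  proof -
    have "norm (v - a) < \<rho> + \<eta>" using that by (simp add: dist_norm norm_minus_commute)
    then have "\<theta> * norm (v - a) < \<theta> * (\<rho> + \<eta>)" using \<theta>(1) by simp
    then show ?thesis using \<theta> by (simp add: \<mu>_def dist_norm)
  qed
  have \<mu>2: "dist (\<mu> v) v < \<eta>" if "v \<in> ball a (\<rho> + \<eta>)" for v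
  proof -
    have "norm (v - a) < \<rho> + \<eta>" using that by (simp add: dist_norm norm_minus_commute)
    then have "(1 - \<theta>) * norm (v - a) < (1 - \<theta>) * (\<rho> + \<eta>)" using \<theta>(2) by simp
    moreover have "v - \<mu> v = (1 - \<theta>) *\<^sub>R (v - a)" by (simp add: \<mu>_def algebra_simps)
    then have "dist (\<mu> v) v = (1 - \<theta>) * norm (v - a)" using \<theta>(2) by (simp add: dist_norm norm_minus_commute[of "\<mu> v"])
    ultimately show ?thesis using \<theta>(4) by simp
  qed
  have \<mu>3: "dist (\<mu> v) (\<mu> w) < \<eta>" if "dist v w < \<eta>" for v w
  proof -
    have "\<mu> v - \<mu> w = \<theta> *\<^sub>R (v - w)" by (simp add: \<mu>_def algebra_simps)
    then have "dist (\<mu> v) (\<mu> w) = \<theta> * dist v w" using \<theta>(1) by (simp add: dist_norm)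
    also have "\<dots> \<le> 1 * dist v w" using \<theta> by (intro mult_right_mono) auto
    finally show ?thesis using that by simp
  qed
  have ts: "t w v = s v" if w: "w \<in> ball a \<rho>" and v: "v \<in> ball w (2 * \<eta>) \<inter> ball a \<rho>" for w v
  proof (rule sections_agree[of "ball w (2 * \<eta>)" "t w" "ball a \<rho>" s w v])
    show "connected (ball w (2 * \<eta>) \<inter> ball a \<rho>)" by (intro convex_connected convex_Int convex_ball)
  qed (use t[OF w] s w v \<eta> in auto)
  define s' where "s' v = t (\<mu> v) v" for v
  have "sect (ball a (\<rho> + \<eta>)) s'"
  proof (rule sect_glue)
    fix w1 assume w1: "w1 \<in> ball a (\<rho> + \<eta>)"
    have m1: "\<mu> w1 \<in> ball a \<rho>" by (rule \<mu>1[OF w1])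
    have sub: "ball w1 \<eta> \<subseteq> ball (\<mu> w1) (2 * \<eta>)"
    proof
      fix v assume "v \<in> ball w1 \<eta>"
      then show "v \<in> ball (\<mu> w1) (2 * \<eta>)" using \<mu>2[OF w1] dist_triangle[of "\<mu> w1" v w1] by simp
    qed
    have "s' v = t (\<mu> w1) v" if v: "v \<in> ball w1 \<eta> \<inter> ball a (\<rho> + \<eta>)" for v
    proof -
      have mv: "\<mu> v \<in> ball a \<rho>" using \<mu>1 v by blast
      have "dist (\<mu> w1) (\<mu> v) < \<eta>" using \<mu>3 v by simp
      then have "\<mu> v \<in> ball (\<mu> w1) (2 * \<eta>)" using \<eta> by simp
      then have eq: "t (\<mu> w1) (\<mu> v) = s (\<mu> v)" using ts[OF m1] mv by blast
      have vv: "v \<in> ball (\<mu> v) (2 * \<eta>)" using \<mu>2[of v] v \<eta> by auto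
      show ?thesis
        unfolding s'_def
      proof (rule sections_agree[of "ball (\<mu> v) (2 * \<eta>)" "t (\<mu> v)" "ball (\<mu> w1) (2 * \<eta>)" "t (\<mu> w1)" "\<mu> v" v])
        show "connected (ball (\<mu> v) (2 * \<eta>) \<inter> ball (\<mu> w1) (2 * \<eta>))" by (intro convex_connected convex_Int convex_ball)
      qed (use t[OF mv] t[OF m1] eq vv sub v \<open>\<mu> v \<in> ball (\<mu> w1) (2 * \<eta>)\<close> \<eta> in auto)
    qed
    then show "\<exists>N t. open N \<and> w1 \<in> N \<and> sect N t \<and> (\<forall>v\<in>N \<inter> ball a (\<rho> + \<eta>). s' v = t v)"
      using sect_subset[OF _ sub, of "t (\<mu> w1)"] t[OF m1] \<eta>(1)
      by (intro exI[of _ "ball w1 \<eta>"] exI[of _ "t (\<mu> w1)"] conjI ballI) simp_all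
  qed auto
  moreover have "\<mu> a = a" by (simp add: \<mu>_def)
  then have "s' a = s a" using t[of a] \<rho> by (simp add: s'_def)
  ultimately show ?thesis using that[of "\<rho> + \<eta>" s'] \<eta> by simp
qed

text \<open>The radii of balls around \<open>h x\<close> with a section through \<open>x\<close> cannot have a finite supremum, by
  \<open>section_extends\<close>.\<close>

lemma complete_imp_global_section:
  assumes comp: "complete_hypersurface M f" and x: "x \<in> topspace M"
  obtains s where "sect UNIV s"
proof -
  define Z where "Z = {\<rho>. \<rho> > 0 \<and> (\<exists>t. sect (ball (h x) \<rho>) t \<and> t (h x) = x)}"
  obtain \<epsilon> t0 where "\<epsilon> > 0" "sect (ball (h x) \<epsilon>) t0" "t0 (h x) = x" by (rule section_at[OF x])
  then have "\<epsilon> \<in> Z" by (auto simp: Z_def)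
  then have ne: "Z \<noteq> {}" by blast
  obtain s where s: "sect (\<Union>\<rho>\<in>Z. ball (h x) \<rho>) s" "s (h x) = x"
    using sections_union[of Z "h x" x] ne unfolding Z_def by blast
  show ?thesis
  proof (cases "bdd_above Z")
    case False
    have "w \<in> (\<Union>\<rho>\<in>Z. ball (h x) \<rho>)" for w
    proof -
      obtain \<rho> where "\<rho> \<in> Z" "\<rho> > dist (h x) w" using False unfolding bdd_above_def by (metis not_less)
      then show ?thesis by auto
    qed
    then have "(\<Union>\<rho>\<in>Z. ball (h x) \<rho>) = UNIV" by blast
    then show ?thesis using that s by simp
  next
    case True
    obtain \<rho>0 where \<rho>0: "\<rho>0 \<in> Z" using ne by blast
    have "\<rho>0 \<le> Sup Z" using cSup_upper[OF \<rho>0 True] .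
    then have pos: "Sup Z > 0" using \<rho>0 by (auto simp: Z_def)
    have sub: "ball (h x) (Sup Z) \<subseteq> (\<Union>\<rho>\<in>Z. ball (h x) \<rho>)"
    proof
      fix w assume "w \<in> ball (h x) (Sup Z)"
      then have "dist (h x) w < Sup Z" by simp
      then obtain \<rho> where "\<rho> \<in> Z" "dist (h x) w < \<rho>" using less_cSup_iff[OF ne True] by blast
      then show "w \<in> (\<Union>\<rho>\<in>Z. ball (h x) \<rho>)" by auto
    qed
    obtain \<rho>' s' where "\<rho>' > Sup Z" "sect (ball (h x) \<rho>') s'" "s' (h x) = s (h x)"
      by (rule section_extends[OF comp pos sect_subset[OF s(1) sub]])
    then have "\<rho>' \<in> Z" using pos s(2) unfolding Z_def by auto
    then show ?thesis using cSup_upper[OF _ True] \<open>\<rho>' > Sup Z\<close> by fastforce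
  qed
qed

text \<open>Neither \<open>h\<close> nor a global section increases distances, so Cauchy sequences can be developed and their
  limits carried back.\<close>

lemma global_section_complete:
  assumes s: "sect UNIV s" shows "complete_hypersurface M f"
proof -
  interpret MS: Metric_space "topspace M" d by (rule Metric_space_d)
  have "\<exists>x. limitin MS.mtopology \<sigma> x sequentially" if \<sigma>: "MS.MCauchy \<sigma>" for \<sigma>
  proof -
    have top: "\<sigma> n \<in> topspace M" for n using \<sigma> unfolding MS.MCauchy_def by auto
    have "Cauchy (\<lambda>n. h (\<sigma> n))"
      unfolding Cauchy_def
    proof (intro allI impI)
      fix e :: real assume "e > 0"
      then obtain N where N: "\<And>m n. N \<le> m \<Longrightarrow> N \<le> n \<Longrightarrow> d (\<sigma> m) (\<sigma> n) < e" using \<sigma> unfolding MS.MCauchy_def by blast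
      have "dist (h (\<sigma> m)) (h (\<sigma> n)) < e" if "N \<le> m" "N \<le> n" for m n
        using N[OF that(2,1)] d_ge[OF top[of n] top[of m]] by (simp add: dist_norm)
      then show "\<exists>M. \<forall>m\<ge>M. \<forall>n\<ge>M. dist (h (\<sigma> m)) (h (\<sigma> n)) < e" by blast
    qed
    then obtain l where l: "(\<lambda>n. h (\<sigma> n)) \<longlonglongrightarrow> l" using Cauchy_convergent convergent_def by blast
    have "\<exists>N. \<forall>n\<ge>N. \<sigma> n \<in> topspace M \<and> d (\<sigma> n) (s l) < e" if e: "e > 0" for e
    proof -
      obtain N where N: "\<And>n. n \<ge> N \<Longrightarrow> dist (h (\<sigma> n)) l < e" using l e unfolding LIMSEQ_def by blast
      have "d (\<sigma> n) (s l) < e" if "n \<ge> N" for n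
      proof -
        have "d (s (h (\<sigma> n))) (s l) \<le> norm (l - h (\<sigma> n))" by (rule d_segment[OF s]) auto
        then show ?thesis using N[OF that] global_section_homeomorphic(2)[OF s top] by (simp add: dist_norm norm_minus_commute)
      qed
      then show ?thesis using top by blast
    qed
    then have "limitin MS.mtopology \<sigma> (s l) sequentially"
      unfolding MS.limit_metric_sequentially using sect_topspace[OF s] by blast
    then show ?thesis by blast
  qed
  then show ?thesis unfolding complete_hypersurface_def MS.mcomplete_def by blast
qed

end

text \<open>Completeness gives a global inverse of the coordinates \<open>h\<close> of \<open>f\<close>, and \<open>f\<close> is \<open>h\<close> followed by the
  isometric embedding of the hyperplane.\<close>

lemma (in hypersurface_chart) in_hyperplane_complete_imp_homeomorphic:
  assumes \<nu>: "\<nu> \<noteq> 0" and sub: "\<And>x. x \<in> topspace M \<Longrightarrow> f x \<in> hyperplane p \<nu>"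
    and comp: "complete_hypersurface M f" and ne: "topspace M \<noteq> {}"
  shows "homeomorphic_map M (top_of_set (hyperplane p \<nu>)) f"
proof -
  obtain A :: "real^'n \<Rightarrow> real^'d" and B where A: "linear A" "linear B" "\<And>w. norm (A w) = norm w" "\<And>w. B (A w) = w"
    "range A = {y. y \<bullet> \<nu> = 0}" "\<And>y. y \<bullet> \<nu> = 0 \<Longrightarrow> A (B y) = y"
    by (rule hyperplane_isometry[OF \<nu> card_d]) blast
  have linA: "bounded_linear A" and linB: "bounded_linear B" using A linear_conv_bounded_linear by blast+
  define h where "h x = B (f x - p)" for x
  have f_eq: "f x = p + A (h x)" if "x \<in> topspace M" for x
    using A(6)[of "f x - p"] sub[OF that] by (simp add: h_def hyperplane_def)
  have cont_h: "continuous_map M euclidean h"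
  proof -
    have "continuous_on UNIV (\<lambda>y. B (y - p))" by (intro bounded_linear.continuous_on[OF linB] continuous_intros)
    then have "continuous_map euclidean euclidean (\<lambda>y. B (y - p))" by simp
    from continuous_map_compose[OF continuous_f this] show ?thesis by (simp add: comp_def h_def[abs_def])
  qed
  interpret D: flat_development M f h p A
  proof
    fix x assume x: "x \<in> topspace M"
    obtain U where U: "openin M U" "x \<in> U" "inj_on f U"
      by (rule f_locally_injective[OF x openin_topspace]) blast
    have injU: "inj_on h U"
    proof (rule inj_onI)
      fix y z assume yz: "y \<in> U" "z \<in> U" "h y = h z"
      have "y \<in> topspace M" "z \<in> topspace M" using yz openin_subset[OF U(1)] by auto
      then have "f y = f z" using f_eq yz(3) by simp
      then show "y = z" using U(3) yz by (simp add: inj_on_def)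
    qed
    obtain \<epsilon> where \<epsilon>: "\<epsilon> > 0" "ball (h x) \<epsilon> \<subseteq> h ` U"
      using open_image_if_injective[OF cont_h injU U(1)] U(2) open_contains_ball by blast
    define t where "t = inv_into U h"
    have t: "t w \<in> U" "h (t w) = w" if "w \<in> ball (h x) \<epsilon>" for w
      using that \<epsilon>(2) by (auto simp: t_def inv_into_into f_inv_into_f)
    have th: "t (h y) = y" if "y \<in> U" for y using that injU by (simp add: t_def)
    have "continuous_map (top_of_set (ball (h x) \<epsilon>)) M t"
      unfolding t_def by (rule continuous_inv_into[OF cont_h injU U(1) open_ball \<epsilon>(2)])
    moreover have "openin M (t ` ball (h x) \<epsilon>)"
    proof -
      have "openin M {y \<in> topspace M. h y \<in> ball (h x) \<epsilon>}"
        by (rule openin_continuous_map_preimage[OF cont_h]) simp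
      then have "openin M (U \<inter> {y \<in> topspace M. h y \<in> ball (h x) \<epsilon>})" using U(1) by (intro openin_Int)
      moreover have "U \<inter> {y \<in> topspace M. h y \<in> ball (h x) \<epsilon>} = t ` ball (h x) \<epsilon>"
      proof
        show "U \<inter> {y \<in> topspace M. h y \<in> ball (h x) \<epsilon>} \<subseteq> t ` ball (h x) \<epsilon>"
        proof
          fix y assume y: "y \<in> U \<inter> {y \<in> topspace M. h y \<in> ball (h x) \<epsilon>}"
          then have "t (h y) = y" "h y \<in> ball (h x) \<epsilon>" using th by auto
          then show "y \<in> t ` ball (h x) \<epsilon>" by (metis imageI)
        qed
        show "t ` ball (h x) \<epsilon> \<subseteq> U \<inter> {y \<in> topspace M. h y \<in> ball (h x) \<epsilon>}" using t openin_subset[OF U(1)] by auto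
      qed
      ultimately show ?thesis by simp
    qed
    ultimately show "\<exists>\<epsilon>>0. \<exists>t. continuous_map (top_of_set (ball (h x) \<epsilon>)) M t \<and> (\<forall>w\<in>ball (h x) \<epsilon>. h (t w) = w) \<and> t (h x) = x \<and> openin M (t ` ball (h x) \<epsilon>)"
      using \<epsilon>(1) t(2) th[OF U(2)] by (intro exI[of _ \<epsilon>] conjI exI[of _ t]) auto
  qed (use Hausdorff_M connected_M A(3) f_eq cont_h in \<open>auto simp: linear_add[OF A(1)] linear_cmul[OF A(1)]\<close>)
  obtain x0 where x0: "x0 \<in> topspace M" using ne by blast
  obtain s where s: "D.sect UNIV s" by (rule D.complete_imp_global_section[OF comp x0])
  note hh = D.global_section_homeomorphic[OF s]
  have "homeomorphic_maps M (top_of_set (hyperplane p \<nu>)) f (s \<circ> (\<lambda>y. B (y - p)))"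
    unfolding homeomorphic_maps_def
  proof (intro conjI ballI)
    show "continuous_map M (top_of_set (hyperplane p \<nu>)) f"
      using continuous_f sub by (auto simp: continuous_map_in_subtopology)
    have "continuous_on (hyperplane p \<nu>) (\<lambda>y. B (y - p))" by (intro bounded_linear.continuous_on[OF linB] continuous_intros)
    then have "continuous_map (top_of_set (hyperplane p \<nu>)) euclidean (\<lambda>y. B (y - p))" by simp
    moreover have "continuous_map euclidean M s" using s by (simp add: D.sect_def)
    ultimately show "continuous_map (top_of_set (hyperplane p \<nu>)) M (s \<circ> (\<lambda>y. B (y - p)))" by (rule continuous_map_compose)
    show "(s \<circ> (\<lambda>y. B (y - p))) (f x) = x" if "x \<in> topspace M" for x
      using hh(2)[OF that] by (simp add: h_def)
    show "f ((s \<circ> (\<lambda>y. B (y - p))) y) = y" if "y \<in> topspace (top_of_set (hyperplane p \<nu>))" for y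
    proof -
      have "s (B (y - p)) \<in> topspace M" "h (s (B (y - p))) = B (y - p)"
        using D.sect_topspace[OF s] s by (auto simp: D.sect_def)
      then have "f (s (B (y - p))) = p + A (B (y - p))" using f_eq by simp
      also have "A (B (y - p)) = y - p" using that by (intro A(6)) (simp add: hyperplane_def)
      finally show ?thesis by simp
    qed
  qed
  then show ?thesis by (metis homeomorphic_maps_map)
qed

section \<open>Hyperplanes as hypersurfaces\<close>

lemma C_k_on_affine:
  fixes L :: "real^'n \<Rightarrow> 'b::real_normed_vector"
  assumes "linear L" shows "C_k_on k (\<lambda>w. c + L w) S"
  using assms
proof (induction k arbitrary: L c)
  case 0
  then have "bounded_linear L" by (simp add: linear_conv_bounded_linear)
  then have "continuous_on S (\<lambda>w. c + L w)"
    by (intro continuous_on_add continuous_on_const linear_continuous_on)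
  then show ?case by simp
next
  case (Suc k)
  have der: "((\<lambda>w. c + L w) has_derivative L) (at u)" for u
    using Suc.prems by (auto intro!: derivative_eq_intros linear_imp_has_derivative)
  then have "(\<lambda>w. c + L w) differentiable_on S"
    by (meson differentiableI differentiable_at_imp_differentiable_on)
  moreover have "C_k_on k (partial_deriv i (\<lambda>w. c + L w)) S" for i
  proof -
    have "partial_deriv i (\<lambda>w. c + L w) = (\<lambda>w. L (axis i 1) + 0)"
      using partial_deriv_eq[OF der] by auto
    then show ?thesis using Suc.IH[of "\<lambda>_. 0" "L (axis i 1)"] by (simp add: linear_zero)
  qed
  ultimately show ?case by simp
qed

lemma second_countable_euclidean:
  "second_countable (euclidean :: 'b::second_countable_topology topology)"
proof -
  obtain \<B> :: "'b set set" where \<B>: "countable \<B>" "topological_basis \<B>"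
    using ex_countable_basis[where 'a = 'b] by auto
  show ?thesis
    unfolding second_countable_def
  proof (intro exI[of _ \<B>] conjI allI ballI impI)
    show "countable \<B>" by (rule \<B>(1))
    show "openin euclidean V" if "V \<in> \<B>" for V using topological_basis_open[OF \<B>(2) that] by simp
    fix U and x :: 'b
    assume "openin euclidean U \<and> x \<in> U"
    then have "open U" "x \<in> U" by auto
    then obtain V where "V \<in> \<B>" "x \<in> V" "V \<subseteq> U" by (rule topological_basisE[OF \<B>(2)])
    then show "\<exists>V\<in>\<B>. x \<in> V \<and> V \<subseteq> U" by (intro bexI[of _ V] conjI)
  qed
qed

text \<open>The inverse \<open>s\<close> of the coordinates of \<open>f\<close> in the hyperplane is a single chart for the whole
  hypersurface. The unit normal is \<open>\<nu>\<close>, and \<open>A\<close> and \<open>B\<close> are as in \<open>hyperplane_isometry\<close>.\<close>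

locale planar_hypersurface =
  fixes T :: "'n::finite itself" and M :: "'a topology" and f :: "'a \<Rightarrow> real^'d" and p \<nu> :: "real^'d"
    and A :: "real^'n \<Rightarrow> real^'d" and B :: "real^'d \<Rightarrow> real^'n" and s :: "real^'n \<Rightarrow> 'a"
  assumes card_d: "CARD('d) = CARD('n) + 1" and card_n: "CARD('n) \<ge> 3" and norm_\<nu>: "norm \<nu> = 1"
    and A: "linear A" "linear B" "\<And>w. norm (A w) = norm w" "\<And>w. B (A w) = w"
      "\<And>w. A w \<bullet> \<nu> = 0" "\<And>y. y \<bullet> \<nu> = 0 \<Longrightarrow> A (B y) = y"
    and in_plane: "\<And>x. x \<in> topspace M \<Longrightarrow> (f x - p) \<bullet> \<nu> = 0"
    and hs: "homeomorphic_maps M euclidean (\<lambda>x. B (f x - p)) s"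
begin

definition "h x = B (f x - p)"

lemma h_maps: "continuous_map M euclidean h" "continuous_map euclidean M s"
    "\<And>x. x \<in> topspace M \<Longrightarrow> s (h x) = x" "\<And>w. h (s w) = w" "\<And>w. s w \<in> topspace M"
proof -
  have hs': "homeomorphic_maps M euclidean h s" using hs by (simp add: h_def[abs_def])
  then show "continuous_map M euclidean h" and c: "continuous_map euclidean M s"
    and "\<And>x. x \<in> topspace M \<Longrightarrow> s (h x) = x" "\<And>w. h (s w) = w"
    by (auto simp: homeomorphic_maps_def)
  show "s w \<in> topspace M" for w using continuous_map_image_subset_topspace[OF c] by auto
qed

lemma f_eq: "x \<in> topspace M \<Longrightarrow> f x = p + A (h x)"
  using A(6)[OF in_plane] by (simp add: h_def)

lemma f_s: "f (s w) = p + A w"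
  using f_eq[OF h_maps(5)] h_maps(4) by simp

lemma open_s: "open U \<Longrightarrow> openin M (s ` U)"
proof -
  assume U: "open U"
  have "openin M {x \<in> topspace M. h x \<in> U}" by (rule openin_continuous_map_preimage[OF h_maps(1)]) (simp add: U)
  moreover have "{x \<in> topspace M. h x \<in> U} = s ` U"
    using h_maps(3-5) by (auto intro!: image_eqI[of _ s, OF h_maps(3)[symmetric]])
  ultimately show ?thesis by simp
qed

lemma compact_s: "compact C \<Longrightarrow> compactin M (s ` C)"
  using image_compactin[OF _ h_maps(2)] by simp

lemma s_image: "{x \<in> topspace M. h x \<in> C} = s ` C"
  using h_maps(3-5) by (auto intro!: image_eqI[of _ s, OF h_maps(3)[symmetric]])

lemma homeomorphic_M: "M homeomorphic_space (euclidean :: (real^'n) topology)"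
  using hs by (auto simp: homeomorphic_space_def)

lemma chart_s: "local_param k M f UNIV s"
proof -
  have "s ` UNIV = topspace M" using s_image[of UNIV] by simp
  then have "openin M (s ` UNIV)" by simp
  moreover have "embedding_map (top_of_set UNIV) M s"
  proof (rule injective_open_imp_embedding_map)
    show "continuous_map (top_of_set UNIV) M s" using h_maps(2) by simp
    show "open_map (top_of_set UNIV) M s" using open_s by (simp add: open_map_def)
    show "inj_on s (topspace (top_of_set UNIV))" by (metis h_maps(4) inj_onI)
  qed
  moreover have fs: "f \<circ> s = (\<lambda>w. p + A w)" by (simp add: fun_eq_iff f_s)
  then have "C_k_on k (f \<circ> s) UNIV" using C_k_on_affine[OF A(1)] by simp
  moreover have "inj (frechet_derivative (f \<circ> s) (at u))" for u
  proof -
    have "((\<lambda>w. p + A w) has_derivative A) (at u)"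
      using A(1) by (auto intro!: derivative_eq_intros linear_imp_has_derivative)
    then have "frechet_derivative (f \<circ> s) (at u) = A" unfolding fs by (metis frechet_derivative_at)
    moreover have "inj A" by (metis A(4) injI)
    ultimately show ?thesis by simp
  qed
  ultimately show ?thesis by (simp add: local_param_def)
qed

lemma is_hypersurface: "hypersurface T k M f"
  unfolding hypersurface_def
proof (intro conjI ballI)
  show "CARD('d) = CARD('n) + 1" by (rule card_d)
  show "connected_space M"
    using homeomorphic_connected_space[OF homeomorphic_M] connectedin_topspace[of "euclidean :: (real^'n) topology"]
      connected_UNIV[where 'a = "real^'n"]
    by (simp only: connectedin_iff_connected topspace_euclidean)
  show "Hausdorff_space M" using homeomorphic_Hausdorff_space[OF homeomorphic_M] by simp
  show "second_countable M"
    using homeomorphic_space_second_countability[OF homeomorphic_M] second_countable_euclidean by simp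
  fix x assume "x \<in> topspace M"
  then have "x \<in> s ` UNIV" using s_image[of UNIV] by simp
  then show "\<exists>V (\<phi> :: real^'n \<Rightarrow> 'a). local_param k M f V \<phi> \<and> x \<in> \<phi> ` V" using chart_s by blast
qed

lemma is_complete: "complete_hypersurface M f"
proof -
  interpret D: flat_development M f h p A
  proof
    show "Hausdorff_space M" "connected_space M" using is_hypersurface by (auto simp: hypersurface_def)
    fix x assume x: "x \<in> topspace M"
    have "continuous_map (top_of_set (ball (h x) 1)) M s" using h_maps(2) by (rule continuous_map_from_subtopology)
    then show "\<exists>\<epsilon>>0. \<exists>t. continuous_map (top_of_set (ball (h x) \<epsilon>)) M t \<and> (\<forall>w\<in>ball (h x) \<epsilon>. h (t w) = w) \<and> t (h x) = x \<and> openin M (t ` ball (h x) \<epsilon>)"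
      using h_maps(3)[OF x] h_maps(4) open_s by (intro exI[of _ 1] conjI exI[of _ s]) auto
  qed (use A(3) f_eq h_maps(1) in \<open>auto simp: linear_add[OF A(1)] linear_cmul[OF A(1)]\<close>)
  show ?thesis by (rule D.global_section_complete[of s]) (use h_maps in \<open>simp add: D.sect_def\<close>)
qed

text \<open>A compact set lies in the preimage of a ball, and the complement of a ball is connected in
  dimension at least two. All other components of the complement stay in that preimage.\<close>

lemma is_one_ended: "one_ended M"
  unfolding one_ended_def
proof (intro allI impI)
  fix K assume K: "compactin M K"
  let ?Y = "subtopology M (topspace M - K)"
  have "compact (h ` K)" using image_compactin[OF K h_maps(1)] by simp
  then have "bounded (h ` K)" by (rule compact_imp_bounded)
  then obtain R where R: "R > 0" "\<And>x. x \<in> K \<Longrightarrow> norm (h x) < R" unfolding bounded_pos_less by auto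
  define Out where "Out = {x \<in> topspace M. h x \<in> - cball 0 R}"
  have Out_s: "Out = s ` (- cball 0 R)" unfolding Out_def by (rule s_image)
  have "connected (- cball (0::real^'n) R)" using card_n by (intro connected_complement_bounded_convex) auto
  then have "connectedin M Out" unfolding Out_s using connectedin_continuous_map_image[OF h_maps(2)] by simp
  moreover have "Out \<subseteq> topspace M - K" using R(2) by (force simp: Out_def)
  ultimately have cO: "connectedin ?Y Out" by (simp add: connectedin_subtopology)
  have far: "s w \<in> Out" if "norm w > R" for w using that h_maps(4,5) by (simp add: Out_def)
  define w0 :: "real^'n" where "w0 = (R + 1) *\<^sub>R axis undefined 1"
  have w0: "norm w0 = R + 1" using R(1) by (simp add: w0_def)
  then have x0: "s w0 \<in> Out" by (intro far) simp
  then have "?Y \<noteq> trivial_topology"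
    using connectedin_subset_topspace[OF cO] by (metis empty_iff null_topspace_iff_trivial subsetD)
  with cO obtain C where C: "C \<in> connected_components_of ?Y" "Out \<subseteq> C"
    using exists_connected_component_of_superset[of ?Y Out] by auto
  have nC: "\<not> compactin M (M closure_of C)"
  proof
    assume "compactin M (M closure_of C)"
    then have "compact (h ` (M closure_of C))" using image_compactin[OF _ h_maps(1)] by simp
    then have "bounded (h ` (M closure_of C))" by (rule compact_imp_bounded)
    then obtain b where b: "\<forall>y\<in>h ` (M closure_of C). norm y \<le> b" unfolding bounded_iff ..
    define w1 :: "real^'n" where "w1 = (max b R + 1) *\<^sub>R axis undefined 1"
    have w1: "norm w1 = max b R + 1" using R(1) by (simp add: w1_def)
    then have "s w1 \<in> C" using far[of w1] C(2) by auto
    moreover have "C \<subseteq> M closure_of C"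
      by (rule closure_of_subset) (use connected_components_of_subset[OF C(1)] in auto)
    ultimately have "h (s w1) \<in> h ` (M closure_of C)" by blast
    then have "norm w1 \<le> b" using b h_maps(4) by auto
    then show False using w1 by linarith
  qed
  show "\<exists>!C. C \<in> connected_components_of ?Y \<and> \<not> compactin M (M closure_of C)"
  proof (intro ex1I[of _ C] conjI C(1) nC)
    fix D assume D: "D \<in> connected_components_of ?Y \<and> \<not> compactin M (M closure_of D)"
    have "D \<inter> Out \<noteq> {}"
    proof
      assume e: "D \<inter> Out = {}"
      have DM: "D \<subseteq> topspace M" using connected_components_of_subset[of D ?Y] D by auto
      have comp: "compactin M (s ` cball 0 R)" by (intro compact_s compact_cball)
      have "D \<subseteq> {x \<in> topspace M. h x \<in> cball 0 R}" using e DM by (auto simp: Out_def)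
      then have "D \<subseteq> s ` cball 0 R" by (simp only: s_image)
      moreover have "closedin M (s ` cball 0 R)"
        using comp is_hypersurface[of 0] by (simp add: compactin_imp_closedin hypersurface_def)
      ultimately have "M closure_of D \<subseteq> s ` cball 0 R" by (rule closure_of_minimal)
      then have "compactin M (M closure_of D)" using closed_compactin[OF comp] closedin_closure_of by blast
      then show False using D by blast
    qed
    then show "D = C" using C D connected_components_of_overlap[of D ?Y C] by blast
  qed
qed

text \<open>In every chart the derivatives of \<open>f\<close> are orthogonal to the constant normal \<open>\<nu>\<close>, so the second
  fundamental form vanishes.\<close>

lemma is_scalar_flat: "scalar_flat T (CARD('n) + 1) M f"
  unfolding scalar_flat_def
proof (intro allI impI ballI)
  fix V and \<phi> :: "real^'n \<Rightarrow> 'a" and u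
  assume lp: "local_param (CARD('n) + 1) M f V \<phi>" and u: "u \<in> V"
  interpret C: hypersurface_chart T M f using is_hypersurface card_n by unfold_locales
  interpret I: immersion "f \<circ> \<phi>" V using C.chart_immersion[OF lp] .
  have inM: "\<phi> v \<in> topspace M" if "v \<in> V" for v
    using openin_subset[OF C.chartD(4)[OF lp]] that by auto
  have N1: "\<nu> \<bullet> partial_deriv i (f \<circ> \<phi>) v = 0" if v: "v \<in> V" for v i
  proof -
    have "partial_deriv i (\<lambda>v. \<nu> \<bullet> (f \<circ> \<phi>) v) v = partial_deriv i (\<lambda>v. \<nu> \<bullet> p) v"
    proof (rule partial_deriv_cong[OF I.open_V v])
      show "\<nu> \<bullet> (f \<circ> \<phi>) v = \<nu> \<bullet> p" if "v \<in> V" for v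
        using in_plane[OF inM[OF that]] by (simp add: inner_diff_left inner_commute[of \<nu>])
      show "(\<lambda>v. \<nu> \<bullet> (f \<circ> \<phi>) v) differentiable (at v)"
        by (rule differentiable_inner[OF differentiable_const I.differentiable(1)[OF v]])
    qed
    moreover have "partial_deriv i (\<lambda>v. \<nu> \<bullet> (f \<circ> \<phi>) v) v = \<nu> \<bullet> partial_deriv i (f \<circ> \<phi>) v"
      using partial_deriv_inner[OF differentiable_const I.differentiable(1)[OF v], of i \<nu>]
      by (simp add: partial_deriv_def)
    ultimately show ?thesis by (simp add: partial_deriv_def)
  qed
  have N2: "\<nu> \<bullet> partial_deriv j (partial_deriv i (f \<circ> \<phi>)) u = 0" for i j
  proof -
    have "partial_deriv j (\<lambda>v. \<nu> \<bullet> partial_deriv i (f \<circ> \<phi>) v) u = partial_deriv j (\<lambda>v. 0 :: real) u"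
      by (rule partial_deriv_cong[OF I.open_V u N1 differentiable_inner[OF differentiable_const I.differentiable(2)[OF u]]])
    moreover have "partial_deriv j (\<lambda>v. \<nu> \<bullet> partial_deriv i (f \<circ> \<phi>) v) u = \<nu> \<bullet> partial_deriv j (partial_deriv i (f \<circ> \<phi>)) u"
      using partial_deriv_inner[OF differentiable_const I.differentiable(2)[OF u], of j \<nu> i]
      by (simp add: partial_deriv_def)
    ultimately show ?thesis by (simp add: partial_deriv_def)
  qed
  show "scalar_curvature (induced_metric (f \<circ> \<phi>)) u = 0"
  proof (rule I.scalar_curvature_eq_0_if_B[OF u])
    fix i j
    have "I.B i j u = (I.B i j u \<bullet> \<nu>) *\<^sub>R \<nu>"
      by (rule I.normal_line[OF u card_d norm_\<nu> N1[OF u] I.B_orthogonal[OF u]])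
    moreover have "\<nu> \<bullet> I.B i j u = 0" using I.inner_normal_B[of \<nu> u i j] N1[OF u] N2 by simp
    ultimately show "I.B i j u = 0" by (simp add: inner_commute)
  qed
qed

text \<open>The rotations preserve the hyperplane, so they act on \<open>M\<close> through the chart \<open>s\<close>.\<close>

lemma is_rotationally_symmetric: "rotationally_symmetric_outside_compact M f"
proof -
  define \<Phi> where "\<Phi> Q x = s (B (Q *v (f x - p)))" for Q :: "real^'d^'d" and x
  have Q\<nu>: "(Q *v y) \<bullet> \<nu> = 0" if "Q \<in> rotations_fixing \<nu>" "y \<bullet> \<nu> = 0" for Q y
  proof -
    have "(Q *v y) \<bullet> \<nu> = y \<bullet> (transpose Q *v \<nu>)"
      by (metis dot_lmul_matrix inner_commute transpose_matrix_vector)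
    also have "transpose Q *v \<nu> = \<nu>"
      using rotations_fixing_group(3)[OF that(1)] by (simp add: rotations_fixing_def del: transpose_matrix_vector)
    finally show ?thesis using that(2) by simp
  qed
  have f\<Phi>: "f (\<Phi> Q x) = p + Q *v (f x - p)" if "Q \<in> rotations_fixing \<nu>" "x \<in> topspace M" for Q x
    using A(6)[OF Q\<nu>[OF that(1) in_plane[OF that(2)]]] by (simp add: \<Phi>_def f_s)
  have linB: "bounded_linear B" and linA: "bounded_linear A" using A linear_conv_bounded_linear by blast+
  have cont: "continuous_map (prod_topology (top_of_set (rotations_fixing \<nu>)) M) M (\<lambda>(Q, x). \<Phi> Q x)"
  proof -
    let ?P = "prod_topology (top_of_set (rotations_fixing \<nu>)) M"
    have "continuous_map ?P euclidean (\<lambda>q. fst q)"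
      using continuous_map_into_fulltopology continuous_map_fst by blast
    moreover have "continuous_map ?P euclidean (\<lambda>q. h (snd q))"
      using continuous_map_compose[OF continuous_map_snd h_maps(1)] by (simp add: comp_def)
    ultimately have "continuous_map ?P (prod_topology euclidean euclidean) (\<lambda>q. (fst q, h (snd q)))"
      by (rule continuous_map_pairedI)
    then have 1: "continuous_map ?P euclidean (\<lambda>q. (fst q, h (snd q)))" by simp
    have "continuous_on UNIV (\<lambda>q :: (real^'d^'d) \<times> (real^'n). B (fst q *v A (snd q)))"
      unfolding matrix_vector_mult_def
      by (intro bounded_linear.continuous_on[OF linB] continuous_on_vec_lambda continuous_intros
          bounded_linear.continuous_on[OF linA])
    then have 2: "continuous_map euclidean euclidean (\<lambda>q :: (real^'d^'d) \<times> (real^'n). B (fst q *v A (snd q)))" by simp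
    have "continuous_map ?P M (s \<circ> ((\<lambda>q. B (fst q *v A (snd q))) \<circ> (\<lambda>q. (fst q, h (snd q)))))"
      by (rule continuous_map_compose[OF continuous_map_compose[OF 1 2] h_maps(2)])
    then show ?thesis
      by (rule continuous_map_eq) (use f_eq in \<open>auto simp: \<Phi>_def\<close>)
  qed
  show ?thesis
    unfolding rotationally_symmetric_outside_compact_def Let_def
  proof (rule exI[of _ p], rule exI[of _ \<nu>], rule exI[of _ "{}"], rule exI[of _ \<Phi>], intro conjI ballI)
    show "norm \<nu> = 1" by (rule norm_\<nu>)
    show "compactin M {}" by simp
    show "continuous_map (prod_topology (top_of_set (rotations_fixing \<nu>)) (subtopology M (topspace M - {})))
        (subtopology M (topspace M - {})) (\<lambda>(A, x). \<Phi> A x)"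
      using cont by (simp add: subtopology_topspace)
    show "\<Phi> (mat 1) x = x" if "x \<in> topspace (subtopology M (topspace M - {}))" for x
      using that h_maps(3) by (simp add: \<Phi>_def flip: h_def)
    show "\<Phi> (Q ** R) x = \<Phi> Q (\<Phi> R x)"
      if "Q \<in> rotations_fixing \<nu>" "R \<in> rotations_fixing \<nu>" "x \<in> topspace (subtopology M (topspace M - {}))" for Q R x
      using f\<Phi>[OF that(2), of x] that(3) unfolding \<Phi>_def[of Q] \<Phi>_def[of "Q ** R"]
      by (simp add: matrix_vector_mul_assoc)
    show "f (\<Phi> Q x) = p + Q *v (f x - p)"
      if "Q \<in> rotations_fixing \<nu>" "x \<in> topspace (subtopology M (topspace M - {}))" for Q x
      using f\<Phi>[OF that(1)] that(2) by simp
  qed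
qed

end

lemma homeomorphic_hyperplane_imp_planar:
  assumes d: "CARD('d) = CARD('n::finite) + 1" and n: "CARD('n) \<ge> 3"
    and \<nu>: "\<nu> \<noteq> 0" and f: "homeomorphic_map M (top_of_set (hyperplane p \<nu>)) (f :: 'a \<Rightarrow> real^'d)"
  shows "\<exists>(A :: real^'n \<Rightarrow> real^'d) B s. planar_hypersurface M f p (\<nu> /\<^sub>R norm \<nu>) A B s"
proof -
  obtain A :: "real^'n \<Rightarrow> real^'d" and B where A: "linear A" "linear B" "\<And>w. norm (A w) = norm w" "\<And>w. B (A w) = w"
    "range A = {y. y \<bullet> \<nu> = 0}" "\<And>y. y \<bullet> \<nu> = 0 \<Longrightarrow> A (B y) = y"
    by (rule hyperplane_isometry[OF \<nu> d]) blast
  have linA: "bounded_linear A" and linB: "bounded_linear B" using A linear_conv_bounded_linear by blast+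
  obtain g where g: "homeomorphic_maps M (top_of_set (hyperplane p \<nu>)) f g"
    using f by (auto simp: homeomorphic_map_maps)
  have A\<nu>: "A w \<bullet> \<nu> = 0" for w using A(5) by auto
  have cf: "continuous_map M euclidean f" "\<And>x. x \<in> topspace M \<Longrightarrow> (f x - p) \<bullet> \<nu> = 0"
    using g by (auto simp: homeomorphic_maps_def continuous_map_in_subtopology hyperplane_def)
  have "planar_hypersurface M f p (\<nu> /\<^sub>R norm \<nu>) A B (\<lambda>w. g (p + A w))"
  proof
    show "homeomorphic_maps M euclidean (\<lambda>x. B (f x - p)) (\<lambda>w. g (p + A w))"
      unfolding homeomorphic_maps_def
    proof (intro conjI ballI)
      have "continuous_on UNIV (\<lambda>y. B (y - p))" by (intro bounded_linear.continuous_on[OF linB] continuous_intros)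
      then have "continuous_map euclidean euclidean (\<lambda>y. B (y - p))" by simp
      from continuous_map_compose[OF cf(1) this] show "continuous_map M euclidean (\<lambda>x. B (f x - p))" by (simp add: comp_def)
      have "continuous_on UNIV (\<lambda>w. p + A w)" by (intro bounded_linear.continuous_on[OF linA] continuous_intros)
      then have "continuous_map euclidean (top_of_set (hyperplane p \<nu>)) (\<lambda>w. p + A w)"
        using A\<nu> by (simp add: continuous_map_in_subtopology hyperplane_def)
      moreover have "continuous_map (top_of_set (hyperplane p \<nu>)) M g" using g by (simp add: homeomorphic_maps_def)
      ultimately have "continuous_map euclidean M (g \<circ> (\<lambda>w. p + A w))" by (rule continuous_map_compose)
      then show "continuous_map euclidean M (\<lambda>w. g (p + A w))" by (simp add: comp_def)
      show "g (p + A (B (f x - p))) = x" if "x \<in> topspace M" for x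
        using A(6)[OF cf(2)[OF that]] g that by (simp add: homeomorphic_maps_def)
      show "B (f (g (p + A w)) - p) = w" for w
        using g A\<nu>[of w] A(4) by (simp add: homeomorphic_maps_def hyperplane_def)
    qed
  qed (use d n \<nu> A A\<nu> cf(2) in \<open>auto simp: linear_add linear_cmul\<close>)
  then show ?thesis by blast
qed

theorem theorem4:
  assumes n: "CARD('n::finite) \<ge> 3"
    and d: "CARD('d::finite) = CARD('n) + 1"
  shows
    "\<not> (\<exists>(M :: 'a topology) (f :: 'a \<Rightarrow> real^'d).
          hypersurface TYPE('n) (CARD('n) + 1) M f \<and> complete_hypersurface M f \<and> one_ended M \<and>
          scalar_flat TYPE('n) (CARD('n) + 1) M f \<and>
          (\<exists>m>0. schwarzschild_outside_compact CARD('n) m M f))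
     \<and>
     (\<forall>(M :: 'a topology) (f :: 'a \<Rightarrow> real^'d).
          hypersurface TYPE('n) (CARD('n) + 1) M f \<and> complete_hypersurface M f \<and> one_ended M \<and>
          scalar_flat TYPE('n) (CARD('n) + 1) M f \<and>
          rotationally_symmetric_outside_compact M f
          \<longleftrightarrow>
          (\<exists>p \<nu>. \<nu> \<noteq> 0 \<and> homeomorphic_map M (top_of_set (hyperplane p \<nu>)) f))"
proof (intro conjI notI allI iffI)
  assume "\<exists>(M :: 'a topology) (f :: 'a \<Rightarrow> real^'d).
          hypersurface TYPE('n) (CARD('n) + 1) M f \<and> complete_hypersurface M f \<and> one_ended M \<and>
          scalar_flat TYPE('n) (CARD('n) + 1) M f \<and>
          (\<exists>m>0. schwarzschild_outside_compact CARD('n) m M f)"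
  then obtain M :: "'a topology" and f :: "'a \<Rightarrow> real^'d" and m
    where M: "hypersurface TYPE('n) (CARD('n) + 1) M f" "one_ended M" "scalar_flat TYPE('n) (CARD('n) + 1) M f"
      "m > 0" "schwarzschild_outside_compact CARD('n) m M f" by blast
  interpret scalar_flat_hypersurface "TYPE('n)" M f using M n by unfold_locales
  show False by (rule no_schwarzschild_end[OF M(2,4,5)])
next
  fix M :: "'a topology" and f :: "'a \<Rightarrow> real^'d"
  assume M: "hypersurface TYPE('n) (CARD('n) + 1) M f \<and> complete_hypersurface M f \<and> one_ended M \<and>
          scalar_flat TYPE('n) (CARD('n) + 1) M f \<and> rotationally_symmetric_outside_compact M f"
  then obtain p \<nu> K \<Phi> where rot: "norm \<nu> = 1" "compactin M K"
    "continuous_map (prod_topology (top_of_set (rotations_fixing \<nu>)) (subtopology M (topspace M - K)))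
        (subtopology M (topspace M - K)) (\<lambda>(A, x). \<Phi> A x)"
    "\<And>x. x \<in> topspace M - K \<Longrightarrow> \<Phi> (mat 1) x = x"
    "\<And>A B x. A \<in> rotations_fixing \<nu> \<Longrightarrow> B \<in> rotations_fixing \<nu> \<Longrightarrow> x \<in> topspace M - K \<Longrightarrow>
        \<Phi> (A ** B) x = \<Phi> A (\<Phi> B x)"
    "\<And>A x. A \<in> rotations_fixing \<nu> \<Longrightarrow> x \<in> topspace M - K \<Longrightarrow> f (\<Phi> A x) = p + A *v (f x - p)"
    unfolding rotationally_symmetric_outside_compact_def Let_def by auto
  interpret rotational_end "TYPE('n)" M f p \<nu> K \<Phi>
    using M n rot by unfold_locales auto
  have one: "one_ended M" and comp: "complete_hypersurface M f" using M by auto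
  obtain c where c: "\<And>x. x \<in> topspace M \<Longrightarrow> \<nu> \<bullet> f x = c" using height_constant_on_M[OF one] by blast
  have "compactin M {}" by simp
  then obtain C where "C \<noteq> {}" "C \<subseteq> topspace M - {}" by (rule end_complement_compact[OF one])
  then have ne: "topspace M \<noteq> {}" by blast
  have \<nu>: "\<nu> \<noteq> 0" "\<nu> \<bullet> \<nu> = 1" using rot(1) by (auto simp: dot_square_norm)
  have "f x \<in> hyperplane (c *\<^sub>R \<nu>) \<nu>" if "x \<in> topspace M" for x
  proof -
    have "f x \<bullet> \<nu> = c" using c[OF that] by (simp only: inner_commute)
    then show ?thesis by (simp add: hyperplane_def inner_diff_left \<nu>(2))
  qed
  then have "homeomorphic_map M (top_of_set (hyperplane (c *\<^sub>R \<nu>) \<nu>)) f"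
    by (rule in_hyperplane_complete_imp_homeomorphic[OF \<nu>(1) _ comp ne])
  then show "\<exists>p \<nu>. \<nu> \<noteq> 0 \<and> homeomorphic_map M (top_of_set (hyperplane p \<nu>)) f" using \<nu>(1) by blast
next
  fix M :: "'a topology" and f :: "'a \<Rightarrow> real^'d"
  assume "\<exists>p \<nu>. \<nu> \<noteq> 0 \<and> homeomorphic_map M (top_of_set (hyperplane p \<nu>)) f"
  then obtain p \<nu> where \<nu>: "\<nu> \<noteq> 0" "homeomorphic_map M (top_of_set (hyperplane p \<nu>)) f" by blast
  obtain A :: "real^'n \<Rightarrow> real^'d" and B s where "planar_hypersurface M f p (\<nu> /\<^sub>R norm \<nu>) A B s"
    using homeomorphic_hyperplane_imp_planar[OF d n \<nu>] by blast
  then interpret planar_hypersurface "TYPE('n)" M f p "\<nu> /\<^sub>R norm \<nu>" A B s .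
  show "hypersurface TYPE('n) (CARD('n) + 1) M f" "complete_hypersurface M f" "one_ended M"
    "scalar_flat TYPE('n) (CARD('n) + 1) M f" "rotationally_symmetric_outside_compact M f"
    by (rule is_hypersurface is_complete is_one_ended is_scalar_flat is_rotationally_symmetric)+
qed

end
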